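(* Let $F,\Delta$ be fixed integers. There is a polynomial-time algorithm which, given a tree $T=(V,E)$ rooted in $d$ with maximum degree at most $\Delta$, a function $f:E\to\mathbb{N}$ with $f(e)\le F$ for all $e\in E$, and a function $g:E\times\{1,\dots,F\}\to\mathbb{N}$, decides whether there exists a closed walk $w$ starting at $d$ such that (i) every edge $e$ of $T$ is traversed exactly $f(e)$ times (respectively, at most $f(e)$ times) in each of the two directions, and (ii) for every edge $e$ and every $y\le f(e)$, there are at most $g(e,y)$ steps between the $y$-th and the $(y+1)$-st traversals of $e$, taken cyclically. As a consequence, there is a polynomial-time algorithm deciding whether an $L,c,t,f$-vehicle route on $T$ exists.
   Context: For the consequence: $T$ is unweighted (all edge lengths $1$) and is equipped with a depot $d$ and priorities $p:E\to\{1,\dots,z\}$. $T^s$ is the symmetric orientation of $T$ (each edge replaced by two opposite arcs). External parameters: maximum route length $L$; $f:E\to\mathbb{Z}^+$ bounding traversal frequency; $t:\{1,\dots,z\}\times\mathbb{Z}^+\to\mathbb{Q}^+$; capacity $c\le1$. An $L,c,t,f$-vehicle route is a closed walk $w=(e_1,\dots,e_\ell)$ in $T^s$ from $d$ in which each arc appears at least once and at most $f(e)$ times, the total length is at most $L$, for every edge $e$ the total length between the $i$-th and $(i+1)$-th traversals of $e$ is at most $t(p(e),i)L$, and the route visits $d$ within every sub-route of total length bigger than $cL$. *)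

theory Defs
  imports
    "Graph_Theory.Graph_Theory"
    "HOL-Library.Sublist"
    "HOL-Computational_Algebra.Polynomial"
begin

section \<open>Polynomial-time decidability\<close>

text \<open>
  The machine model is a first-order, call-by-value functional language over binary trees, with
  mutually recursive one-argument functions, in the style of the languages F and WHILE of
  N. D. Jones, \<^emph>\<open>Computability and Complexity from a Programming Perspective\<close>. The run time is the
  number of evaluation steps, and every step costs one unit. The only way to inspect a value is to
  branch on the root of a tree. With values stored as a directed acyclic graph a run of \<open>n\<close> steps
  is simulated by a Turing machine in time polynomial in \<open>n\<close> and the size of the input; conversely
  a Turing machine is simulated with a constant number of steps per move. So the problems decided
  in polynomial time are exactly those in P.
\<close>

datatype data = Leaf | Node data data

datatype expr =
    Var nat
  | ELeaf
  | ENode expr expr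
  | Let expr expr
  | Branch expr expr expr
  | Call nat expr

text \<open>
  A program is the list of its function bodies. Variables are de Bruijn indices: the body of a
  function sees its argument as \<open>Var 0\<close>, \<open>Let\<close> binds one variable, and the last branch of
  \<open>Branch\<close> binds the left (index 0) and the right (index 1) subtree.
  \<open>eval P env e v n\<close> means that \<open>e\<close> evaluates to \<open>v\<close> in \<open>n\<close> steps.
\<close>

type_synonym prog = "expr list"

inductive eval :: "prog \<Rightarrow> data list \<Rightarrow> expr \<Rightarrow> data \<Rightarrow> nat \<Rightarrow> bool" for P where
  Var: "i < length env \<Longrightarrow> eval P env (Var i) (env ! i) 1"
| Leaf: "eval P env ELeaf Leaf 1"
| Node: "eval P env a v m \<Longrightarrow> eval P env b w n \<Longrightarrow>
    eval P env (ENode a b) (Node v w) (m + n + 1)"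
| Let: "eval P env a v m \<Longrightarrow> eval P (v # env) b w n \<Longrightarrow> eval P env (Let a b) w (m + n + 1)"
| Branch_Leaf: "eval P env a Leaf m \<Longrightarrow> eval P env b w n \<Longrightarrow>
    eval P env (Branch a b c) w (m + n + 1)"
| Branch_Node: "eval P env a (Node l r) m \<Longrightarrow> eval P (l # r # env) c w n \<Longrightarrow>
    eval P env (Branch a b c) w (m + n + 1)"
| Call: "eval P env a v m \<Longrightarrow> i < length P \<Longrightarrow> eval P [v] (P ! i) w n \<Longrightarrow>
    eval P env (Call i a) w (m + n + 1)"

inductive_cases eval_VarE: "eval P env (Var i) v n"
inductive_cases eval_ELeafE: "eval P env ELeaf v n"
inductive_cases eval_ENodeE: "eval P env (ENode a b) v n"
inductive_cases eval_LetE: "eval P env (Let a b) v n"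
inductive_cases eval_BranchE: "eval P env (Branch a b c) v n"
inductive_cases eval_CallE: "eval P env (Call i a) v n"

lemma eval_deterministic:
  assumes "eval P env e v m" and "eval P env e w n"
  shows "v = w \<and> m = n"
  using assms
proof (induction arbitrary: w n rule: eval.induct)
  case (Var i env)
  then show ?case by (auto elim: eval_VarE)
next
  case (Leaf env)
  then show ?case by (auto elim: eval_ELeafE)
next
  case (Node env a v m b u k)
  from Node.prems show ?case
    by (rule eval_ENodeE) (auto dest: Node.IH)
next
  case (Let env a v m b u k)
  from Let.prems show ?case
    by (rule eval_LetE) (auto dest!: Let.IH)
next
  case (Branch_Leaf env a m b u k c)
  from Branch_Leaf.prems show ?case
    by (rule eval_BranchE) (auto dest!: Branch_Leaf.IH)
next
  case (Branch_Node env a l r m c u k b)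
  from Branch_Node.prems show ?case
    by (rule eval_BranchE) (auto dest!: Branch_Node.IH)
next
  case (Call env a v m i u k)
  from Call.prems show ?case
    by (rule eval_CallE) (auto dest!: Call.IH)
qed

text \<open>
  A decision problem is given by the set \<open>I\<close> of its instances, an encoding of the instances as
  trees, and the set of yes-instances \<open>Q\<close>; the answer ``no'' is \<open>Leaf\<close>. The library function
  \<open>size\<close> counts the inner nodes of a tree.
\<close>

definition polytime_decidable :: "'a set \<Rightarrow> ('a \<Rightarrow> data) \<Rightarrow> ('a \<Rightarrow> bool) \<Rightarrow> bool" where
  "polytime_decidable I enc Q \<longleftrightarrow>
    (\<exists>(P :: prog) (q :: nat poly). \<forall>x\<in>I. \<exists>v n.
      eval P [enc x] (Call 0 (Var 0)) v n \<and>
      n \<le> poly q (size (enc x)) \<and>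
      (v \<noteq> Leaf \<longleftrightarrow> Q x))"

text \<open>Numbers are encoded in binary, least significant bit first.\<close>

fun enc_nat :: "nat \<Rightarrow> data" where
  "enc_nat n = (if n = 0 then Leaf
     else Node (if odd n then Node Leaf Leaf else Leaf) (enc_nat (n div 2)))"

declare enc_nat.simps [simp del]

definition enc_list :: "('a \<Rightarrow> data) \<Rightarrow> 'a list \<Rightarrow> data" where
  "enc_list enc xs = foldr (\<lambda>x. Node (enc x)) xs Leaf"

text \<open>Only used for non-negative rationals.\<close>

definition enc_rat :: "rat \<Rightarrow> data" where
  "enc_rat r = (case quotient_of r of (a, b) \<Rightarrow> Node (enc_nat (nat a)) (enc_nat (nat b)))"


section \<open>Rooted trees as input\<close>

text \<open>
  The vertices and edges of \<open>T\<close> are listed in an arbitrary order, every edge once, with its two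
  ends in an arbitrary order. Functions on the edges take the edge as the set of its ends.
\<close>

record tree_input =
  vertex_list :: "nat list"
  edge_list :: "(nat \<times> nat) list"
  depot :: nat

definition edges :: "'z tree_input_scheme \<Rightarrow> nat set set" where
  "edges T = (\<lambda>(u, v). {u, v}) ` set (edge_list T)"

definition sym_orient :: "'z tree_input_scheme \<Rightarrow> nat pair_pre_digraph" where
  "sym_orient T = \<lparr> pverts = set (vertex_list T), parcs = {(u, v). {u, v} \<in> edges T} \<rparr>"

text \<open>
  The predicate \<open>tree\<close> of \<open>Graph_Theory\<close> forbids directed cycles, and every edge of a symmetric
  digraph gives a directed cycle of length two. The cycles of the undirected graph \<open>T\<close> are the
  directed cycles of its symmetric orientation of length at least three.
\<close>

definition is_rooted_tree :: "'z tree_input_scheme \<Rightarrow> bool" where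
  "is_rooted_tree T \<longleftrightarrow>
    distinct (vertex_list T) \<and>
    distinct (map (\<lambda>(u, v). {u, v}) (edge_list T)) \<and>
    (\<forall>(u, v)\<in>set (edge_list T). u \<noteq> v \<and> u \<in> set (vertex_list T) \<and> v \<in> set (vertex_list T)) \<and>
    depot T \<in> set (vertex_list T) \<and>
    strongly_connected (with_proj (sym_orient T)) \<and>
    \<not> (\<exists>c. pre_digraph.cycle (with_proj (sym_orient T)) c \<and> 3 \<le> length c)"

definition max_degree_le :: "nat \<Rightarrow> 'z tree_input_scheme \<Rightarrow> bool" where
  "max_degree_le D T \<longleftrightarrow> (\<forall>v\<in>set (vertex_list T). card {e \<in> edges T. v \<in> e} \<le> D)"

definition closed_walk_from_depot :: "'z tree_input_scheme \<Rightarrow> (nat \<times> nat) list \<Rightarrow> bool" where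
  "closed_walk_from_depot T w \<longleftrightarrow>
    pre_digraph.awalk (with_proj (sym_orient T)) (depot T) w (depot T)"

text \<open>
  The traversals of an edge are counted separately in each of the two directions, that is, for each
  of its two arcs. \<open>positions a w\<close> lists the increasing positions of \<open>a\<close> in \<open>w\<close>.
\<close>

definition positions :: "'b \<Rightarrow> 'b list \<Rightarrow> nat list" where
  "positions a w = filter (\<lambda>i. w ! i = a) [0..<length w]"

text \<open>
  Position of the \<open>y\<close>-th traversal (\<open>y \<ge> 1\<close>) of \<open>a\<close> in the periodic repetition of the closed
  walk \<open>w\<close>; only meaningful if \<open>a\<close> occurs in \<open>w\<close>. If \<open>a\<close> occurs exactly \<open>k\<close> times, then the
  traversal \<open>k + 1\<close> is the first one of the next round.
\<close>

definition cyclic_position :: "'b \<Rightarrow> 'b list \<Rightarrow> nat \<Rightarrow> nat" where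
  "cyclic_position a w y =
    (let ps = positions a w; k = length ps
     in ps ! ((y - 1) mod k) + ((y - 1) div k) * length w)"

definition cyclic_gap :: "'b \<Rightarrow> 'b list \<Rightarrow> nat \<Rightarrow> nat" where
  "cyclic_gap a w y = cyclic_position a w (y + 1) - cyclic_position a w y"


section \<open>Closed walks with prescribed frequencies and gaps\<close>

record freq_input = tree_input +
  freq :: "nat set \<Rightarrow> nat"

record walk_input = freq_input +
  gap :: "nat set \<Rightarrow> nat \<Rightarrow> nat"

definition walk_instances :: "nat \<Rightarrow> nat \<Rightarrow> walk_input set" where
  "walk_instances F D = {X. is_rooted_tree X \<and> max_degree_le D X \<and> (\<forall>e\<in>edges X. freq X e \<le> F)}"

definition enc_walk_input :: "nat \<Rightarrow> walk_input \<Rightarrow> data" where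
  "enc_walk_input F X =
    Node (enc_nat (depot X))
      (Node (enc_list enc_nat (vertex_list X))
        (enc_list (\<lambda>(u, v).
            Node (Node (enc_nat u) (enc_nat v))
              (Node (enc_nat (freq X {u, v}))
                (enc_list (\<lambda>y. enc_nat (gap X {u, v} y)) [1..<F + 1])))
          (edge_list X)))"

text \<open>
  The bound for \<open>y\<close> asserts in particular that the \<open>y\<close>-th traversal exists in the periodic
  repetition of \<open>w\<close>, i.e. that the arc is used. Without this the empty walk would always meet the
  version with at most \<open>freq X e\<close> traversals.
\<close>

definition gaps_ok :: "walk_input \<Rightarrow> (nat \<times> nat) list \<Rightarrow> bool" where
  "gaps_ok X w \<longleftrightarrow>
    (\<forall>(u, v)\<in>parcs (sym_orient X). \<forall>y\<in>{1..freq X {u, v}}.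
      (u, v) \<in> set w \<and> cyclic_gap (u, v) w y \<le> gap X {u, v} y)"

definition exact_walk :: "walk_input \<Rightarrow> (nat \<times> nat) list \<Rightarrow> bool" where
  "exact_walk X w \<longleftrightarrow>
    closed_walk_from_depot X w \<and>
    (\<forall>(u, v)\<in>parcs (sym_orient X). count_list w (u, v) = freq X {u, v}) \<and>
    gaps_ok X w"

definition at_most_walk :: "walk_input \<Rightarrow> (nat \<times> nat) list \<Rightarrow> bool" where
  "at_most_walk X w \<longleftrightarrow>
    closed_walk_from_depot X w \<and>
    (\<forall>(u, v)\<in>parcs (sym_orient X). count_list w (u, v) \<le> freq X {u, v}) \<and>
    gaps_ok X w"


section \<open>Vehicle routes\<close>

record vehicle_input = freq_input +
  num_prio :: nat
  prio :: "nat set \<Rightarrow> nat"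
  time_frac :: "nat \<Rightarrow> nat \<Rightarrow> rat"
  max_length :: rat
  capacity :: rat

definition vehicle_instances :: "nat \<Rightarrow> nat \<Rightarrow> vehicle_input set" where
  "vehicle_instances F D = {X.
    is_rooted_tree X \<and> max_degree_le D X \<and>
    (\<forall>e\<in>edges X. 1 \<le> freq X e \<and> freq X e \<le> F) \<and>
    (\<forall>e\<in>edges X. prio X e \<in> {1..num_prio X}) \<and>
    (\<forall>q\<in>{1..num_prio X}. \<forall>i\<ge>1. 0 < time_frac X q i) \<and>
    0 \<le> max_length X \<and>
    0 \<le> capacity X \<and> capacity X \<le> 1}"

text \<open>
  No arc is traversed more than \<open>F\<close> times, so the table of \<open>time_frac X\<close> stops at \<open>F\<close>.
\<close>

definition enc_vehicle_input :: "nat \<Rightarrow> vehicle_input \<Rightarrow> data" where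
  "enc_vehicle_input F X =
    Node (enc_nat (depot X))
      (Node (enc_list enc_nat (vertex_list X))
        (Node
          (enc_list (\<lambda>(u, v).
              Node (Node (enc_nat u) (enc_nat v))
                (Node (enc_nat (freq X {u, v})) (enc_nat (prio X {u, v}))))
            (edge_list X))
          (Node
            (enc_list (\<lambda>q. enc_list (\<lambda>i. enc_rat (time_frac X q i)) [1..<F + 1])
              [1..<num_prio X + 1])
            (Node (enc_rat (max_length X)) (enc_rat (capacity X))))))"

text \<open>
  All edges have length 1, so the length of a route is its number of arcs. Sub-routes that pass the
  end of \<open>w\<close> cyclically always visit the depot, hence it suffices to look at contiguous sublists.
\<close>

definition vehicle_route :: "vehicle_input \<Rightarrow> (nat \<times> nat) list \<Rightarrow> bool" where
  "vehicle_route X w \<longleftrightarrow>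
    closed_walk_from_depot X w \<and>
    (\<forall>(u, v)\<in>parcs (sym_orient X).
      1 \<le> count_list w (u, v) \<and> count_list w (u, v) \<le> freq X {u, v}) \<and>
    of_nat (length w) \<le> max_length X \<and>
    (\<forall>(u, v)\<in>parcs (sym_orient X). \<forall>i\<in>{1..<count_list w (u, v)}.
      of_nat (positions (u, v) w ! i - positions (u, v) w ! (i - 1))
        \<le> time_frac X (prio X {u, v}) i * max_length X) \<and>
    (\<forall>s. sublist s w \<and> capacity X * max_length X < of_nat (length s) \<longrightarrow>
      depot X \<in> fst ` set s \<union> snd ` set s)"

end

theory Submission
  imports Defs
begin

text \<open>
  A closed walk of length \<open>N\<close> is the same as a choice of a set of traversal times below \<open>N\<close> for
  every arc that satisfies a condition at every vertex: the arcs out of a vertex have disjoint sets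
  of times, and every departure at time \<open>t\<close> follows an arrival at time \<open>t - 1\<close> and conversely, except
  that at the depot there is a departure at time 0 and the arrival at time \<open>N - 1\<close> has no successor.
  Since only the depot has a departure without a preceding arrival, no second walk can be present
  besides the one that starts there. The gap conditions concern the times of a single arc, and the
  condition on visits of the depot concerns the arcs at the depot.

  As an arc has at most \<open>F\<close> times and a vertex has at most \<open>D\<close> edges, there are polynomially many
  assignments of times to the edges at one vertex. Along a tree, such local
  assignments can be glued together as soon as each has a matching one at every neighbour. Repeatedly
  deleting the local assignments without a match therefore decides whether a walk of length \<open>N\<close>
  exists, and \<open>N\<close> is at most \<open>2 F |E|\<close>.
\<close>

section \<open>Closure properties of polynomial-time functions\<close>

text \<open>The length \<open>N\<close> of the walk is tried out because it enters the local
  condition at the depot and the cyclic gaps. Once it is fixed, every requirement concerns one edge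
  or one vertex. The times of both arcs of an edge form a single candidate, so neighbouring vertices
  need to agree on one item only.

  The machine has no arithmetic, so the procedure is composed from functions known to be polynomial
  (\<open>polyf\<close>). \<open>F\<close> and \<open>D\<close> are constants of the program and
  determine the degree of its time bound, through \<open>lists_upto\<close>. Quantities bounded by
  the length of a walk are unary. The input is binary and may be exponentially large: vertex names
  are only compared for equality; frequencies, priorities and gaps are cut off at a unary bound;
  products of rationals are compared exactly through lists of exponents.

  The condition on visits of the depot becomes a bound \<open>K\<close> on the arcs between a
  departure from the depot and a later arrival there. The problem without it uses
  \<open>K = N\<close>, which forbids nothing.\<close>

fun shift_calls :: "nat \<Rightarrow> expr \<Rightarrow> expr" where
  "shift_calls k (Var i) = Var i"
| "shift_calls k ELeaf = ELeaf"
| "shift_calls k (ENode a b) = ENode (shift_calls k a) (shift_calls k b)"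
| "shift_calls k (Let a b) = Let (shift_calls k a) (shift_calls k b)"
| "shift_calls k (Branch a b c) = Branch (shift_calls k a) (shift_calls k b) (shift_calls k c)"
| "shift_calls k (Call i a) = Call (i + k) (shift_calls k a)"

text \<open>Calls name absolute positions in the program, so code placed behind \<open>Q\<close>
  keeps its meaning once every call is raised by \<open>length Q\<close>.\<close>

lemma eval_shift_calls:
  assumes "eval P env e v n"
  shows "eval (Q @ map (shift_calls (length Q)) P) env (shift_calls (length Q) e) v n"
  using assms
proof induction
  case (Call env a v m i w n)
  then show ?case
    using eval.Call[of _ env _ v m] by (simp add: nth_append)
qed (simp_all only: shift_calls.simps, (rule eval.intros; assumption)+)

lemma eval_append:
  assumes "eval P env e v n"
  shows "eval (P @ Q) env e v n"
  using assms
proof induction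
  case (Call env a v m i w n)
  then show ?case
    using eval.Call[of _ env _ v m] by (simp add: nth_append)
qed (rule eval.intros; assumption)+

lemma eval_steps_eq: "eval P env e v n \<Longrightarrow> n = m \<Longrightarrow> eval P env e v m"
  by simp

text \<open>Natural coefficients are non-negative. Monotonicity is what allows a size to be replaced
  by a bound for it inside a polynomial.\<close>

lemma poly_nat_mono: "m \<le> n \<Longrightarrow> poly (q :: nat poly) m \<le> poly q n"
  by (induction q) (auto intro!: add_mono mult_mono)

text \<open>\<open>x\<close> ranges over the whole type, not over the instances of a problem.
  Functions can then be composed without side conditions on their arguments.\<close>

definition runs :: "prog \<Rightarrow> nat \<Rightarrow> ('a \<Rightarrow> data) \<Rightarrow> ('b \<Rightarrow> data) \<Rightarrow> ('a \<Rightarrow> 'b) \<Rightarrow> nat poly \<Rightarrow> bool" where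
  "runs P i A B f q \<longleftrightarrow> i < length P \<and> (\<forall>x. \<exists>n. eval P [A x] (P ! i) (B (f x)) n \<and>
     n \<le> poly q (size (A x)) \<and> size (B (f x)) \<le> poly q (size (A x)))"

text \<open>
  The size of the result has to be bounded separately: subtrees are shared, so a program can build a
  tree of exponential size in linearly many steps.
\<close>

definition polyf :: "('a \<Rightarrow> data) \<Rightarrow> ('b \<Rightarrow> data) \<Rightarrow> ('a \<Rightarrow> 'b) \<Rightarrow> bool" where
  "polyf A B f \<longleftrightarrow> (\<exists>P i q. runs P i A B f q)"

lemma runs_append:
  assumes "runs P i A B f q" shows "runs (P @ Q) i A B f q"
  using assms unfolding runs_def by (auto simp: nth_append intro: eval_append)

lemma runs_prepend:
  assumes "runs P i A B f q"
  shows "runs (Q @ map (shift_calls (length Q)) P) (i + length Q) A B f q"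
  using assms unfolding runs_def by (auto simp: nth_append) (metis eval_shift_calls)

lemma runs_weaken:
  assumes "runs P i A B f q" and "\<forall>n. poly q n \<le> poly q' n"
  shows "runs P i A B f q'"
  using assms unfolding runs_def by (meson order_trans)

text \<open>Programs are linked one after another. \<open>P\<close> stays a prefix, so entry points
  found earlier keep their numbers, and the new bound dominates the old one.\<close>

lemma polyf_extend:
  assumes "polyf A B f"
  obtains P' i q' where "runs (P @ P') i A B f q'" "\<forall>n. poly q n \<le> poly q' n"
proof -
  from assms obtain P0 i0 q0 where "runs P0 i0 A B f q0" unfolding polyf_def by blast
  then have "runs (P @ map (shift_calls (length P)) P0) (i0 + length P) A B f (q0 + q)"
    by (auto intro: runs_weaken[OF runs_prepend])
  then show ?thesis by (rule that) simp
qed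

lemma polyf_join2:
  assumes "polyf A B f" "polyf A' B' g"
  obtains P i j q where "runs P i A B f q" "runs P j A' B' g q"
proof -
  from assms(1) obtain P i q where 1: "runs P i A B f q" unfolding polyf_def by blast
  obtain P' j q' where 2: "runs (P @ P') j A' B' g q'" "\<forall>n. poly q n \<le> poly q' n"
    by (rule polyf_extend[OF assms(2), where P = P and q = q])
  from runs_weaken[OF runs_append[OF 1] 2(2)] 2(1) show ?thesis by (rule that)
qed

lemma polyf_join3:
  assumes "polyf A B f" "polyf A' B' g" "polyf A'' B'' h"
  obtains P i j k q where "runs P i A B f q" "runs P j A' B' g q" "runs P k A'' B'' h q"
proof -
  obtain P i j q where 1: "runs P i A B f q" "runs P j A' B' g q"
    by (rule polyf_join2[OF assms(1,2)])
  obtain P' k q' where 2: "runs (P @ P') k A'' B'' h q'" "\<forall>n. poly q n \<le> poly q' n"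
    by (rule polyf_extend[OF assms(3), where P = P and q = q])
  from runs_weaken[OF runs_append[OF 1(1)] 2(2)] runs_weaken[OF runs_append[OF 1(2)] 2(2)] 2(1)
  show ?thesis by (rule that)
qed

lemma eval_Call_runs:
  assumes "runs P i A B f q" and "eval (P @ Q) env a (A x) m"
  obtains n where "eval (P @ Q) env (Call i a) (B (f x)) n"
    "n \<le> m + poly q (size (A x)) + 1" "size (B (f x)) \<le> poly q (size (A x))"
proof -
  from assms(1)[THEN runs_append, of Q, unfolded runs_def, THEN conjunct2, rule_format, of x]
  obtain k where k: "eval (P @ Q) [A x] ((P @ Q) ! i) (B (f x)) k"
    "k \<le> poly q (size (A x))" "size (B (f x)) \<le> poly q (size (A x))"
    by auto
  moreover have "i < length (P @ Q)" using assms(1) by (simp add: runs_def)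
  ultimately show ?thesis
    using eval.Call[OF assms(2) _ k(1)] by (intro that[of "m + k + 1"]) auto
qed

lemma polyfI:
  assumes "\<And>x. \<exists>n. eval (P @ [e]) [A x] e (B (f x)) n \<and> n \<le> poly q (size (A x)) \<and>
    size (B (f x)) \<le> poly q (size (A x))"
  shows "polyf A B f"
  unfolding polyf_def runs_def
  by (rule exI[of _ "P @ [e]"], rule exI[of _ "length P"], rule exI[of _ q]) (simp add: assms)

lemma polyf_comp:
  assumes "polyf A B f" and "polyf B C g"
  shows "polyf A C (\<lambda>x. g (f x))"
proof -
  obtain P i j q where f: "runs P i A B f q" and g: "runs P j B C g q"
    by (rule polyf_join2[OF assms])
  let ?e = "Call j (Call i (Var 0))"
  \<comment> \<open>The second call is charged by the size of the intermediate value, itself at most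
    \<open>q\<close>; hence the composition. The constant pays for the variable and the two
    calls.\<close>
  let ?q = "q + pcompose q q + [:3:]"
  show ?thesis
  proof (rule polyfI[of P ?e _ _ _ ?q])
    fix x
    have "eval (P @ [?e]) [A x] (Var 0) (A x) 1" using eval.Var[of 0 "[A x]"] by simp
    then obtain m where m: "eval (P @ [?e]) [A x] (Call i (Var 0)) (B (f x)) m"
      "m \<le> 1 + poly q (size (A x)) + 1" "size (B (f x)) \<le> poly q (size (A x))"
      by (rule eval_Call_runs[OF f])
    obtain n where n: "eval (P @ [?e]) [A x] ?e (C (g (f x))) n"
      "n \<le> m + poly q (size (B (f x))) + 1" "size (C (g (f x))) \<le> poly q (size (B (f x)))"
      by (rule eval_Call_runs[OF g m(1)])
    have "poly q (size (B (f x))) \<le> poly q (poly q (size (A x)))"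
      by (rule poly_nat_mono) (rule m(3))
    then show "\<exists>n. eval (P @ [?e]) [A x] ?e (C (g (f x))) n \<and> n \<le> poly ?q (size (A x)) \<and>
      size (C (g (f x))) \<le> poly ?q (size (A x))"
      using m n by (intro exI[of _ n]) (auto simp: poly_pcompose)
  qed
qed

section \<open>Pairs, constants and branching\<close>

definition enc_prod :: "('a \<Rightarrow> data) \<Rightarrow> ('b \<Rightarrow> data) \<Rightarrow> 'a \<times> 'b \<Rightarrow> data" where
  "enc_prod A B p = Node (A (fst p)) (B (snd p))"

definition enc_bool :: "bool \<Rightarrow> data" where
  "enc_bool b = (if b then Node Leaf Leaf else Leaf)"

lemma enc_prod_simp [simp]: "enc_prod A B (a, b) = Node (A a) (B b)"
  by (simp add: enc_prod_def)

lemma enc_list_simps [simp]: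
  "enc_list A [] = Leaf" "enc_list A (x # xs) = Node (A x) (enc_list A xs)"
  by (simp_all add: enc_list_def)

lemma enc_bool_simps [simp]: "enc_bool True = Node Leaf Leaf" "enc_bool False = Leaf"
  by (simp_all add: enc_bool_def)

lemma eval_Var_eq: "i < length env \<Longrightarrow> env ! i = v \<Longrightarrow> eval P env (Var i) v 1"
  using eval.Var by blast

lemma polyf_id: "polyf A A (\<lambda>x. x)"
  by (rule polyfI[of "[]" "Var 0" _ _ _ "[:1, 1:]"]) (auto intro!: exI[of _ 1] eval_Var_eq)

lemma polyf_fst: "polyf A (enc_prod B C) f \<Longrightarrow> polyf A B (\<lambda>x. fst (f x))"
proof (erule polyf_comp, rule polyfI[of "[]" "Branch (Var 0) ELeaf (Var 0)" _ _ _ "[:3, 1:]"])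
  fix p :: "'b \<times> 'c"
  have "eval ([] @ [Branch (Var 0) ELeaf (Var 0)]) [enc_prod B C p]
    (Branch (Var 0) ELeaf (Var 0)) (B (fst p)) (1 + 1 + 1)"
    by (intro eval.Branch_Node eval_Var_eq) (auto simp: enc_prod_def)
  then show "\<exists>n. eval ([] @ [Branch (Var 0) ELeaf (Var 0)]) [enc_prod B C p]
    (Branch (Var 0) ELeaf (Var 0)) (B (fst p)) n \<and> n \<le> poly [:3, 1:] (size (enc_prod B C p)) \<and>
    size (B (fst p)) \<le> poly [:3, 1:] (size (enc_prod B C p))"
    by (intro exI conjI) (auto simp: enc_prod_def)
qed

lemma polyf_snd: "polyf A (enc_prod B C) f \<Longrightarrow> polyf A C (\<lambda>x. snd (f x))"
proof (erule polyf_comp, rule polyfI[of "[]" "Branch (Var 0) ELeaf (Var 1)" _ _ _ "[:3, 1:]"])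
  fix p :: "'b \<times> 'c"
  have "eval ([] @ [Branch (Var 0) ELeaf (Var 1)]) [enc_prod B C p]
    (Branch (Var 0) ELeaf (Var 1)) (C (snd p)) (1 + 1 + 1)"
    by (intro eval.Branch_Node eval_Var_eq) (auto simp: enc_prod_def)
  then show "\<exists>n. eval ([] @ [Branch (Var 0) ELeaf (Var 1)]) [enc_prod B C p]
    (Branch (Var 0) ELeaf (Var 1)) (C (snd p)) n \<and> n \<le> poly [:3, 1:] (size (enc_prod B C p)) \<and>
    size (C (snd p)) \<le> poly [:3, 1:] (size (enc_prod B C p))"
    by (intro exI conjI) (auto simp: enc_prod_def)
qed

fun const_expr :: "data \<Rightarrow> expr" where
  "const_expr Leaf = ELeaf"
| "const_expr (Node a b) = ENode (const_expr a) (const_expr b)"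

lemma eval_const_expr: "eval P env (const_expr d) d (2 * size d + 1)"
proof (induction d)
  case (Node a b)
  from eval.Node[OF Node.IH] show ?case by simp
qed (use eval.Leaf in simp)

lemma polyf_const: "polyf A B (\<lambda>x. c)"
  by (rule polyfI[of "[]" "const_expr (B c)" _ _ _ "[:2 * size (B c) + 1:]"])
    (use eval_const_expr in force)

text \<open>Pairs, list cells and unary successors are all a single \<open>Node\<close>; leaving the
  encoding \<open>D\<close> open lets one rule serve all three.\<close>

lemma polyf_Node:
  assumes "polyf A B f" and "polyf A C g" and "\<And>x. D (h x) = Node (B (f x)) (C (g x))"
  shows "polyf A D h"
proof -
  obtain P i j q where f: "runs P i A B f q" and g: "runs P j A C g q"
    by (rule polyf_join2[OF assms(1,2)])
  let ?e = "ENode (Call i (Var 0)) (Call j (Var 0))"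
  show ?thesis
  proof (rule polyfI[of P ?e _ _ _ "q + q + [:5:]"])
    fix x
    have v: "eval (P @ [?e]) [A x] (Var 0) (A x) 1" by (rule eval_Var_eq) auto
    obtain m where m: "eval (P @ [?e]) [A x] (Call i (Var 0)) (B (f x)) m"
      "m \<le> 1 + poly q (size (A x)) + 1" "size (B (f x)) \<le> poly q (size (A x))"
      by (rule eval_Call_runs[OF f v])
    obtain n where n: "eval (P @ [?e]) [A x] (Call j (Var 0)) (C (g x)) n"
      "n \<le> 1 + poly q (size (A x)) + 1" "size (C (g x)) \<le> poly q (size (A x))"
      by (rule eval_Call_runs[OF g v])
    from eval.Node[OF m(1) n(1)] m n
    show "\<exists>n. eval (P @ [?e]) [A x] ?e (D (h x)) n \<and> n \<le> poly (q + q + [:5:]) (size (A x)) \<and>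
      size (D (h x)) \<le> poly (q + q + [:5:]) (size (A x))"
      unfolding assms(3) by (intro exI conjI) auto
  qed
qed

lemma polyf_Pair:
  "polyf A B f \<Longrightarrow> polyf A C g \<Longrightarrow> polyf A (enc_prod B C) (\<lambda>x. (f x, g x))"
  by (erule polyf_Node, assumption) auto

lemma polyf_Cons:
  "polyf A B f \<Longrightarrow> polyf A (enc_list B) g \<Longrightarrow> polyf A (enc_list B) (\<lambda>x. f x # g x)"
  by (erule polyf_Node, assumption) auto

lemma polyf_if:
  assumes "polyf A enc_bool b" and "polyf A B f" and "polyf A B g"
  shows "polyf A B (\<lambda>x. if b x then f x else g x)"
proof -
  obtain P i j k q where b: "runs P i A enc_bool b q" and f: "runs P j A B f q"
    and g: "runs P k A B g q"
    by (rule polyf_join3[OF assms])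
  \<comment> \<open>\<open>True\<close> is a node, whose branch binds the two subtrees; there the
    argument has moved to index 2.\<close>
  let ?e = "Branch (Call i (Var 0)) (Call k (Var 0)) (Call j (Var 2))"
  show ?thesis
  proof (rule polyfI[of P ?e _ _ _ "q + q + [:5:]"])
    fix x
    have v: "eval (P @ [?e]) [A x] (Var 0) (A x) 1" by (rule eval_Var_eq) auto
    have v': "eval (P @ [?e]) [Leaf, Leaf, A x] (Var 2) (A x) 1" by (rule eval_Var_eq) auto
    obtain l where l: "eval (P @ [?e]) [A x] (Call i (Var 0)) (enc_bool (b x)) l"
      "l \<le> 1 + poly q (size (A x)) + 1"
      by (rule eval_Call_runs[OF b v])
    obtain m where m: "eval (P @ [?e]) [Leaf, Leaf, A x] (Call j (Var 2)) (B (f x)) m"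
      "m \<le> 1 + poly q (size (A x)) + 1" "size (B (f x)) \<le> poly q (size (A x))"
      by (rule eval_Call_runs[OF f v'])
    obtain n where n: "eval (P @ [?e]) [A x] (Call k (Var 0)) (B (g x)) n"
      "n \<le> 1 + poly q (size (A x)) + 1" "size (B (g x)) \<le> poly q (size (A x))"
      by (rule eval_Call_runs[OF g v])
    show "\<exists>n. eval (P @ [?e]) [A x] ?e (B (if b x then f x else g x)) n \<and>
      n \<le> poly (q + q + [:5:]) (size (A x)) \<and>
      size (B (if b x then f x else g x)) \<le> poly (q + q + [:5:]) (size (A x))"
    proof (cases "b x")
      case True
      with l have "eval (P @ [?e]) [A x] (Call i (Var 0)) (Node Leaf Leaf) l" by simp
      from eval.Branch_Node[OF this m(1)] True l m show ?thesis
        by (intro exI conjI) auto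
    next
      case False
      with l have "eval (P @ [?e]) [A x] (Call i (Var 0)) Leaf l" by simp
      from eval.Branch_Leaf[OF this n(1)] False l n show ?thesis
        by (intro exI conjI) auto
    qed
  qed
qed

lemma polyf_list_case:
  assumes "polyf A (enc_list X) L" and "polyf A B f"
    and "polyf (enc_prod X (enc_prod (enc_list X) A)) B (\<lambda>p. g (fst p) (fst (snd p)) (snd (snd p)))"
  shows "polyf A B (\<lambda>s. case L s of [] \<Rightarrow> f s | x # xs \<Rightarrow> g x xs s)"
proof -
  obtain P i j k q where L: "runs P i A (enc_list X) L q" and f: "runs P j A B f q"
    and g: "runs P k (enc_prod X (enc_prod (enc_list X) A)) B
      (\<lambda>p. g (fst p) (fst (snd p)) (snd (snd p))) q"
    by (rule polyf_join3[OF assms])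
  let ?e = "Branch (Call i (Var 0)) (Call j (Var 0)) (Call k (ENode (Var 0) (ENode (Var 1) (Var 2))))"
  let ?q = "q + q + pcompose q (q + [:1, 1:]) + [:10:]"
  show ?thesis
  proof (rule polyfI[of P ?e _ _ _ ?q])
    fix s
    have v: "eval (P @ [?e]) [A s] (Var 0) (A s) 1" by (rule eval_Var_eq) auto
    obtain l where l: "eval (P @ [?e]) [A s] (Call i (Var 0)) (enc_list X (L s)) l"
      "l \<le> 1 + poly q (size (A s)) + 1" "size (enc_list X (L s)) \<le> poly q (size (A s))"
      by (rule eval_Call_runs[OF L v])
    show "\<exists>n. eval (P @ [?e]) [A s] ?e (B (case L s of [] \<Rightarrow> f s | x # xs \<Rightarrow> g x xs s)) n \<and>
      n \<le> poly ?q (size (A s)) \<and>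
      size (B (case L s of [] \<Rightarrow> f s | x # xs \<Rightarrow> g x xs s)) \<le> poly ?q (size (A s))"
    proof (cases "L s")
      case Nil
      obtain m where m: "eval (P @ [?e]) [A s] (Call j (Var 0)) (B (f s)) m"
        "m \<le> 1 + poly q (size (A s)) + 1" "size (B (f s)) \<le> poly q (size (A s))"
        by (rule eval_Call_runs[OF f v])
      from Nil l have "eval (P @ [?e]) [A s] (Call i (Var 0)) Leaf l" by simp
      from eval.Branch_Leaf[OF this m(1)] Nil l m show ?thesis
        by (intro exI conjI) auto
    next
      case (Cons x xs)
      let ?env = "[X x, enc_list X xs, A s]"
      have "eval (P @ [?e]) ?env (ENode (Var 0) (ENode (Var 1) (Var 2)))
        (enc_prod X (enc_prod (enc_list X) A) (x, xs, s)) (1 + (1 + 1 + 1) + 1)"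
        unfolding enc_prod_simp by (intro eval.Node eval_Var_eq) auto
      then obtain m where m: "eval (P @ [?e]) ?env
        (Call k (ENode (Var 0) (ENode (Var 1) (Var 2)))) (B (g x xs s)) m"
        "m \<le> 5 + poly q (size (Node (X x) (Node (enc_list X xs) (A s)))) + 1"
        "size (B (g x xs s)) \<le> poly q (size (Node (X x) (Node (enc_list X xs) (A s))))"
        by (rule eval_Call_runs[OF g]) simp
      have "poly q (size (Node (X x) (Node (enc_list X xs) (A s))))
        \<le> poly q (poly (q + [:1, 1:]) (size (A s)))"
        by (rule poly_nat_mono) (use l(3) Cons in auto)
      moreover from Cons l have "eval (P @ [?e]) [A s] (Call i (Var 0)) (Node (X x) (enc_list X xs)) l"
        by simp
      ultimately show ?thesis
        using eval.Branch_Node[OF _ m(1)] Cons l m by (intro exI conjI) (auto simp: poly_pcompose)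
    qed
  qed
qed

section \<open>Recursion along lists\<close>

lemma length_le_size_enc_list: "length xs \<le> size (enc_list A xs)"
  by (induction xs) auto

lemma size_enc_list_append: "size (enc_list A (xs @ ys)) = size (enc_list A xs) + size (enc_list A ys)"
  by (induction xs) auto

lemma size_enc_list_mem: "x \<in> set xs \<Longrightarrow> size (A x) \<le> size (enc_list A xs)"
  by (induction xs) auto

text \<open>Iterating a polynomial step can produce exponentially large values, so a bound
  \<open>r\<close> on all accumulators is a hypothesis. The accumulators of \<open>foldr\<close> are
  its values on the suffixes of the list.\<close>

lemma polyf_foldr:
  assumes L: "polyf A (enc_list X) L" and f: "polyf A B f"
    and g: "polyf (enc_prod X (enc_prod B A)) B (\<lambda>p. g (fst p) (fst (snd p)) (snd (snd p)))"
    and r: "\<And>s xs ys. L s = ys @ xs \<Longrightarrow>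
      size (B (foldr (\<lambda>x a. g x a s) xs (f s))) \<le> poly r (size (A s))"
  shows "polyf A B (\<lambda>s. foldr (\<lambda>x a. g x a s) (L s) (f s))"
proof -
  let ?h = "\<lambda>xs s. foldr (\<lambda>x a. g x a s) xs (f s)"
  obtain P i j k q where L: "runs P i A (enc_list X) L q" and f: "runs P j A B f q"
    and g: "runs P k (enc_prod X (enc_prod B A)) B (\<lambda>p. g (fst p) (fst (snd p)) (snd (snd p))) q"
    by (rule polyf_join3[OF assms(1-3)])
  let ?loop = "Suc (length P)"
  let ?e = "Call ?loop (ENode (Call i (Var 0)) (Var 0))"
  \<comment> \<open>The loop takes a pair of the remaining list and the state. Inside the second
    branch index 1 is the tail and index 3 the state.\<close>
  let ?b = "Branch (Var 0) ELeaf (Branch (Var 0) (Call j (Var 1))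
    (Call k (ENode (Var 0) (ENode (Call ?loop (ENode (Var 1) (Var 3))) (Var 3)))))"
  let ?P = "P @ [?e, ?b]"
  \<comment> \<open>The cost of one round: 20 for the fixed instructions, \<open>poly q a\<close>
    for the final call of \<open>f\<close>, and the nested term for a call of \<open>g\<close>,
    whose argument consists of a list element, an accumulator, the state and two nodes.\<close>
  define t where "t a = 20 + poly q a + poly q (poly q a + poly r a + a + 2)" for a
  have loop: "\<exists>n. eval ?P [Node (enc_list X xs) (A s)] ?b (B (?h xs s)) n \<and>
      n \<le> t (size (A s)) * (length xs + 1)" if "L s = ys @ xs"
      and sz: "size (enc_list X (L s)) \<le> poly q (size (A s))" for s xs ys
    using that(1)
  proof (induction xs arbitrary: ys)
    case Nil
    let ?env = "[Leaf, A s, Node Leaf (A s)]"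
    have "eval ?P ?env (Var 1) (A s) 1" by (rule eval_Var_eq) auto
    then obtain m where m: "eval ?P ?env (Call j (Var 1)) (B (f s)) m"
      "m \<le> 1 + poly q (size (A s)) + 1"
      by (rule eval_Call_runs[OF f])
    have "eval ?P [Node Leaf (A s)] ?b (B (f s)) (1 + (1 + m + 1) + 1)"
      by (rule eval.Branch_Node[OF _ eval.Branch_Leaf[OF _ m(1)]]; rule eval_Var_eq) auto
    then show ?case using m(2) by (intro exI conjI) (auto simp: t_def)
  next
    case (Cons x xs)
    from Cons.IH[of "ys @ [x]"] Cons.prems obtain n where
      n: "eval ?P [Node (enc_list X xs) (A s)] ?b (B (?h xs s)) n"
        "n \<le> t (size (A s)) * (length xs + 1)" by auto
    let ?env = "[X x, enc_list X xs, Node (X x) (enc_list X xs), A s,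
      Node (Node (X x) (enc_list X xs)) (A s)]"
    let ?a = "ENode (Var 0) (ENode (Call ?loop (ENode (Var 1) (Var 3))) (Var 3))"
    have "eval ?P ?env (Call ?loop (ENode (Var 1) (Var 3))) (B (?h xs s)) ((1 + 1 + 1) + n + 1)"
    proof (rule eval.Call)
      show "eval ?P ?env (ENode (Var 1) (Var 3)) (Node (enc_list X xs) (A s)) (1 + 1 + 1)"
        by (intro eval.Node eval_Var_eq) auto
    qed (use n(1) in \<open>auto simp: nth_append\<close>)
    then have "eval ?P ?env ?a (Node (X x) (Node (B (?h xs s)) (A s)))
      (1 + (((1 + 1 + 1) + n + 1) + 1 + 1) + 1)"
      by (intro eval.Node eval_Var_eq) auto
    then have "eval ?P ?env ?a (enc_prod X (enc_prod B A) (x, ?h xs s, s)) (n + 8)"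
      unfolding enc_prod_simp by (rule eval_steps_eq) simp
    then obtain m where m: "eval ?P ?env (Call k ?a) (B (g x (?h xs s) s)) m"
      "m \<le> (n + 8) + poly q (size (Node (X x) (Node (B (?h xs s)) (A s)))) + 1"
      by (rule eval_Call_runs[OF g]) simp
    have "eval ?P [Node (enc_list X (x # xs)) (A s)] ?b (B (?h (x # xs) s)) (1 + (1 + m + 1) + 1)"
      unfolding enc_list_simps foldr.simps o_apply
      by (rule eval.Branch_Node[OF _ eval.Branch_Node[OF _ m(1)]]; rule eval_Var_eq) auto
    moreover have "poly q (size (Node (X x) (Node (B (?h xs s)) (A s))))
      \<le> poly q (poly q (size (A s)) + poly r (size (A s)) + size (A s) + 2)"
    proof (rule poly_nat_mono)
      have "size (X x) \<le> poly q (size (A s))"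
        using size_enc_list_mem[of x "L s" X] sz Cons.prems by auto
      moreover have "size (B (?h xs s)) \<le> poly r (size (A s))"
        using r[of s "ys @ [x]" xs] Cons.prems by simp
      ultimately show "size (Node (X x) (Node (B (?h xs s)) (A s)))
        \<le> poly q (size (A s)) + poly r (size (A s)) + size (A s) + 2" by simp
    qed
    ultimately show ?case using m(2) n(2) by (intro exI conjI) (auto simp: t_def)
  qed
  \<comment> \<open>The first factor is \<open>t\<close> as a polynomial; the second bounds the
    number of rounds, since a list has no more elements than nodes.\<close>
  let ?q = "([:20:] + q + pcompose q (q + r + [:2, 1:])) * (q + [:1:]) + q + r + [:20:]"
  have run: "\<exists>n. eval ?P [A s] ?e (B (?h (L s) s)) n \<and> n \<le> poly ?q (size (A s)) \<and>
    size (B (?h (L s) s)) \<le> poly ?q (size (A s))" for s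
  proof -
    have "eval ?P [A s] (Var 0) (A s) 1" by (rule eval_Var_eq) auto
    then obtain l where l: "eval ?P [A s] (Call i (Var 0)) (enc_list X (L s)) l"
      "l \<le> 1 + poly q (size (A s)) + 1" "size (enc_list X (L s)) \<le> poly q (size (A s))"
      by (rule eval_Call_runs[OF L])
    obtain n where n: "eval ?P [Node (enc_list X (L s)) (A s)] ?b (B (?h (L s) s)) n"
        "n \<le> t (size (A s)) * (length (L s) + 1)" using loop[of s "[]"] l(3) by auto
    have "eval ?P [A s] ?e (B (?h (L s) s)) ((l + 1 + 1) + n + 1)"
    proof (rule eval.Call)
      show "eval ?P [A s] (ENode (Call i (Var 0)) (Var 0)) (Node (enc_list X (L s)) (A s)) (l + 1 + 1)"
        by (intro eval.Node eval_Var_eq l(1)) auto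
    qed (use n(1) in \<open>auto simp: nth_append\<close>)
    moreover have "n \<le> t (size (A s)) * (poly q (size (A s)) + 1)"
      by (rule order_trans[OF n(2)])
        (use l(3) length_le_size_enc_list[of "L s" X] in \<open>auto intro!: mult_mono\<close>)
    moreover have "t (size (A s)) = poly ([:20:] + q + pcompose q (q + r + [:2, 1:])) (size (A s))"
      by (simp add: t_def poly_pcompose algebra_simps)
    moreover have "size (B (?h (L s) s)) \<le> poly r (size (A s))" by (rule r[of s "[]"]) simp
    ultimately show ?thesis using l(2) by (intro exI conjI) auto
  qed
  have "runs ?P (length P) A B (\<lambda>s. ?h (L s) s) ?q"
    unfolding runs_def using run by (auto simp: nth_append)
  then show ?thesis unfolding polyf_def by blast
qed

text \<open>A decision procedure is entered at function 0, so a jump to the actual entry point is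
  put in front and everything else moves up by one.\<close>

lemma polyf_polytime:
  assumes "polyf A enc_bool f"
  obtains P q where "\<And>x. \<exists>v n. eval P [A x] (Call 0 (Var 0)) v n \<and> n \<le> poly q (size (A x)) \<and>
      (v \<noteq> Leaf \<longleftrightarrow> f x)"
proof -
  obtain P i q where "runs P i A enc_bool f q" using assms unfolding polyf_def by blast
  let ?P = "Call (Suc i) (Var 0) # map (shift_calls 1) P"
  from runs_prepend[OF \<open>runs P i A enc_bool f q\<close>, of "[Call (Suc i) (Var 0)]"]
  have r: "runs ?P (Suc i) A enc_bool f q" by simp
  show ?thesis
  proof (rule that[of ?P "q + [:5:]"])
    fix x
    from r obtain n where n: "eval ?P [A x] (?P ! Suc i) (enc_bool (f x)) n"
      "n \<le> poly q (size (A x))" "Suc i < length ?P" unfolding runs_def by meson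
    have v: "eval ?P [A x] (Var 0) (A x) 1" by (rule eval_Var_eq) auto
    have "eval ?P [A x] (?P ! 0) (enc_bool (f x)) (1 + n + 1)"
      unfolding nth_Cons_0 by (rule eval.Call[OF v n(3,1)])
    from eval.Call[OF v _ this]
    have "eval ?P [A x] (Call 0 (Var 0)) (enc_bool (f x)) (1 + (1 + n + 1) + 1)" by simp
    moreover have "enc_bool (f x) \<noteq> Leaf \<longleftrightarrow> f x" by (simp add: enc_bool_def)
    ultimately show "\<exists>v n. eval ?P [A x] (Call 0 (Var 0)) v n \<and> n \<le> poly (q + [:5:]) (size (A x)) \<and>
      (v \<noteq> Leaf \<longleftrightarrow> f x)" using n(2)
      by (intro exI conjI) auto
  qed
qed

named_theorems polyf_intros

declare polyf_id [polyf_intros] polyf_const [polyf_intros] polyf_fst [polyf_intros]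
  polyf_snd [polyf_intros] polyf_Pair [polyf_intros] polyf_Cons [polyf_intros] polyf_if [polyf_intros]

lemma polyf_size:
  assumes "polyf A B f"
  obtains q where "\<And>x. size (B (f x)) \<le> poly q (size (A x))"
  using assms unfolding polyf_def runs_def by blast

text \<open>A program sees encodings only. Values of different types may share them: a list of units
  is a unary number, a list of bits a binary one.\<close>

lemma polyf_enc_cong:
  assumes "polyf A B f" and "\<And>x. B (f x) = C (g x)"
  shows "polyf A C g"
  using assms unfolding polyf_def runs_def by auto

text \<open>
  The body of a bound variable \<open>x\<close> is a function of the pair \<open>p\<close> of \<open>x\<close> and the surrounding state.
  In the rules below it is written with the projections of \<open>p\<close>, so that they apply by pattern
  unification.
\<close>

lemma polyf_app2:
  assumes "polyf (enc_prod X A) B (\<lambda>p. h (fst p) (snd p))" and "polyf S X f" and "polyf S A g"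
  shows "polyf S B (\<lambda>s. h (f s) (g s))"
  using polyf_comp[OF polyf_Pair[OF assms(2,3)] assms(1)] by simp

section \<open>Equality of encoded values\<close>

definition eq_body :: expr where
  "eq_body = Branch (Var 0) ELeaf
    (Branch (Var 0) (Branch (Var 1) (ENode ELeaf ELeaf) ELeaf)
      (Branch (Var 3) ELeaf
        (Branch (Call 0 (ENode (Var 2) (Var 0))) ELeaf (Call 0 (ENode (Var 5) (Var 3))))))"

text \<open>The right subtrees are compared only if the left ones agree, and each recursive call
  descends in both trees, so the calls are bounded by the size of the first tree. In the innermost
  branch the indices 0, 1 are the subtrees of \<open>b\<close> and 2, 3 those of \<open>a\<close>;
  they move up by two once the first comparison has succeeded.\<close>

lemma eval_eq_body:
  "\<exists>n. eval [eq_body] [Node a b] eq_body (enc_bool (a = b)) n \<and> n \<le> 40 * size a + 20"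
proof (induction a arbitrary: b)
  case Leaf
  show ?case
  proof (cases b)
    case L: Leaf
    have "eval [eq_body] [Node Leaf Leaf] eq_body (Node Leaf Leaf) (1 + (1 + (1 + (1 + 1 + 1) + 1) + 1) + 1)"
      unfolding eq_body_def
      by (rule eval.Branch_Node, rule eval_Var_eq, simp, simp,
        rule eval.Branch_Leaf, rule eval_Var_eq, simp, simp,
        rule eval.Branch_Leaf, rule eval_Var_eq, simp, simp, intro eval.intros)
    with L show ?thesis by (intro exI conjI) auto
  next
    case (Node l r)
    have "eval [eq_body] [Node Leaf b] eq_body Leaf (1 + (1 + (1 + 1 + 1) + 1) + 1)"
      unfolding eq_body_def Node
      by (rule eval.Branch_Node, rule eval_Var_eq, simp, simp,
        rule eval.Branch_Leaf, rule eval_Var_eq, simp, simp,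
        rule eval.Branch_Node, rule eval_Var_eq, simp, simp, rule eval.intros)
    with Node show ?thesis by (intro exI conjI) auto
  qed
next
  case (Node al ar)
  show ?case
  proof (cases b)
    case Leaf
    have "eval [eq_body] [Node (Node al ar) b] eq_body Leaf (1 + (1 + (1 + 1 + 1) + 1) + 1)"
      unfolding eq_body_def Leaf
      by (rule eval.Branch_Node, rule eval_Var_eq, simp, simp,
        rule eval.Branch_Node, rule eval_Var_eq, simp, simp,
        rule eval.Branch_Leaf, rule eval_Var_eq, simp, simp, rule eval.intros)
    with Leaf show ?thesis by (intro exI conjI) auto
  next
    case b: (Node bl br)
    let ?env = "[bl, br, al, ar, Node al ar, b, Node (Node al ar) b]"
    obtain m where m: "eval [eq_body] [Node al bl] eq_body (enc_bool (al = bl)) m"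
      "m \<le> 40 * size al + 20" using Node.IH(1) by blast
    obtain n where n: "eval [eq_body] [Node ar br] eq_body (enc_bool (ar = br)) n"
      "n \<le> 40 * size ar + 20" using Node.IH(2) by blast
    have 1: "eval [eq_body] ?env (Call 0 (ENode (Var 2) (Var 0))) (enc_bool (al = bl)) ((1 + 1 + 1) + m + 1)"
    proof (rule eval.Call)
      show "eval [eq_body] ?env (ENode (Var 2) (Var 0)) (Node al bl) (1 + 1 + 1)"
        by (intro eval.Node eval_Var_eq) auto
    qed (use m(1) in auto)
    have 2: "eval [eq_body] (Leaf # Leaf # ?env) (Call 0 (ENode (Var 5) (Var 3))) (enc_bool (ar = br)) ((1 + 1 + 1) + n + 1)"
    proof (rule eval.Call)
      show "eval [eq_body] (Leaf # Leaf # ?env) (ENode (Var 5) (Var 3)) (Node ar br) (1 + 1 + 1)"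
        by (intro eval.Node eval_Var_eq) auto
    qed (use n(1) in auto)
    have "\<exists>k. eval [eq_body] ?env (Branch (Call 0 (ENode (Var 2) (Var 0))) ELeaf (Call 0 (ENode (Var 5) (Var 3))))
      (enc_bool (Node al ar = b)) k \<and> k \<le> m + n + 10"
    proof (cases "al = bl")
      case True
      then have "eval [eq_body] ?env (Call 0 (ENode (Var 2) (Var 0))) (Node Leaf Leaf) ((1 + 1 + 1) + m + 1)"
        using 1 by simp
      from eval.Branch_Node[OF this 2] True b show ?thesis by (intro exI conjI) auto
    next
      case False
      then have "eval [eq_body] ?env (Call 0 (ENode (Var 2) (Var 0))) Leaf ((1 + 1 + 1) + m + 1)"
        using 1 by simp
      from eval.Branch_Leaf[OF this eval.Leaf] False b show ?thesis by (intro exI conjI) auto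
    qed
    then obtain k where k: "eval [eq_body] ?env (Branch (Call 0 (ENode (Var 2) (Var 0))) ELeaf (Call 0 (ENode (Var 5) (Var 3))))
      (enc_bool (Node al ar = b)) k" "k \<le> m + n + 10" by blast
    have "eval [eq_body] [Node (Node al ar) b] (Branch (Var 0) ELeaf
    (Branch (Var 0) (Branch (Var 1) (ENode ELeaf ELeaf) ELeaf)
      (Branch (Var 3) ELeaf
        (Branch (Call 0 (ENode (Var 2) (Var 0))) ELeaf (Call 0 (ENode (Var 5) (Var 3)))))))
      (enc_bool (Node al ar = b)) (1 + (1 + (1 + k + 1) + 1) + 1)"
      by (rule eval.Branch_Node, rule eval_Var_eq, simp, simp,
        rule eval.Branch_Node, rule eval_Var_eq, simp, simp,
        rule eval.Branch_Node, rule eval_Var_eq, simp, simp add: b, use k(1) in simp)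
    then show ?thesis using k(2) m(2) n(2) unfolding eq_body_def[symmetric]
      by (intro exI conjI) auto
  qed
qed

lemma polyf_eq_data: "polyf (enc_prod (\<lambda>d. d) (\<lambda>d. d)) enc_bool (\<lambda>p. fst p = snd p)"
  unfolding polyf_def runs_def
proof (rule exI[of _ "[eq_body]"], rule exI[of _ 0], rule exI[of _ "[:20, 40:]"], intro conjI allI)
  fix p :: "data \<times> data"
  obtain a b where p: "p = (a, b)" by fastforce
  obtain n where "eval [eq_body] [Node a b] eq_body (enc_bool (a = b)) n" "n \<le> 40 * size a + 20"
    using eval_eq_body by blast
  then have "eval [eq_body] [enc_prod (\<lambda>d. d) (\<lambda>d. d) p] ([eq_body] ! 0) (enc_bool (fst p = snd p)) n
    \<and> n \<le> poly [:20, 40:] (size (enc_prod (\<lambda>d. d) (\<lambda>d. d) p))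
    \<and> size (enc_bool (fst p = snd p)) \<le> poly [:20, 40:] (size (enc_prod (\<lambda>d. d) (\<lambda>d. d) p))"
    unfolding p by (auto simp: enc_bool_def)
  then show "\<exists>n. eval [eq_body] [enc_prod (\<lambda>d. d) (\<lambda>d. d) p] ([eq_body] ! 0) (enc_bool (fst p = snd p)) n
    \<and> n \<le> poly [:20, 40:] (size (enc_prod (\<lambda>d. d) (\<lambda>d. d) p))
    \<and> size (enc_bool (fst p = snd p)) \<le> poly [:20, 40:] (size (enc_prod (\<lambda>d. d) (\<lambda>d. d) p))" ..
qed auto

text \<open>Values are compared through their encodings, hence the demand that \<open>X\<close> be
  injective.\<close>

lemma polyf_eq:
  assumes "polyf A X f" and "polyf A X g" and "inj X"
  shows "polyf A enc_bool (\<lambda>s. f s = g s)"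
proof -
  have "polyf A enc_bool (\<lambda>s. X (f s) = X (g s))"
    using polyf_comp[OF polyf_Pair[OF polyf_enc_cong[OF assms(1)] polyf_enc_cong[OF assms(2)]] polyf_eq_data]
    by simp
  then show ?thesis using assms(3) by (simp add: inj_eq)
qed

section \<open>Boolean connectives and list operations\<close>

lemma polyf_conj [polyf_intros]:
  assumes "polyf A enc_bool f" "polyf A enc_bool g"
  shows "polyf A enc_bool (\<lambda>s. f s \<and> g s)"
  by (rule polyf_enc_cong[OF polyf_if[OF assms polyf_const[of A enc_bool False]]]) simp

lemma polyf_disj [polyf_intros]:
  assumes "polyf A enc_bool f" "polyf A enc_bool g"
  shows "polyf A enc_bool (\<lambda>s. f s \<or> g s)"
  by (rule polyf_enc_cong[OF polyf_if[OF assms(1) polyf_const[of A enc_bool True] assms(2)]]) simp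

lemma polyf_not [polyf_intros]:
  assumes "polyf A enc_bool f"
  shows "polyf A enc_bool (\<lambda>s. \<not> f s)"
  by (rule polyf_enc_cong[OF polyf_if[OF assms polyf_const[of A enc_bool False]
        polyf_const[of A enc_bool True]]]) simp

lemma polyf_imp [polyf_intros]:
  assumes "polyf A enc_bool f" "polyf A enc_bool g"
  shows "polyf A enc_bool (\<lambda>s. f s \<longrightarrow> g s)"
  by (rule polyf_enc_cong[OF polyf_disj[OF polyf_not[OF assms(1)] assms(2)]]) auto

lemma polyf_map [polyf_intros]:
  assumes L: "polyf A (enc_list X) L"
    and h: "polyf (enc_prod X A) B (\<lambda>p. h (fst p) (snd p))"
  shows "polyf A (enc_list B) (\<lambda>s. map (\<lambda>x. h x s) (L s))"
proof -
  obtain q where q: "\<And>s. size (enc_list X (L s)) \<le> poly q (size (A s))"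
    by (rule polyf_size[OF L]) blast
  obtain r where r: "\<And>p. size (B (h (fst p) (snd p))) \<le> poly r (size (enc_prod X A p))"
    by (rule polyf_size[OF h]) blast
  have "polyf A (enc_list B) (\<lambda>s. foldr (\<lambda>x a. h x s # a) (L s) [])"
  proof (rule polyf_foldr[OF L polyf_const])
    show "polyf (enc_prod X (enc_prod (enc_list B) A)) (enc_list B)
      (\<lambda>p. h (fst p) (snd (snd p)) # fst (snd p))"
      by (rule polyf_intros polyf_app2[OF h])+
    fix s xs ys assume s: "L s = ys @ xs"
    \<comment> \<open>Bounds the size of one image together with the list cell that holds
      it.\<close>
    let ?b = "poly r (poly q (size (A s)) + size (A s) + 1) + 1"
    have *: "size (enc_list X xs) \<le> poly q (size (A s))"
      using q[of s] s by (simp add: size_enc_list_append)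
    have "size (enc_list B (foldr (\<lambda>x a. h x s # a) xs [])) \<le> ?b * length xs"
      using *
    proof (induction xs)
      case (Cons x xs)
      have "size (B (h x s)) \<le> poly r (size (enc_prod X A (x, s)))" using r[of "(x, s)"] by simp
      also have "\<dots> \<le> poly r (poly q (size (A s)) + size (A s) + 1)"
        by (rule poly_nat_mono) (use Cons.prems in auto)
      finally show ?case using Cons by simp
    qed simp
    also have "\<dots> \<le> ?b * poly q (size (A s))"
      using * length_le_size_enc_list[of xs X] by (intro mult_left_mono) auto
    also have "\<dots> = poly ((pcompose r (q + [:1, 1:]) + [:1:]) * q) (size (A s))"
      by (simp add: poly_pcompose algebra_simps)
    finally show "size (enc_list B (foldr (\<lambda>x a. h x s # a) xs []))
      \<le> poly ((pcompose r (q + [:1, 1:]) + [:1:]) * q) (size (A s))" .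
  qed
  moreover have "foldr (\<lambda>x a. h x s # a) xs [] = map (\<lambda>x. h x s) xs" for s xs
    by (induction xs) auto
  ultimately show ?thesis by simp
qed

lemma polyf_filter [polyf_intros]:
  assumes L: "polyf A (enc_list X) L"
    and h: "polyf (enc_prod X A) enc_bool (\<lambda>p. h (fst p) (snd p))"
  shows "polyf A (enc_list X) (\<lambda>s. filter (\<lambda>x. h x s) (L s))"
proof -
  obtain q where q: "\<And>s. size (enc_list X (L s)) \<le> poly q (size (A s))"
    by (rule polyf_size[OF L]) blast
  have f: "foldr (\<lambda>x a. if h x s then x # a else a) xs [] = filter (\<lambda>x. h x s) xs" for s xs
    by (induction xs) auto
  have "polyf A (enc_list X) (\<lambda>s. foldr (\<lambda>x a. if h x s then x # a else a) (L s) [])"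
  proof (rule polyf_foldr[OF L polyf_const])
    show "polyf (enc_prod X (enc_prod (enc_list X) A)) (enc_list X)
      (\<lambda>p. if h (fst p) (snd (snd p)) then fst p # fst (snd p) else fst (snd p))"
      by (rule polyf_intros polyf_app2[OF h])+
    fix s xs ys assume s: "L s = ys @ xs"
    have "size (enc_list X (filter (\<lambda>x. h x s) xs)) \<le> size (enc_list X xs)"
      by (induction xs) auto
    then show "size (enc_list X (foldr (\<lambda>x a. if h x s then x # a else a) xs []))
      \<le> poly q (size (A s))" using q[of s] s by (simp add: f size_enc_list_append)
  qed
  then show ?thesis by (simp add: f)
qed

lemma polyf_append [polyf_intros]:
  assumes L: "polyf A (enc_list X) L" and M: "polyf A (enc_list X) M"
  shows "polyf A (enc_list X) (\<lambda>s. L s @ M s)"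
proof -
  obtain q where q: "\<And>s. size (enc_list X (L s)) \<le> poly q (size (A s))"
    by (rule polyf_size[OF L]) blast
  obtain r where r: "\<And>s. size (enc_list X (M s)) \<le> poly r (size (A s))"
    by (rule polyf_size[OF M]) blast
  have f: "foldr (\<lambda>x a. x # a) xs zs = xs @ zs" for xs zs :: "'b list"
    by (induction xs) auto
  have "polyf A (enc_list X) (\<lambda>s. foldr (\<lambda>x a. x # a) (L s) (M s))"
  proof (rule polyf_foldr[OF L M])
    show "polyf (enc_prod X (enc_prod (enc_list X) A)) (enc_list X) (\<lambda>p. fst p # fst (snd p))"
      by (rule polyf_intros)+
    fix s xs ys assume s: "L s = ys @ xs"
    then show "size (enc_list X (foldr (\<lambda>x a. x # a) xs (M s))) \<le> poly (q + r) (size (A s))"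
      using q[of s] r[of s] by (simp add: f size_enc_list_append)
  qed
  then show ?thesis by (simp add: f)
qed

lemma polyf_concat [polyf_intros]:
  assumes L: "polyf A (enc_list (enc_list X)) L"
  shows "polyf A (enc_list X) (\<lambda>s. concat (L s))"
proof -
  obtain q where q: "\<And>s. size (enc_list (enc_list X) (L s)) \<le> poly q (size (A s))"
    by (rule polyf_size[OF L]) blast
  have f: "foldr (\<lambda>x a. x @ a) xs [] = concat xs" for xs :: "'b list list"
    by (induction xs) auto
  have "polyf A (enc_list X) (\<lambda>s. foldr (\<lambda>x a. x @ a) (L s) [])"
  proof (rule polyf_foldr[OF L polyf_const])
    show "polyf (enc_prod (enc_list X) (enc_prod (enc_list X) A)) (enc_list X) (\<lambda>p. fst p @ fst (snd p))"
      by (rule polyf_intros)+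
    fix s xs ys assume s: "L s = ys @ xs"
    have "size (enc_list X (concat xs)) \<le> size (enc_list (enc_list X) xs)"
      by (induction xs) (auto simp: size_enc_list_append)
    then show "size (enc_list X (foldr (\<lambda>x a. x @ a) xs [])) \<le> poly q (size (A s))"
      using q[of s] s by (simp add: f size_enc_list_append)
  qed
  then show ?thesis by (simp add: f)
qed

lemma polyf_Ball [polyf_intros]:
  assumes L: "polyf A (enc_list X) L"
    and h: "polyf (enc_prod X A) enc_bool (\<lambda>p. h (fst p) (snd p))"
  shows "polyf A enc_bool (\<lambda>s. \<forall>x\<in>set (L s). h x s)"
proof -
  have f: "foldr (\<lambda>x a. h x s \<and> a) xs True \<longleftrightarrow> (\<forall>x\<in>set xs. h x s)" for s xs
    by (induction xs) auto
  have "polyf A enc_bool (\<lambda>s. foldr (\<lambda>x a. h x s \<and> a) (L s) True)"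
  proof (rule polyf_foldr[OF L polyf_const])
    show "polyf (enc_prod X (enc_prod enc_bool A)) enc_bool
      (\<lambda>p. h (fst p) (snd (snd p)) \<and> fst (snd p))"
      by (rule polyf_intros polyf_app2[OF h])+
    show "size (enc_bool (foldr (\<lambda>x a. h x s \<and> a) xs True)) \<le> poly [:1:] (size (A s))" for s xs
      by (simp add: enc_bool_def)
  qed
  then show ?thesis by (simp add: f)
qed

lemma polyf_Bex [polyf_intros]:
  assumes L: "polyf A (enc_list X) L"
    and h: "polyf (enc_prod X A) enc_bool (\<lambda>p. h (fst p) (snd p))"
  shows "polyf A enc_bool (\<lambda>s. \<exists>x\<in>set (L s). h x s)"
  using polyf_not[OF polyf_Ball[OF L polyf_not[OF h]]] by simp

lemma polyf_mem [polyf_intros]: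
  assumes "polyf A X f" "polyf A (enc_list X) L" "inj X"
  shows "polyf A enc_bool (\<lambda>s. f s \<in> set (L s))"
proof -
  have "polyf A enc_bool (\<lambda>s. \<exists>x\<in>set (L s). x = f s)"
    by (rule assms(2,3) polyf_intros polyf_eq polyf_comp[OF _ assms(1)])+
  then show ?thesis by simp
qed

lemma polyf_tl [polyf_intros]: "polyf A (enc_list X) L \<Longrightarrow> polyf A (enc_list X) (\<lambda>s. tl (L s))"
  unfolding tl_def by (rule polyf_list_case polyf_intros | assumption)+

section \<open>Unary and binary numbers\<close>

text \<open>The size of the encoding is the number itself, and as a list of leaves it turns
  appending into addition and dropping into truncated subtraction.\<close>

definition enc_unary :: "nat \<Rightarrow> data" where
  "enc_unary n = enc_list (\<lambda>_. Leaf) (replicate n ())"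

lemma enc_unary_simps [simp]: "enc_unary 0 = Leaf" "enc_unary (Suc n) = Node Leaf (enc_unary n)"
  by (simp_all add: enc_unary_def)

lemma size_enc_unary [simp]: "size (enc_unary n) = n"
  by (induction n) auto

lemma inj_enc_unary: "inj enc_unary"
  by (metis injI size_enc_unary)

lemma polyf_replicate: "polyf A enc_unary k \<Longrightarrow> polyf A (enc_list (\<lambda>_. Leaf)) (\<lambda>s. replicate (k s) ())"
  by (erule polyf_enc_cong) (simp add: enc_unary_def)

lemma polyf_length [polyf_intros]: "polyf A (enc_list X) L \<Longrightarrow> polyf A enc_unary (\<lambda>s. length (L s))"
proof (rule polyf_enc_cong[OF polyf_map[of A X L "\<lambda>_. Leaf" "\<lambda>_ _. ()"]])
  show "enc_list (\<lambda>_. Leaf) (map (\<lambda>_. ()) (L s)) = enc_unary (length (L s))" for s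
    by (simp add: enc_unary_def map_replicate_const)
qed (auto intro: polyf_const)

lemma polyf_Suc [polyf_intros]: "polyf A enc_unary f \<Longrightarrow> polyf A enc_unary (\<lambda>s. Suc (f s))"
  by (erule polyf_Node[OF polyf_const[of A "\<lambda>_. Leaf" "()"]]) simp

lemma polyf_plus [polyf_intros]:
  assumes "polyf A enc_unary f" "polyf A enc_unary g"
  shows "polyf A enc_unary (\<lambda>s. f s + g s)"
  using polyf_length[OF polyf_append[OF polyf_replicate[OF assms(1)] polyf_replicate[OF assms(2)]]]
  by simp

lemma polyf_const_times [polyf_intros]: "polyf A enc_unary f \<Longrightarrow> polyf A enc_unary (\<lambda>s. c * f s)" for c :: nat
  by (induction c) (auto intro: polyf_const polyf_plus)

text \<open>Iteration is a fold over a list of \<open>k s\<close> dummies, so only the first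
  \<open>k s\<close> iterates need a size bound.\<close>

lemma polyf_funpow:
  assumes k: "polyf A enc_unary k" and f: "polyf A B f"
    and g: "polyf (enc_prod B A) B (\<lambda>p. g (fst p) (snd p))"
    and r: "\<And>s n. n \<le> k s \<Longrightarrow> size (B (((\<lambda>a. g a s) ^^ n) (f s))) \<le> poly r (size (A s))"
  shows "polyf A B (\<lambda>s. ((\<lambda>a. g a s) ^^ k s) (f s))"
proof -
  have eq: "foldr (\<lambda>x a. g a s) xs z = ((\<lambda>a. g a s) ^^ length xs) z" for s z and xs :: "unit list"
    by (induction xs) auto
  have "polyf A B (\<lambda>s. foldr (\<lambda>x a. g a s) (replicate (k s) ()) (f s))"
  proof (rule polyf_foldr[OF polyf_replicate[OF k] f])
    show "polyf (enc_prod (\<lambda>_. Leaf) (enc_prod B A)) B (\<lambda>p. g (fst (snd p)) (snd (snd p)))"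
      by (rule polyf_intros polyf_app2[OF g])+
    fix s xs ys assume "replicate (k s) () = ys @ xs"
    then have "length xs \<le> k s" by (metis le_add2 length_append length_replicate)
    then show "size (B (foldr (\<lambda>x a. g a s) xs (f s))) \<le> poly r (size (A s))"
      unfolding eq by (rule r)
  qed
  then show ?thesis by (simp add: eq)
qed

lemma polyf_drop [polyf_intros]:
  assumes k: "polyf A enc_unary k" and L: "polyf A (enc_list X) L"
  shows "polyf A (enc_list X) (\<lambda>s. drop (k s) (L s))"
proof -
  obtain q where q: "\<And>s. size (enc_list X (L s)) \<le> poly q (size (A s))"
    by (rule polyf_size[OF L]) blast
  have eq: "(tl ^^ n) xs = drop n xs" for n and xs :: "'b list"
    by (induction n arbitrary: xs) (auto simp: funpow_Suc_right drop_Suc simp del: funpow.simps)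
  have "polyf A (enc_list X) (\<lambda>s. ((\<lambda>a. tl a) ^^ k s) (L s))"
  proof (rule polyf_funpow[OF k L])
    show "polyf (enc_prod (enc_list X) A) (enc_list X) (\<lambda>p. tl (fst p))"
      by (rule polyf_intros)+
    show "size (enc_list X (((\<lambda>a. tl a) ^^ n) (L s))) \<le> poly q (size (A s))" for s n
      using q[of s] size_enc_list_append[of X "take n (L s)" "drop n (L s)"] by (simp add: eq)
  qed
  then show ?thesis by (simp add: eq)
qed

lemma polyf_minus [polyf_intros]:
  assumes "polyf A enc_unary f" "polyf A enc_unary g"
  shows "polyf A enc_unary (\<lambda>s. f s - g s)"
  using polyf_length[OF polyf_drop[OF assms(2) polyf_replicate[OF assms(1)]]] by simp

lemma polyf_le [polyf_intros]:
  assumes "polyf A enc_unary f" "polyf A enc_unary g"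
  shows "polyf A enc_bool (\<lambda>s. f s \<le> g s)"
  using polyf_eq[OF polyf_minus[OF assms] polyf_const[of A enc_unary 0] inj_enc_unary] by simp

lemma polyf_less [polyf_intros]:
  assumes "polyf A enc_unary f" "polyf A enc_unary g"
  shows "polyf A enc_bool (\<lambda>s. f s < g s)"
  using polyf_le[OF polyf_Suc[OF assms(1)] assms(2)] by (simp add: Suc_le_eq)

lemma polyf_min [polyf_intros]:
  assumes "polyf A enc_unary f" "polyf A enc_unary g"
  shows "polyf A enc_unary (\<lambda>s. min (f s) (g s))"
  using polyf_if[OF polyf_le[OF assms] assms] by (simp add: min_def)

text \<open>A program has to return something definite past the end of the list as well; the default
  value settles what.\<close>

lemma polyf_nth_default [polyf_intros]:
  assumes "polyf A (enc_list X) L" and "polyf A enc_unary k"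
  shows "polyf A X (\<lambda>s. nth_default d (L s) (k s))"
proof -
  have "polyf A X (\<lambda>s. case drop (k s) (L s) of [] \<Rightarrow> d | x # xs \<Rightarrow> x)"
    by (rule polyf_list_case polyf_intros assms)+
  moreover have "(case drop n xs of [] \<Rightarrow> d | x # xs \<Rightarrow> x) = nth_default d xs n" for xs n
    by (auto simp: nth_default_def Cons_nth_drop_Suc[symmetric])
  ultimately show ?thesis by simp
qed


lemma inj_enc_prod: "inj A \<Longrightarrow> inj B \<Longrightarrow> inj (enc_prod A B)"
  by (auto simp: inj_def enc_prod_def prod_eq_iff)

lemma inj_enc_list: "inj A \<Longrightarrow> inj (enc_list A)"
proof (rule injI)
  fix xs ys assume "inj A" "enc_list A xs = enc_list A ys"
  then show "xs = ys"
  proof (induction xs arbitrary: ys)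
    case Nil then show ?case by (cases ys) auto
  next
    case (Cons x xs) then show ?case by (cases ys) (auto dest: injD)
  qed
qed

section \<open>Binary numbers and enumeration of times\<close>

fun bits :: "nat \<Rightarrow> bool list" where
  "bits n = (if n = 0 then [] else odd n # bits (n div 2))"

declare bits.simps [simp del]

lemma enc_nat_bits: "enc_nat n = enc_list enc_bool (bits n)"
proof (induction n rule: bits.induct)
  case (1 n)
  then show ?case
    by (cases "odd n") (auto simp: enc_nat.simps[of n] bits.simps[of n])
qed

lemma inj_enc_nat: "inj enc_nat"
proof (rule injI)
  fix m n assume "enc_nat m = enc_nat n"
  then show "m = n"
  proof (induction m arbitrary: n rule: enc_nat.induct)
    case (1 m)
    show ?case
    proof (cases "m = 0 \<or> n = 0")
      case True
      with 1(2) show ?thesis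
        by (auto simp: enc_nat.simps[of m] enc_nat.simps[of n] enc_nat.simps[of 0] split: if_splits)
    next
      case False
      then have eq: "Node (if odd m then Node Leaf Leaf else Leaf) (enc_nat (m div 2))
        = Node (if odd n then Node Leaf Leaf else Leaf) (enc_nat (n div 2))"
        using 1(2) enc_nat.simps[of m] enc_nat.simps[of n] by simp
      then have "m div 2 = n div 2" using 1(1) False by simp
      moreover have "odd m = odd n" using eq by (auto split: if_splits)
      ultimately show ?thesis by (metis even_two_times_div_two odd_two_times_div_two_succ)
    qed
  qed
qed

lemma polyf_bits: "polyf A enc_nat f \<Longrightarrow> polyf A (enc_list enc_bool) (\<lambda>s. bits (f s))"
  by (erule polyf_enc_cong) (rule enc_nat_bits)

text \<open>This is \<open>min\<close> with a unary first and a binary second argument. The separate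
  name keeps the syntax-directed rules from selecting the rule for two unary numbers.\<close>

definition clip :: "nat \<Rightarrow> nat \<Rightarrow> nat" where
  "clip m n = min m n"

text \<open>Clipping a binary number makes it small enough to be written in unary.\<close>

lemma polyf_clip [polyf_intros]:
  assumes f: "polyf A enc_nat f" and m: "polyf A enc_unary m"
  shows "polyf A enc_unary (\<lambda>s. clip (m s) (f s))"
proof -
  obtain q where q: "\<And>s. size (enc_unary (m s)) \<le> poly q (size (A s))"
    by (rule polyf_size[OF m]) blast
  \<comment> \<open>Horner's rule from the most significant bit on, as \<open>foldr\<close> starts
    at the end of the list. Clipping in every round is harmless: a value that has reached
    \<open>M\<close> does not fall below it by doubling.\<close>
  have eq: "foldr (\<lambda>b a. min M (if b then Suc (a + a) else a + a)) (bits n) 0 = min M n" for M n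
  proof (induction n rule: bits.induct)
    case (1 n)
    show ?case
    proof (cases "n = 0")
      case False
      have "n = (if odd n then Suc (n div 2 + n div 2) else n div 2 + n div 2)"
        by (auto elim!: oddE evenE)
      with 1[OF False] False show ?thesis
        by (subst bits.simps) (auto simp: min_def split: if_splits)
    qed (simp add: bits.simps)
  qed
  have "polyf A enc_unary (\<lambda>s. foldr (\<lambda>b a. min (m s) (if b then Suc (a + a) else a + a)) (bits (f s)) 0)"
  proof (rule polyf_foldr[OF polyf_bits[OF f] polyf_const])
    show "polyf (enc_prod enc_bool (enc_prod enc_unary A)) enc_unary
     (\<lambda>p. min (m (snd (snd p))) (if fst p then Suc (fst (snd p) + fst (snd p)) else fst (snd p) + fst (snd p)))"
      by (rule polyf_intros polyf_comp[OF _ m])+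
    show "size (enc_unary (foldr (\<lambda>b a. min (m s) (if b then Suc (a + a) else a + a)) xs 0))
      \<le> poly q (size (A s))" for s xs
      using q[of s] by (cases xs) auto
  qed
  then show ?thesis by (simp add: eq clip_def)
qed

lemma size_enc_list_bound:
  "(\<And>x. x \<in> set xs \<Longrightarrow> size (A x) \<le> b) \<Longrightarrow> size (enc_list A xs) \<le> (b + 1) * length xs"
  by (induction xs) (force simp: algebra_simps)+

lemma polyf_upt [polyf_intros]:
  assumes m: "polyf A enc_unary m"
  shows "polyf A (enc_list enc_unary) (\<lambda>s. [0..<m s])"
proof -
  obtain q where q: "\<And>s. size (enc_unary (m s)) \<le> poly q (size (A s))"
    by (rule polyf_size[OF m]) blast
  have eq: "((\<lambda>a. 0 # map Suc a) ^^ n) [] = [0..<n]" for n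
    by (induction n) (auto simp: map_Suc_upt upt_conv_Cons simp del: upt_Suc)
  have "polyf A (enc_list enc_unary) (\<lambda>s. ((\<lambda>a. 0 # map Suc a) ^^ m s) [])"
  proof (rule polyf_funpow[OF m polyf_const])
    show "polyf (enc_prod (enc_list enc_unary) A) (enc_list enc_unary) (\<lambda>p. 0 # map Suc (fst p))"
      by (rule polyf_intros)+
    fix s n assume "n \<le> m s"
    have "size (enc_list enc_unary [0..<n]) \<le> (n + 1) * length [0..<n]"
      by (rule size_enc_list_bound) auto
    also have "\<dots> \<le> (poly q (size (A s)) + 1) * poly q (size (A s))"
      using \<open>n \<le> m s\<close> q[of s] by (intro mult_mono) auto
    also have "\<dots> = poly ((q + [:1:]) * q) (size (A s))" by simp
    finally show "size (enc_list enc_unary (((\<lambda>a. 0 # map Suc a) ^^ n) [])) \<le> poly ((q + [:1:]) * q) (size (A s))"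
      unfolding eq .
  qed
  then show ?thesis by (simp add: eq)
qed

lemma polyf_sum_list [polyf_intros]:
  assumes L: "polyf A (enc_list enc_unary) L"
  shows "polyf A enc_unary (\<lambda>s. sum_list (L s))"
proof -
  have "polyf A (enc_list (\<lambda>_. Leaf)) (\<lambda>s. concat (map (\<lambda>n. replicate n ()) (L s)))"
    by (rule polyf_intros polyf_replicate L)+
  then have "polyf A enc_unary (\<lambda>s. length (concat (map (\<lambda>n. replicate n ()) (L s))))"
    by (rule polyf_length)
  then show ?thesis by (simp add: length_concat o_def)
qed

text \<open>Numbers of exponential size are handled as the lists of the exponents in their binary expansion.
  Sums and products of such numbers are formed without carries.\<close>

definition exponents :: "nat \<Rightarrow> nat list" where
  "exponents n = foldr (\<lambda>b a. (if b then [0] else []) @ map Suc a) (bits n) []"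

definition sum_pow2 :: "nat list \<Rightarrow> nat" where
  "sum_pow2 es = (\<Sum>e\<leftarrow>es. 2 ^ e)"

lemma sum_pow2_simps [simp]:
  "sum_pow2 [] = 0" "sum_pow2 (e # es) = 2 ^ e + sum_pow2 es"
  "sum_pow2 (es @ fs) = sum_pow2 es + sum_pow2 fs"
  by (simp_all add: sum_pow2_def)

lemma sum_pow2_map_Suc: "sum_pow2 (map Suc es) = 2 * sum_pow2 es"
  by (induction es) auto

lemma sum_pow2_exponents [simp]: "sum_pow2 (exponents n) = n"
proof (induction n rule: bits.induct)
  case (1 n)
  show ?case
  proof (cases "n = 0")
    case False
    then have "exponents n = (if odd n then [0] else []) @ map Suc (exponents (n div 2))"
      by (simp add: exponents_def bits.simps[of n])
    with 1[OF False] show ?thesis by (simp add: sum_pow2_map_Suc)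
  qed (simp add: exponents_def bits.simps)
qed

lemma polyf_exponents [polyf_intros]:
  assumes f: "polyf A enc_nat f"
  shows "polyf A (enc_list enc_unary) (\<lambda>s. exponents (f s))"
proof -
  obtain q where q: "\<And>s. size (enc_list enc_bool (bits (f s))) \<le> poly q (size (A s))"
    by (rule polyf_size[OF polyf_bits[OF f]]) blast
  let ?h = "\<lambda>xs. foldr (\<lambda>b a. (if b then [0] else []) @ map Suc a) xs []"
  have "polyf A (enc_list enc_unary) (\<lambda>s. ?h (bits (f s)))"
  proof (rule polyf_foldr[OF polyf_bits[OF f] polyf_const])
    show "polyf (enc_prod enc_bool (enc_prod (enc_list enc_unary) A)) (enc_list enc_unary)
     (\<lambda>p. (if fst p then [0] else []) @ map Suc (fst (snd p)))"
      by (rule polyf_intros)+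
    fix s xs ys assume s: "bits (f s) = ys @ xs"
    have l: "length xs \<le> poly q (size (A s))"
      using q[of s] s length_le_size_enc_list[of "bits (f s)" enc_bool] by simp
    have le: "length (?h xs) \<le> length xs" by (induction xs) auto
    have "\<forall>e\<in>set (?h xs). e < length xs" by (induction xs) auto
    then have "size (enc_list enc_unary (?h xs)) \<le> (length xs + 1) * length (?h xs)"
      by (intro size_enc_list_bound) (simp add: less_imp_le)
    also have "\<dots> \<le> (poly q (size (A s)) + 1) * poly q (size (A s))"
      using l le by (intro mult_mono) auto
    also have "\<dots> = poly ((q + [:1:]) * q) (size (A s))" by simp
    finally show "size (enc_list enc_unary (?h xs)) \<le> poly ((q + [:1:]) * q) (size (A s))" .
  qed
  then show ?thesis by (simp add: exponents_def)
qed

definition exponents_mult :: "nat list \<Rightarrow> nat list \<Rightarrow> nat list" where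
  "exponents_mult es fs = concat (map (\<lambda>e. map (\<lambda>f. e + f) fs) es)"

lemma sum_pow2_exponents_mult [simp]: "sum_pow2 (exponents_mult es fs) = sum_pow2 es * sum_pow2 fs"
proof -
  have "sum_pow2 (map ((+) e) fs) = 2 ^ e * sum_pow2 fs" for e
    by (induction fs) (auto simp: power_add algebra_simps)
  then show ?thesis by (induction es) (auto simp: exponents_mult_def algebra_simps)
qed

lemma polyf_exponents_mult [polyf_intros]:
  assumes "polyf A (enc_list enc_unary) f" "polyf A (enc_list enc_unary) g"
  shows "polyf A (enc_list enc_unary) (\<lambda>s. exponents_mult (f s) (g s))"
  unfolding exponents_mult_def by (rule polyf_intros assms(1) polyf_comp[OF _ assms(2)])+

definition pow2_le :: "nat list \<Rightarrow> nat list \<Rightarrow> bool" where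
  "pow2_le es fs = (let m = length es + length fs in
    foldr (\<lambda>i a. min (2 * m) ((length (filter (\<lambda>e. e = i) es) + 2 * a) - (length (filter (\<lambda>f. f = i) fs) + m)))
      [0..<Suc (sum_list (es @ fs))] m \<le> m)"

lemma polyf_pow2_le [polyf_intros]:
  assumes es: "polyf A (enc_list enc_unary) es" and fs: "polyf A (enc_list enc_unary) fs"
  shows "polyf A enc_bool (\<lambda>s. pow2_le (es s) (fs s))"
proof -
  let ?m = "\<lambda>s. length (es s) + length (fs s)"
  let ?g = "\<lambda>i a s. min (2 * ?m s) ((length (filter (\<lambda>e. e = i) (es s)) + 2 * a) -
    (length (filter (\<lambda>f. f = i) (fs s)) + ?m s))"
  obtain q where q: "\<And>s. size (enc_unary (2 * ?m s)) \<le> poly q (size (A s))"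
    by (rule polyf_size[of A enc_unary "\<lambda>s. 2 * ?m s"]) (rule polyf_intros es fs | blast)+
  have "polyf A enc_unary (\<lambda>s. foldr (\<lambda>i a. ?g i a s) [0..<Suc (sum_list (es s @ fs s))] (?m s))"
  proof (rule polyf_foldr)
    show "polyf A (enc_list enc_unary) (\<lambda>s. [0..<Suc (sum_list (es s @ fs s))])"
      by (rule polyf_intros es fs)+
    show "polyf A enc_unary ?m" by (rule polyf_intros es fs)+
    show "polyf (enc_prod enc_unary (enc_prod enc_unary A)) enc_unary
     (\<lambda>p. ?g (fst p) (fst (snd p)) (snd (snd p)))"
      by (rule polyf_intros polyf_eq inj_enc_unary polyf_comp[OF _ es] polyf_comp[OF _ fs])+
    show "size (enc_unary (foldr (\<lambda>i a. ?g i a s) xs (?m s))) \<le> poly q (size (A s))" for s xs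
      using q[of s] by (cases xs) auto
  qed
  from polyf_le[OF this polyf_plus[OF polyf_length[OF es] polyf_length[OF fs]]]
  show ?thesis by (simp only: pow2_le_def Let_def)
qed

text \<open>The accumulator of \<open>pow2_le\<close> is the difference of the two numbers, read from the most
  significant digit on, clipped to \<open>[- m, m]\<close> and shifted by \<open>m\<close>. Once the difference leaves
  this interval its sign cannot change any more.\<close>

lemma pow2_le_iff: "pow2_le es fs \<longleftrightarrow> sum_pow2 es \<le> sum_pow2 fs"
proof -
  define m where "m = length es + length fs"
  define c where "c z = nat (min (2 * int m) (max 0 (z + int m)))" for z :: int
  define cnt where "cnt xs i = length (filter (\<lambda>e. e = i) xs)" for xs :: "nat list" and i
  define d where "d i = int (cnt es i) - int (cnt fs i)" for i
  define g where "g i a = min (2 * m) ((cnt es i + 2 * a) - (cnt fs i + m))" for i a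
  have bound: "cnt es i + cnt fs i \<le> m" for i
    unfolding cnt_def m_def by (intro add_mono length_filter_le)
  \<comment> \<open>The digit difference \<open>d i\<close> lies between \<open>- m\<close> and
    \<open>m\<close>. So \<open>z \<ge> m\<close> implies \<open>d i + 2 * z \<ge> m\<close>, and
    symmetrically below: clipping before or after the round gives the same.\<close>
  have step: "g i (c z) = c (d i + 2 * z)" for i z
    using bound[of i] unfolding g_def c_def d_def by (simp add: min_def max_def) linarith
  \<comment> \<open>The difference of the two numbers restricted to the digits from \<open>k\<close>
    on, divided by \<open>2 ^ k\<close>.\<close>
  define S where "S k n = (\<Sum>i\<in>{k..<n}. d i * 2 ^ (i - k))" for k n
  have S: "S k n = d k + 2 * S (Suc k) n" if "k < n" for k n
  proof -
    have "S k n = d k * 2 ^ (k - k) + (\<Sum>i\<in>{Suc k..<n}. d i * 2 ^ (i - k))"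
      unfolding S_def using that by (simp add: sum.atLeast_Suc_lessThan)
    also have "(\<Sum>i\<in>{Suc k..<n}. d i * 2 ^ (i - k)) = 2 * S (Suc k) n"
      unfolding S_def sum_distrib_left
      by (intro sum.cong refl) (auto simp: Suc_diff_le simp flip: power_Suc)
    finally show ?thesis by simp
  qed
  have fold: "k \<le> n \<Longrightarrow> foldr g [k..<n] m = c (S k n)" for k n
  proof (induction "n - k" arbitrary: k)
    case 0 then show ?case by (simp add: c_def S_def)
  next
    case (Suc j)
    then have k: "k < n" by simp
    with Suc have "foldr g [Suc k..<n] m = c (S (Suc k) n)" by simp
    then show ?case using k by (simp add: upt_conv_Cons step S del: upt_Suc)
  qed
  \<comment> \<open>Every exponent is at most the sum of all of them, which is an easily computed
    bound for the highest digit.\<close>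
  define n where "n = Suc (sum_list (es @ fs))"
  have val: "int (sum_pow2 xs) = (\<Sum>i\<in>{0..<n}. int (cnt xs i) * 2 ^ i)" if "set xs \<subseteq> {0..<n}" for xs
    using that
  proof (induction xs)
    case (Cons x xs)
    have "(\<Sum>i\<in>{0..<n}. int (cnt (x # xs) i) * 2 ^ i)
      = (\<Sum>i\<in>{0..<n}. (if i = x then 2 ^ i else 0) + int (cnt xs i) * 2 ^ i)"
      by (intro sum.cong) (auto simp: cnt_def algebra_simps)
    also have "\<dots> = 2 ^ x + (\<Sum>i\<in>{0..<n}. int (cnt xs i) * 2 ^ i)"
      using Cons.prems by (simp add: sum.distrib)
    finally show ?case using Cons by simp
  qed (simp add: cnt_def)
  have "set (es @ fs) \<subseteq> {0..<n}"
    unfolding n_def using member_le_sum_list[of _ "es @ fs"] by (auto simp: less_Suc_eq_le)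
  then have "S 0 n = int (sum_pow2 es) - int (sum_pow2 fs)"
    using val[of es] val[of fs] by (simp add: S_def d_def sum_subtractf left_diff_distrib)
  moreover have "pow2_le es fs \<longleftrightarrow> foldr g [0..<n] m \<le> m"
    unfolding pow2_le_def Let_def n_def g_def cnt_def m_def by simp
  \<comment> \<open>For \<open>m = 0\<close> the clipping interval is a single point and does not
    show the sign; in that case both lists are empty.\<close>
  moreover have "c z \<le> m \<longleftrightarrow> z \<le> 0" if "m > 0 \<or> z = 0" for z
    using that unfolding c_def by (auto simp: min_def max_def)
  moreover have "m = 0 \<Longrightarrow> es = [] \<and> fs = []" by (simp add: m_def)
  ultimately show ?thesis using fold[of 0 n] by (cases "m = 0") auto
qed

section \<open>Lists of bounded length\<close>

fun lists_upto :: "nat \<Rightarrow> 'a list \<Rightarrow> 'a list list" where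
  "lists_upto 0 xs = [[]]"
| "lists_upto (Suc n) xs = [] # concat (map (\<lambda>x. map (\<lambda>ys. x # ys) (lists_upto n xs)) xs)"

lemma set_lists_upto: "set (lists_upto n xs) = {ys. set ys \<subseteq> set xs \<and> length ys \<le> n}"
proof (induction n)
  case (Suc n)
  have "ys \<in> set (lists_upto (Suc n) xs) \<longleftrightarrow> set ys \<subseteq> set xs \<and> length ys \<le> Suc n" for ys
    using Suc by (cases ys) auto
  then show ?case by blast
qed auto

text \<open>Here \<open>n\<close> belongs to the program and not to its input: the induction yields
  a separate program and a separate polynomial for every \<open>n\<close>. This is where fixed
  \<open>F\<close> and \<open>D\<close> are needed.\<close>

lemma polyf_lists_upto [polyf_intros]:
  assumes "polyf A (enc_list X) L"
  shows "polyf A (enc_list (enc_list X)) (\<lambda>s. lists_upto n (L s))"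
proof (induction n)
  case (Suc n)
  show ?case unfolding lists_upto.simps
    by (rule polyf_intros assms polyf_comp[OF _ Suc] polyf_comp[OF _ assms])+
qed (simp add: polyf_const)

section \<open>Rooted trees\<close>

abbreviation arcs_of :: "'z tree_input_scheme \<Rightarrow> (nat \<times> nat) set" where
  "arcs_of T \<equiv> parcs (sym_orient T)"

abbreviation verts_of :: "'z tree_input_scheme \<Rightarrow> nat set" where
  "verts_of T \<equiv> set (vertex_list T)"

lemma arcs_of_sym: "(u, v) \<in> arcs_of T \<longleftrightarrow> (v, u) \<in> arcs_of T"
  by (simp add: sym_orient_def insert_commute)

lemma arcs_of_iff: "(u, v) \<in> arcs_of T \<longleftrightarrow> (u, v) \<in> set (edge_list T) \<or> (v, u) \<in> set (edge_list T)"
  by (force simp: sym_orient_def edges_def doubleton_eq_iff)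

lemma arcs_of_verts:
  assumes "is_rooted_tree T" "(u, v) \<in> arcs_of T"
  shows "u \<in> verts_of T" "v \<in> verts_of T" "u \<noteq> v"
  using assms unfolding arcs_of_iff is_rooted_tree_def by auto

lemma wf_sym_orient: "is_rooted_tree T \<Longrightarrow> wf_digraph (with_proj (sym_orient T))"
  by unfold_locales (auto dest: arcs_of_verts simp: sym_orient_def with_proj_def)

lemma pverts_sym_orient [simp]: "pverts (sym_orient T) = verts_of T"
  by (simp add: sym_orient_def)

text \<open>Two neighbours \<open>x\<close> and \<open>x'\<close> of \<open>y\<close> could be
  joined by a path inside \<open>S\<close>; as \<open>y\<close> lies outside \<open>S\<close>, the
  detour through \<open>y\<close> would close it to a cycle of length at least three.\<close>

lemma tree_unique_neighbour:
  assumes T: "is_rooted_tree T"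
    and paths: "\<And>x x'. x \<in> S \<Longrightarrow> x' \<in> S \<Longrightarrow>
      \<exists>p. pre_digraph.apath (with_proj (sym_orient T)) x p x' \<and>
        set (pre_digraph.awalk_verts (with_proj (sym_orient T)) x p) \<subseteq> S"
    and "x \<in> S" "x' \<in> S" "y \<notin> S" "(x, y) \<in> arcs_of T" "(x', y) \<in> arcs_of T"
  shows "x = x'"
proof (rule ccontr)
  interpret wf_digraph "with_proj (sym_orient T)" by (rule wf_sym_orient[OF T])
  assume "x \<noteq> x'"
  obtain p where p: "apath x p x'" "set (awalk_verts x p) \<subseteq> S"
    using paths[OF assms(3,4)] by blast
  let ?c = "(y, x) # p @ [(x', y)]"
  \<comment> \<open>A path with at least one arc makes the cycle longer than the two-arc cycles that
    every edge produces.\<close>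
  have "p \<noteq> []" using p(1) \<open>x \<noteq> x'\<close> by (auto simp: apath_Nil_iff)
  then have "3 \<le> length ?c" by (cases p) auto
  moreover have "cycle ?c"
    unfolding cycle_def
  proof (intro exI conjI)
    have awp: "awalk x p x'" using p(1) by (simp add: apath_def)
    show "awalk y ?c y"
      using awp assms(6,7) arcs_of_sym[of x y T] arcs_of_verts[OF T assms(6)]
      by (auto simp: awalk_Cons_iff awalk_Nil_iff intro!: awalk_appendI)
    have "tl (awalk_verts y ?c) = awalk_verts x (p @ [(x', y)])" by simp
    also have "\<dots> = awalk_verts x p @ [y]"
      using awalk_verts_append[of x p "[(x', y)]" y] awp assms(7) arcs_of_verts[OF T assms(7)]
      by (auto simp: awalk_Cons_iff awalk_Nil_iff intro!: awalk_appendI)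
    finally show "distinct (tl (awalk_verts y ?c))"
      using p assms(5) by (auto simp: apath_def)
  qed auto
  ultimately show False using T unfolding is_rooted_tree_def by blast
qed

text \<open>The labelled set grows from the depot by one vertex at a time. A new vertex has exactly
  one neighbour in the set, so \<open>extend\<close> along that edge is all that has to be
  satisfied; \<open>sym\<close> covers the opposite arc.\<close>

lemma tree_labelling:
  assumes T: "is_rooted_tree T"
    and root: "c \<in> R (depot T)"
    and extend: "\<And>u v a. (u, v) \<in> arcs_of T \<Longrightarrow> a \<in> R u \<Longrightarrow> \<exists>b\<in>R v. agree u v a b"
    and sym: "\<And>u v a b. agree u v a b \<Longrightarrow> agree v u b a"
  shows "\<exists>f. (\<forall>v\<in>verts_of T. f v \<in> R v) \<and> (\<forall>(u, v)\<in>arcs_of T. agree u v (f u) (f v))"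
proof -
  interpret wf_digraph "with_proj (sym_orient T)" by (rule wf_sym_orient[OF T])
  \<comment> \<open>Paths that stay inside \<open>S\<close> are part of the invariant because the
    uniqueness of the neighbour rests on them.\<close>
  let ?good = "\<lambda>S f. depot T \<in> S \<and> S \<subseteq> verts_of T \<and>
    (\<forall>x\<in>S. \<forall>x'\<in>S. \<exists>p. apath x p x' \<and> set (awalk_verts x p) \<subseteq> S) \<and>
    (\<forall>v\<in>S. f v \<in> R v) \<and> (\<forall>u\<in>S. \<forall>v\<in>S. (u, v) \<in> arcs_of T \<longrightarrow> agree u v (f u) (f v))"
  have d: "depot T \<in> verts_of T" using T by (simp add: is_rooted_tree_def)
  have "\<exists>S f. ?good S f \<and> card S = Suc n" if "n < card (verts_of T)" for n
    using that
  proof (induction n)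
    case 0
    have "?good {depot T} (\<lambda>_. c)"
      using root d arcs_of_verts(3)[OF T] by (auto simp: apath_Nil_iff intro!: exI[of _ "[]"])
    then show ?case by (intro exI[of _ "{depot T}"] exI[of _ "\<lambda>_. c"]) auto
  next
    case (Suc n)
    then obtain S f where S: "?good S f" and card: "card S = Suc n" by auto
    then have "S \<noteq> verts_of T" using Suc.prems by auto
    then obtain z where z: "z \<in> verts_of T" "z \<notin> S" using S by auto
    have "depot T \<rightarrow>\<^sup>*\<^bsub>with_proj (sym_orient T)\<^esub> z"
      using T d z unfolding is_rooted_tree_def strongly_connected_def
      by simp
    then have "\<exists>x y. x \<in> S \<and> y \<notin> S \<and> (x, y) \<in> arcs_of T"
      using z(2)
    proof (induction rule: reachable_induct)
      case base then show ?case using S by auto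
    next
      case (step x y)
      then show ?case by (cases "x \<in> S") auto
    qed
    then obtain x y where xy: "x \<in> S" "y \<notin> S" "(x, y) \<in> arcs_of T" by blast
    have yx: "(y, x) \<in> arcs_of T" using xy(3) arcs_of_sym by blast
    have paths: "\<exists>p. apath u p v \<and> set (awalk_verts u p) \<subseteq> S" if "u \<in> S" "v \<in> S" for u v
      using S that by blast
    note unique = tree_unique_neighbour[OF T paths _ xy(1,2) _ xy(3)]
    have y: "y \<in> verts_of T" using arcs_of_verts[OF T xy(3)] by simp
    obtain b where b: "b \<in> R y" "agree x y (f x) b" using extend[OF xy(3), of "f x"] S xy(1) by blast
    let ?S = "insert y S" and ?f = "f(y := b)"
    have "\<exists>p. apath u p v \<and> set (awalk_verts u p) \<subseteq> ?S" if uv: "u \<in> ?S" "v \<in> ?S" for u v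
    proof -
      consider "u \<in> S" "v \<in> S" | "u \<in> S" "v = y" | "u = y" "v \<in> S" | "u = y" "v = y" using uv by auto
      then show ?thesis
      proof cases
        case 1 with paths show ?thesis by blast
      next
        case 2
        obtain p where p: "apath u p x" "set (awalk_verts u p) \<subseteq> S" using paths[OF 2(1) xy(1)] by blast
        then have aw: "awalk u p x" by (simp add: apath_def)
        have aw': "awalk u (p @ [(x, y)]) y"
          using aw xy(3) y by (auto simp: awalk_Cons_iff awalk_Nil_iff intro!: awalk_appendI)
        have "awalk_verts u (p @ [(x, y)]) = awalk_verts u p @ [y]"
          using awalk_verts_append[OF aw'] by simp
        then have "apath u (p @ [(x, y)]) v" "set (awalk_verts u (p @ [(x, y)])) \<subseteq> ?S"
          using aw' p 2 xy(2) by (auto simp: apath_def)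
        then show ?thesis by blast
      next
        case 3
        obtain p where p: "apath x p v" "set (awalk_verts x p) \<subseteq> S" using paths[OF xy(1) 3(2)] by blast
        then have "apath u ((y, x) # p) v" "set (awalk_verts u ((y, x) # p)) \<subseteq> ?S"
          using 3 yx xy(2) by (auto simp: apath_Cons_iff)
        then show ?thesis by blast
      next
        case 4
        then have "apath u [] v" "set (awalk_verts u []) \<subseteq> ?S" using y
          by (auto simp: apath_Nil_iff)
        then show ?thesis by blast
      qed
    qed
    moreover have "agree u v (?f u) (?f v)" if uv: "u \<in> ?S" "v \<in> ?S" "(u, v) \<in> arcs_of T" for u v
    proof -
      have "u \<noteq> v" using arcs_of_verts[OF T uv(3)] by simp
      then consider "u \<in> S" "v \<in> S" | "u \<in> S" "v = y" | "u = y" "v \<in> S" using uv by auto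
      then show ?thesis
      proof cases
        case 1 then show ?thesis using S uv xy(2) by auto
      next
        case 2
        then have "u = x" using unique[of u] uv by auto
        then show ?thesis using 2 b xy by auto
      next
        case 3
        then have "v = x" using unique[of v] uv arcs_of_sym by blast
        then show ?thesis using 3 b xy sym by auto
      qed
    qed
    ultimately have "?good ?S ?f" using S y b(1) by auto
    moreover have "card ?S = Suc (Suc n)"
      using card xy(2) S by (simp add: finite_subset[of S "verts_of T"])
    ultimately show ?case by blast
  qed
  moreover have "card (verts_of T) > 0" using d by (auto simp: card_gt_0_iff)
  ultimately obtain S f where S: "?good S f" "card S = card (verts_of T)"
    by (metis Suc_pred' lessI diff_less zero_less_one)
  then have "S = verts_of T" by (intro card_subset_eq) auto
  then show ?thesis using S(1) arcs_of_verts[OF T] by (intro exI[of _ f]) blast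
qed

section \<open>Local description of closed walks\<close>

type_synonym cand = "(nat \<times> nat) \<times> nat list \<times> nat list"

text \<open>A candidate \<open>((a, b), ts, ts')\<close> says that the arc \<open>(a, b)\<close> is traversed in the steps \<open>ts\<close> and the
  arc \<open>(b, a)\<close> in the steps \<open>ts'\<close>.\<close>

definition outs :: "nat \<Rightarrow> cand \<Rightarrow> nat list" where
  "outs v x = (if v = fst (fst x) then fst (snd x) else snd (snd x))"

definition ins :: "nat \<Rightarrow> cand \<Rightarrow> nat list" where
  "ins v x = (if v = fst (fst x) then snd (snd x) else fst (snd x))"

text \<open>All quantifiers run over lists, so the closure rules apply directly. The third conjunct
  also ensures that an edge occurs with one candidate only. The last conjunct limits the arcs
  between a departure from the depot and the next arrival there to \<open>K\<close>.\<close>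

definition good_config :: "nat \<Rightarrow> nat \<Rightarrow> nat \<Rightarrow> (nat \<times> nat) list \<Rightarrow> nat \<Rightarrow> cand list \<Rightarrow> bool" where
  "good_config N K d es v c \<longleftrightarrow>
    (\<forall>x\<in>set c. v = fst (fst x) \<or> v = snd (fst x)) \<and>
    (\<forall>e\<in>set es. v = fst e \<or> v = snd e \<longrightarrow> (\<exists>x\<in>set c. fst x = e)) \<and>
    (\<forall>x\<in>set c. \<forall>y\<in>set c. x = y \<or> (fst x \<noteq> fst y \<and> (\<forall>t\<in>set (outs v x). t \<notin> set (outs v y)))) \<and>
    (\<forall>x\<in>set c. \<forall>t\<in>set (outs v x). (v = d \<and> t = 0) \<or> (\<exists>y\<in>set c. \<exists>s\<in>set (ins v y). t = Suc s)) \<and>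
    (\<forall>x\<in>set c. \<forall>t\<in>set (ins v x). (v = d \<and> Suc t = N) \<or> (\<exists>y\<in>set c. Suc t \<in> set (outs v y))) \<and>
    (v = d \<and> 0 < N \<longrightarrow> (\<exists>x\<in>set c. 0 \<in> set (outs v x))) \<and>
    (v = d \<longrightarrow> (\<forall>x\<in>set c. \<forall>t\<in>set (outs v x). \<exists>y\<in>set c. \<exists>s\<in>set (ins v y). t < s \<and> s \<le> Suc (t + K)))"

definition config_of :: "(nat \<times> nat) list \<Rightarrow> (nat \<times> nat \<Rightarrow> nat list \<times> nat list) \<Rightarrow> nat \<Rightarrow> cand list" where
  "config_of es \<sigma> v = map (\<lambda>e. (e, \<sigma> e)) (filter (\<lambda>e. v = fst e \<or> v = snd e) es)"

definition arc_times :: "(nat \<times> nat) list \<Rightarrow> (nat \<times> nat \<Rightarrow> nat list \<times> nat list) \<Rightarrow> nat \<times> nat \<Rightarrow> nat set" where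
  "arc_times es \<sigma> a = (if a \<in> set es then set (fst (\<sigma> a)) else set (snd (\<sigma> (snd a, fst a))))"

text \<open>Edges are distinct as sets of ends, so no edge is listed in both directions. Hence the
  lookup in \<open>arc_times\<close> is unambiguous.\<close>

lemma edge_list_no_reverse:
  assumes "is_rooted_tree T" "(u, v) \<in> set (edge_list T)"
  shows "(v, u) \<notin> set (edge_list T)"
proof
  assume "(v, u) \<in> set (edge_list T)"
  moreover have "inj_on (\<lambda>(u, v). {u, v}) (set (edge_list T))" "u \<noteq> v"
    using assms by (auto simp: is_rooted_tree_def distinct_map)
  ultimately have "(u, v) = (v, u)" using assms(2)
    by (elim inj_onD) (auto simp: insert_commute)
  with \<open>u \<noteq> v\<close> show False by simp
qed

text \<open>Together with the converse below this is the dictionary between listed edges at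
  \<open>v\<close> and arcs leaving \<open>v\<close>: the arrival times belong to the reversed
  arc.\<close>

lemma outs_config:
  assumes T: "is_rooted_tree T" and e: "e \<in> set (edge_list T)" "v = fst e \<or> v = snd e"
  shows "\<exists>a\<in>arcs_of T. fst a = v \<and> {fst a, snd a} = {fst e, snd e} \<and>
    set (outs v (e, \<sigma> e)) = arc_times (edge_list T) \<sigma> a \<and>
    set (ins v (e, \<sigma> e)) = arc_times (edge_list T) \<sigma> (snd a, fst a)"
proof -
  obtain x y where xy: "e = (x, y)" by fastforce
  have *: "(x, y) \<in> arcs_of T" "(y, x) \<in> arcs_of T" "(y, x) \<notin> set (edge_list T)" "x \<noteq> y"
    using e xy arcs_of_iff edge_list_no_reverse[OF T, of x y] arcs_of_verts[OF T, of x y] by auto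
  show ?thesis
  proof (cases "v = x")
    case True
    then show ?thesis using * e xy
      by (intro bexI[of _ "(x, y)"]) (auto simp: outs_def ins_def arc_times_def)
  next
    case False
    then show ?thesis using * e xy
      by (intro bexI[of _ "(y, x)"]) (auto simp: outs_def ins_def arc_times_def)
  qed
qed

lemma config_outs:
  assumes T: "is_rooted_tree T" and a: "a \<in> arcs_of T"
  shows "\<exists>e\<in>set (edge_list T). (fst a = fst e \<or> fst a = snd e) \<and> {fst a, snd a} = {fst e, snd e} \<and>
    set (outs (fst a) (e, \<sigma> e)) = arc_times (edge_list T) \<sigma> a \<and>
    set (ins (fst a) (e, \<sigma> e)) = arc_times (edge_list T) \<sigma> (snd a, fst a)"
proof -
  obtain u v where uv: "a = (u, v)" by fastforce
  have "u \<noteq> v" using arcs_of_verts[OF T, of u v] a uv by auto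
  from a[unfolded uv arcs_of_iff] show ?thesis
  proof
    assume "(u, v) \<in> set (edge_list T)"
    then show ?thesis using edge_list_no_reverse[OF T, of u v] uv
      by (intro bexI[of _ "(u, v)"]) (auto simp: outs_def ins_def arc_times_def)
  next
    assume "(v, u) \<in> set (edge_list T)"
    then show ?thesis using edge_list_no_reverse[OF T, of v u] uv \<open>u \<noteq> v\<close>
      by (intro bexI[of _ "(v, u)"]) (auto simp: outs_def ins_def arc_times_def)
  qed
qed

lemma config_ball:
  assumes T: "is_rooted_tree T"
  shows "(\<forall>x\<in>set (config_of (edge_list T) \<sigma> v). P (set (outs v x)) (set (ins v x))) \<longleftrightarrow>
    (\<forall>a\<in>arcs_of T. fst a = v \<longrightarrow> P (arc_times (edge_list T) \<sigma> a) (arc_times (edge_list T) \<sigma> (snd a, fst a)))"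
    (is "?L \<longleftrightarrow> ?R")
proof
  assume L: ?L
  show ?R
  proof (intro ballI impI)
    fix a assume "a \<in> arcs_of T" "fst a = v"
    then obtain e where e: "e \<in> set (edge_list T)" "v = fst e \<or> v = snd e"
      "set (outs v (e, \<sigma> e)) = arc_times (edge_list T) \<sigma> a"
      "set (ins v (e, \<sigma> e)) = arc_times (edge_list T) \<sigma> (snd a, fst a)"
      using config_outs[OF T, of a \<sigma>] by blast
    then have "(e, \<sigma> e) \<in> set (config_of (edge_list T) \<sigma> v)" by (auto simp: config_of_def)
    with L e(3,4) show "P (arc_times (edge_list T) \<sigma> a) (arc_times (edge_list T) \<sigma> (snd a, fst a))"
      by metis
  qed
next
  assume R: ?R
  show ?L
  proof
    fix x assume "x \<in> set (config_of (edge_list T) \<sigma> v)"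
    then obtain e where e: "x = (e, \<sigma> e)" "e \<in> set (edge_list T)" "v = fst e \<or> v = snd e"
      by (auto simp: config_of_def)
    from outs_config[OF T e(2,3), of \<sigma>] R show "P (set (outs v x)) (set (ins v x))"
      unfolding e(1) by metis
  qed
qed

lemma config_bex:
  assumes T: "is_rooted_tree T"
  shows "(\<exists>x\<in>set (config_of (edge_list T) \<sigma> v). P (set (outs v x)) (set (ins v x))) \<longleftrightarrow>
    (\<exists>a\<in>arcs_of T. fst a = v \<and> P (arc_times (edge_list T) \<sigma> a) (arc_times (edge_list T) \<sigma> (snd a, fst a)))"
  using config_ball[OF T, of \<sigma> v "\<lambda>A B. \<not> P A B"] by blast

lemma rev_arc_ball: "(\<forall>a\<in>arcs_of T. fst a = v \<longrightarrow> P (snd a, fst a)) \<longleftrightarrow> (\<forall>a\<in>arcs_of T. snd a = v \<longrightarrow> P a)"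
  using arcs_of_sym[of _ _ T] by fastforce

lemma rev_arc_bex: "(\<exists>a\<in>arcs_of T. fst a = v \<and> P (snd a, fst a)) \<longleftrightarrow> (\<exists>a\<in>arcs_of T. snd a = v \<and> P a)"
  using rev_arc_ball[of T v "\<lambda>a. \<not> P a"] by blast

text \<open>This frees the local condition from the order and orientation of the edge list. Only the
  disjointness clause compares two entries, and so needs that the correspondence between edges and
  arcs is injective; the other clauses are instances of \<open>config_ball\<close> and
  \<open>config_bex\<close>.\<close>

lemma good_config_iff:
  fixes T :: "'z tree_input_scheme"
  assumes T: "is_rooted_tree T"
  defines "\<tau> \<equiv> \<lambda>\<sigma>. arc_times (edge_list T) \<sigma>"
  shows "good_config N K d (edge_list T) v (config_of (edge_list T) \<sigma> v) \<longleftrightarrow>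
    (\<forall>a\<in>arcs_of T. fst a = v \<longrightarrow> (\<forall>b\<in>arcs_of T. fst b = v \<longrightarrow> a = b \<or> \<tau> \<sigma> a \<inter> \<tau> \<sigma> b = {})) \<and>
    (\<forall>a\<in>arcs_of T. fst a = v \<longrightarrow> (\<forall>t\<in>\<tau> \<sigma> a. (v = d \<and> t = 0) \<or> (\<exists>b\<in>arcs_of T. snd b = v \<and> (\<exists>s\<in>\<tau> \<sigma> b. t = Suc s)))) \<and>
    (\<forall>a\<in>arcs_of T. snd a = v \<longrightarrow> (\<forall>t\<in>\<tau> \<sigma> a. (v = d \<and> Suc t = N) \<or> (\<exists>b\<in>arcs_of T. fst b = v \<and> Suc t \<in> \<tau> \<sigma> b))) \<and>
    (v = d \<and> 0 < N \<longrightarrow> (\<exists>a\<in>arcs_of T. fst a = v \<and> 0 \<in> \<tau> \<sigma> a)) \<and>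
    (v = d \<longrightarrow> (\<forall>a\<in>arcs_of T. fst a = v \<longrightarrow>
      (\<forall>t\<in>\<tau> \<sigma> a. \<exists>b\<in>arcs_of T. snd b = v \<and> (\<exists>s\<in>\<tau> \<sigma> b. t < s \<and> s \<le> Suc (t + K)))))"
proof -
  let ?c = "config_of (edge_list T) \<sigma> v"
  note ball = config_ball[OF T, of \<sigma> v, folded \<tau>_def] and bex = config_bex[OF T, of \<sigma> v, folded \<tau>_def]
  have 1: "\<forall>x\<in>set ?c. v = fst (fst x) \<or> v = snd (fst x)"
    and 2: "\<forall>e\<in>set (edge_list T). v = fst e \<or> v = snd e \<longrightarrow> (\<exists>x\<in>set ?c. fst x = e)"
    by (auto simp: config_of_def)
  have 3: "(\<forall>x\<in>set ?c. \<forall>y\<in>set ?c. x = y \<or> (fst x \<noteq> fst y \<and> (\<forall>t\<in>set (outs v x). t \<notin> set (outs v y)))) \<longleftrightarrow>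
    (\<forall>a\<in>arcs_of T. fst a = v \<longrightarrow> (\<forall>b\<in>arcs_of T. fst b = v \<longrightarrow> a = b \<or> \<tau> \<sigma> a \<inter> \<tau> \<sigma> b = {}))"
    (is "?L \<longleftrightarrow> ?R")
  proof
    assume L: ?L
    show ?R
    proof (intro ballI impI)
      fix a b assume ab: "a \<in> arcs_of T" "fst a = v" "b \<in> arcs_of T" "fst b = v"
      obtain e where e: "e \<in> set (edge_list T)" "v = fst e \<or> v = snd e"
        "{fst a, snd a} = {fst e, snd e}" "set (outs v (e, \<sigma> e)) = \<tau> \<sigma> a"
        using config_outs[OF T ab(1), of \<sigma>] ab(2) unfolding \<tau>_def by metis
      obtain f where f: "f \<in> set (edge_list T)" "v = fst f \<or> v = snd f"
        "{fst b, snd b} = {fst f, snd f}" "set (outs v (f, \<sigma> f)) = \<tau> \<sigma> b"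
        using config_outs[OF T ab(3), of \<sigma>] ab(4) unfolding \<tau>_def by metis
      have "(e, \<sigma> e) \<in> set ?c" "(f, \<sigma> f) \<in> set ?c" using e f by (auto simp: config_of_def)
      with L have "(e, \<sigma> e) = (f, \<sigma> f) \<or> \<tau> \<sigma> a \<inter> \<tau> \<sigma> b = {}" using e(4) f(4) by blast
      \<comment> \<open>Both arcs start at \<open>v\<close> and have the ends of the same
        edge.\<close>
      moreover have "a = b" if "e = f"
        using that e(3) f(3) ab by (cases a; cases b) (auto simp: doubleton_eq_iff)
      ultimately show "a = b \<or> \<tau> \<sigma> a \<inter> \<tau> \<sigma> b = {}" by blast
    qed
  next
    assume R: ?R
    show ?L
    proof (intro ballI)
      fix x y assume "x \<in> set ?c" "y \<in> set ?c"
      then obtain e f where e: "x = (e, \<sigma> e)" "e \<in> set (edge_list T)" "v = fst e \<or> v = snd e"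
        and f: "y = (f, \<sigma> f)" "f \<in> set (edge_list T)" "v = fst f \<or> v = snd f"
        by (auto simp: config_of_def)
      obtain a where a: "a \<in> arcs_of T" "fst a = v" "{fst a, snd a} = {fst e, snd e}"
        "set (outs v x) = \<tau> \<sigma> a"
        using outs_config[OF T e(2,3), of \<sigma>] unfolding \<tau>_def e(1) by metis
      obtain b where b: "b \<in> arcs_of T" "fst b = v" "{fst b, snd b} = {fst f, snd f}"
        "set (outs v y) = \<tau> \<sigma> b"
        using outs_config[OF T f(2,3), of \<sigma>] unfolding \<tau>_def f(1) by metis
      show "x = y \<or> (fst x \<noteq> fst y \<and> (\<forall>t\<in>set (outs v x). t \<notin> set (outs v y)))"
      proof (cases "e = f")
        case False
        have "a \<noteq> b"
        proof
          assume "a = b"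
          with a(3) b(3) have "{fst e, snd e} = {fst f, snd f}" by simp
          then have "f = e \<or> f = (snd e, fst e)" by (cases e; cases f) (auto simp: doubleton_eq_iff)
          with False e(2) f(2) edge_list_no_reverse[OF T, of "fst e" "snd e"] show False by auto
        qed
        with R a b have "\<tau> \<sigma> a \<inter> \<tau> \<sigma> b = {}" by blast
        with False e(1) f(1) a(4) b(4) show ?thesis by auto
      qed (use e f in auto)
    qed
  qed
  have 4: "(\<exists>y\<in>set ?c. \<exists>s\<in>set (ins v y). Q s) \<longleftrightarrow> (\<exists>b\<in>arcs_of T. snd b = v \<and> (\<exists>s\<in>\<tau> \<sigma> b. Q s))" for Q
    using bex[of "\<lambda>_ B. \<exists>s\<in>B. Q s"] rev_arc_bex[of T v "\<lambda>b. \<exists>s\<in>\<tau> \<sigma> b. Q s"] by simp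
  have 5: "(\<exists>y\<in>set ?c. t \<in> set (outs v y)) \<longleftrightarrow> (\<exists>b\<in>arcs_of T. fst b = v \<and> t \<in> \<tau> \<sigma> b)" for t
    using bex[of "\<lambda>B _. t \<in> B"] by simp
  have 6: "(\<forall>x\<in>set ?c. \<forall>t\<in>set (outs v x). Q t) \<longleftrightarrow> (\<forall>a\<in>arcs_of T. fst a = v \<longrightarrow> (\<forall>t\<in>\<tau> \<sigma> a. Q t))" for Q
    using ball[of "\<lambda>A _. \<forall>s\<in>A. Q s"] by simp
  have 7: "(\<forall>x\<in>set ?c. \<forall>t\<in>set (ins v x). Q t) \<longleftrightarrow> (\<forall>a\<in>arcs_of T. snd a = v \<longrightarrow> (\<forall>t\<in>\<tau> \<sigma> a. Q t))" for Q
    using ball[of "\<lambda>_ B. \<forall>s\<in>B. Q s"] rev_arc_ball[of T v "\<lambda>b. \<forall>s\<in>\<tau> \<sigma> b. Q s"] by simp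
  from 1 2 show ?thesis unfolding good_config_def 3 4 5 6 7 by simp
qed

section \<open>From traversal times to walks and back\<close>

lemma pcas_iff: "pcas u w v \<longleftrightarrow>
  (\<forall>i<length w. fst (w ! i) = (if i = 0 then u else snd (w ! (i - 1)))) \<and>
  v = (if w = [] then u else snd (last w))"
proof (induction w arbitrary: u)
  case (Cons a w)
  have "(\<forall>i<length (a # w). fst ((a # w) ! i) = (if i = 0 then u else snd ((a # w) ! (i - 1)))) \<longleftrightarrow>
    fst a = u \<and> (\<forall>i<length w. fst (w ! i) = (if i = 0 then snd a else snd (w ! (i - 1))))"
    (is "?L \<longleftrightarrow> ?R")
    unfolding length_Cons All_less_Suc2
    by (auto simp: nth_Cons' split: if_splits)
  with Cons show ?case by (cases a) auto
qed auto

lemma closed_walk_iff: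
  assumes "is_rooted_tree T"
  shows "closed_walk_from_depot T w \<longleftrightarrow> set w \<subseteq> arcs_of T \<and>
    (\<forall>i<length w. fst (w ! i) = (if i = 0 then depot T else snd (w ! (i - 1)))) \<and>
    (w \<noteq> [] \<longrightarrow> snd (last w) = depot T)"
  using assms unfolding closed_walk_from_depot_def pre_digraph.awalk_def
  by (auto simp: cas_with_proj_eq pcas_iff is_rooted_tree_def)

text \<open>By induction on \<open>t\<close>, exactly one arc carries the time \<open>t\<close>:
  every arc with time \<open>Suc t\<close> starts where the unique arc with time \<open>t\<close>
  ends, and arcs leaving one vertex have disjoint times. Read in order of time, these arcs are the
  walk.\<close>

lemma walk_of_times:
  assumes d: "d = depot T" and T: "is_rooted_tree T"
    and lt: "\<And>a t. a \<in> arcs_of T \<Longrightarrow> t \<in> \<tau> a \<Longrightarrow> t < N"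
    and disj: "\<And>a b t. a \<in> arcs_of T \<Longrightarrow> b \<in> arcs_of T \<Longrightarrow> fst a = fst b \<Longrightarrow> t \<in> \<tau> a \<Longrightarrow> t \<in> \<tau> b \<Longrightarrow> a = b"
    and prev: "\<And>a t. a \<in> arcs_of T \<Longrightarrow> t \<in> \<tau> a \<Longrightarrow>
      (fst a = d \<and> t = 0) \<or> (\<exists>b\<in>arcs_of T. snd b = fst a \<and> (\<exists>s\<in>\<tau> b. t = Suc s))"
    and succ: "\<And>a t. a \<in> arcs_of T \<Longrightarrow> t \<in> \<tau> a \<Longrightarrow>
      (snd a = d \<and> Suc t = N) \<or> (\<exists>b\<in>arcs_of T. fst b = snd a \<and> Suc t \<in> \<tau> b)"
    and start: "0 < N \<Longrightarrow> \<exists>a\<in>arcs_of T. fst a = d \<and> 0 \<in> \<tau> a"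
  shows "\<exists>w. length w = N \<and> closed_walk_from_depot T w \<and> (\<forall>a\<in>arcs_of T. {i. i < N \<and> w ! i = a} = \<tau> a)"
proof -
  have unique: "\<exists>!a. a \<in> arcs_of T \<and> t \<in> \<tau> a" if "t < N" for t
    using that
  proof (induction t)
    case 0
    then obtain a where "a \<in> arcs_of T" "fst a = d" "0 \<in> \<tau> a" using start by auto
    moreover have "fst b = d" if "b \<in> arcs_of T" "0 \<in> \<tau> b" for b using prev[OF that] by auto
    ultimately show ?case using disj by metis
  next
    case (Suc t)
    then obtain a where a: "a \<in> arcs_of T" "t \<in> \<tau> a" "\<And>b. b \<in> arcs_of T \<Longrightarrow> t \<in> \<tau> b \<Longrightarrow> b = a" by auto
    obtain b where b: "b \<in> arcs_of T" "fst b = snd a" "Suc t \<in> \<tau> b"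
      using succ[OF a(1,2)] Suc.prems by auto
    have "fst c = snd a" if "c \<in> arcs_of T" "Suc t \<in> \<tau> c" for c
      using prev[OF that] a(3) by auto
    with b show ?case using disj by metis
  qed
  define arc where "arc t = (THE a. a \<in> arcs_of T \<and> t \<in> \<tau> a)" for t
  have arc: "arc t \<in> arcs_of T" "t \<in> \<tau> (arc t)" if "t < N" for t
    using theI'[OF unique[OF that]] by (auto simp: arc_def)
  have arc_eq: "arc t = a" if "a \<in> arcs_of T" "t \<in> \<tau> a" for a t
    using unique[OF lt[OF that]] arc[OF lt[OF that]] that by blast
  let ?w = "map arc [0..<N]"
  show ?thesis
  proof (intro exI[of _ ?w] conjI ballI)
    show "closed_walk_from_depot T ?w"
      unfolding closed_walk_iff[OF T]
    proof (intro conjI allI impI)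
      fix i assume "i < length ?w"
      then have i: "i < N" by simp
      show "fst (?w ! i) = (if i = 0 then depot T else snd (?w ! (i - 1)))"
      proof (cases i)
        case 0 then show ?thesis using prev[OF arc[OF i]] i d by auto
      next
        case (Suc j)
        then obtain b where "b \<in> arcs_of T" "snd b = fst (arc i)" "j \<in> \<tau> b" using prev[OF arc[OF i]] by auto
        then show ?thesis using arc_eq[of b j] Suc i by simp
      qed
    next
      assume "?w \<noteq> []"
      then have "N - 1 < N" "Suc (N - 1) = N" by auto
      \<comment> \<open>No arc carries the time \<open>N\<close> by \<open>lt\<close>, so the last
        arc must fall under the exception in \<open>succ\<close>.\<close>
      then have "snd (arc (N - 1)) = d" using succ[OF arc[of "N - 1"]] lt by force
      then show "snd (last ?w) = depot T" using \<open>?w \<noteq> []\<close> d by (simp add: last_map)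
    qed (use arc in auto)
    show "{i. i < N \<and> ?w ! i = a} = \<tau> a" if a: "a \<in> arcs_of T" for a
    proof -
      have "{i. i < N \<and> ?w ! i = a} \<subseteq> \<tau> a" using arc by auto
      moreover have "i < N \<and> ?w ! i = a" if "i \<in> \<tau> a" for i
        using lt[OF a that] arc_eq[OF a that] by simp
      ultimately show ?thesis by blast
    qed
  qed simp
qed

text \<open>The arcs strictly between a departure \<open>i\<close> and the next arrival
  \<open>j\<close> form a sub-route that misses \<open>d\<close>; the bound on \<open>j\<close> says
  that there are at most \<open>K\<close> of them.\<close>

definition returns_within :: "nat \<Rightarrow> nat \<Rightarrow> (nat \<times> nat) list \<Rightarrow> bool" where
  "returns_within d K w \<longleftrightarrow> (\<forall>i<length w. fst (w ! i) = d \<longrightarrow>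
    (\<exists>j<length w. i < j \<and> j \<le> Suc (i + K) \<and> snd (w ! j) = d))"

lemma set_positions: "set (positions a w) = {i. i < length w \<and> w ! i = a}"
  by (auto simp: positions_def)

lemma good_config_walk:
  assumes T: "is_rooted_tree T" and w: "closed_walk_from_depot T w" "returns_within (depot T) K w"
  shows "good_config (length w) K (depot T) (edge_list T) v
    (config_of (edge_list T) (\<lambda>e. (positions e w, positions (snd e, fst e) w)) v)"
proof -
  let ?\<sigma> = "\<lambda>e. (positions e w, positions (snd e, fst e) w)"
  have \<tau>: "arc_times (edge_list T) ?\<sigma> a = {i. i < length w \<and> w ! i = a}" for a
    by (auto simp: arc_times_def set_positions)
  note cw = w(1)[unfolded closed_walk_iff[OF T]]
  have arc: "w ! i \<in> arcs_of T" if "i < length w" for i using cw that by auto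
  have step: "fst (w ! Suc i) = snd (w ! i)" if "Suc i < length w" for i
    using cw that by auto
  have init: "fst (w ! 0) = depot T" if "0 < length w" using cw that by auto
  have fin: "snd (w ! i) = depot T" if "Suc i = length w" for i
    using cw that by (metis last_conv_nth length_0_conv nat.distinct(1) diff_Suc_1)
  have next_or_end: "(snd (w ! i) = depot T \<and> Suc i = length w) \<or> Suc i < length w" if "i < length w" for i
    using fin[of i] that by force
  show ?thesis
    unfolding good_config_iff[OF T] \<tau>
  proof (intro conjI ballI impI)
    fix a t assume a: "fst a = v" "t \<in> {i. i < length w \<and> w ! i = a}"
    show "(v = depot T \<and> t = 0) \<or>
      (\<exists>b\<in>arcs_of T. snd b = v \<and> (\<exists>s\<in>{i. i < length w \<and> w ! i = b}. t = Suc s))"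
    proof (cases t)
      case 0 then show ?thesis using init a by auto
    next
      case (Suc s)
      then have "w ! s \<in> arcs_of T" "snd (w ! s) = v" "s < length w" using a step[of s] arc by auto
      then show ?thesis using Suc by auto
    qed
  next
    fix a t assume a: "snd a = v" "t \<in> {i. i < length w \<and> w ! i = a}"
    then show "(v = depot T \<and> Suc t = length w) \<or>
      (\<exists>b\<in>arcs_of T. fst b = v \<and> Suc t \<in> {i. i < length w \<and> w ! i = b})"
      using next_or_end[of t] step[of t] arc[of "Suc t"] by auto
  next
    assume "v = depot T \<and> 0 < length w"
    then show "\<exists>a\<in>arcs_of T. fst a = v \<and> 0 \<in> {i. i < length w \<and> w ! i = a}"
      using init arc by auto
  next
    fix a t assume "v = depot T" "fst a = v" "t \<in> {i. i < length w \<and> w ! i = a}"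
    then obtain j where "j < length w" "t < j" "j \<le> Suc (t + K)" "snd (w ! j) = depot T"
      using w(2) unfolding returns_within_def by blast
    then show "\<exists>b\<in>arcs_of T. snd b = v \<and> (\<exists>s\<in>{i. i < length w \<and> w ! i = b}. t < s \<and> s \<le> Suc (t + K))"
      using arc[of j] \<open>v = depot T\<close> by auto
  qed auto
qed

text \<open>The local conditions only see sets of times. As each list is a filtered
  \<open>[0..<N]\<close>, it is determined by its set, and so the positions agree as lists.\<close>

lemma walk_of_configs:
  assumes T: "is_rooted_tree T"
    and \<sigma>: "\<And>e. e \<in> set (edge_list T) \<Longrightarrow> (\<exists>P. fst (\<sigma> e) = filter P [0..<N]) \<and> (\<exists>P. snd (\<sigma> e) = filter P [0..<N])"
    and good: "\<And>v. v \<in> verts_of T \<Longrightarrow>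
      good_config N K (depot T) (edge_list T) v (config_of (edge_list T) \<sigma> v)"
  shows "\<exists>w. closed_walk_from_depot T w \<and> length w = N \<and> returns_within (depot T) K w \<and>
    (\<forall>e\<in>set (edge_list T). positions e w = fst (\<sigma> e) \<and> positions (snd e, fst e) w = snd (\<sigma> e))"
proof -
  let ?\<tau> = "arc_times (edge_list T) \<sigma>"
  note g = good[unfolded good_config_iff[OF T]]
  have ends: "fst a \<in> verts_of T" "snd a \<in> verts_of T" if "a \<in> arcs_of T" for a
    using arcs_of_verts[OF T, of "fst a" "snd a"] that by auto
  have lt: "t < N" if "a \<in> arcs_of T" "t \<in> ?\<tau> a" for a t
  proof -
    have "a \<in> set (edge_list T) \<or> (snd a, fst a) \<in> set (edge_list T)"
      using that(1) arcs_of_iff[of "fst a" "snd a" T] by simp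
    then obtain P where "?\<tau> a = set (filter P [0..<N])"
      using \<sigma>[of a] \<sigma>[of "(snd a, fst a)"] unfolding arc_times_def by metis
    with that(2) show ?thesis by simp
  qed
  have d: "depot T \<in> verts_of T" using T by (simp add: is_rooted_tree_def)
  have disj: "a = b" if "a \<in> arcs_of T" "b \<in> arcs_of T" "fst a = fst b" "t \<in> ?\<tau> a" "t \<in> ?\<tau> b" for a b t
  proof -
    have "fst a \<in> verts_of T" using ends(1) that(1) .
    from g[OF this, THEN conjunct1] that show ?thesis by (metis disjoint_iff)
  qed
  have prev: "(fst a = depot T \<and> t = 0) \<or> (\<exists>b\<in>arcs_of T. snd b = fst a \<and> (\<exists>s\<in>?\<tau> b. t = Suc s))"
    if "a \<in> arcs_of T" "t \<in> ?\<tau> a" for a t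
  proof -
    have "fst a \<in> verts_of T" using ends(1) that(1) .
    from g[OF this, THEN conjunct2, THEN conjunct1, rule_format, OF that(1) refl that(2)]
    show ?thesis .
  qed
  have succ: "(snd a = depot T \<and> Suc t = N) \<or> (\<exists>b\<in>arcs_of T. fst b = snd a \<and> Suc t \<in> ?\<tau> b)"
    if "a \<in> arcs_of T" "t \<in> ?\<tau> a" for a t
  proof -
    have "snd a \<in> verts_of T" using ends(2) that(1) .
    from g[OF this, THEN conjunct2, THEN conjunct2, THEN conjunct1, rule_format, OF that(1) refl that(2)]
    show ?thesis .
  qed
  have start: "\<exists>a\<in>arcs_of T. fst a = depot T \<and> 0 \<in> ?\<tau> a" if "0 < N"
    using g[OF d, THEN conjunct2, THEN conjunct2, THEN conjunct2, THEN conjunct1] that by blast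
  have "\<exists>w. length w = N \<and> closed_walk_from_depot T w \<and> (\<forall>a\<in>arcs_of T. {i. i < N \<and> w ! i = a} = ?\<tau> a)"
    by (rule walk_of_times[of "depot T" T ?\<tau> N, OF refl T])
      ((rule lt disj prev succ start; assumption)+)
  then obtain w where w: "length w = N" "closed_walk_from_depot T w"
    "\<And>a. a \<in> arcs_of T \<Longrightarrow> {i. i < N \<and> w ! i = a} = ?\<tau> a" by blast
  have in_\<tau>: "i \<in> ?\<tau> (w ! i)" if "i < N" for i
  proof -
    have "w ! i \<in> arcs_of T" using w(1,2) that nth_mem[of i w] by (auto simp: closed_walk_iff[OF T])
    from w(3)[OF this] that show ?thesis by blast
  qed
  show ?thesis
  proof (intro exI[of _ w] conjI ballI)
    show "returns_within (depot T) K w"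
      unfolding returns_within_def
    proof (intro allI impI)
      fix i assume i: "i < length w" "fst (w ! i) = depot T"
      then have "w ! i \<in> arcs_of T" using w(2) by (auto simp: closed_walk_iff[OF T])
      then obtain b s where b: "b \<in> arcs_of T" "snd b = depot T" "s \<in> ?\<tau> b" "i < s" "s \<le> Suc (i + K)"
        using g[OF d, THEN conjunct2, THEN conjunct2, THEN conjunct2, THEN conjunct2] i in_\<tau>[of i] w(1)
        by blast
      then have "s < N" "w ! s = b" using w(3)[of b] by auto
      with b show "\<exists>j<length w. i < j \<and> j \<le> Suc (i + K) \<and> snd (w ! j) = depot T" using w(1) by auto
    qed
  next
    fix e assume e: "e \<in> set (edge_list T)"
    then have arcs: "e \<in> arcs_of T" "(snd e, fst e) \<in> arcs_of T" "(snd e, fst e) \<notin> set (edge_list T)"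
      using arcs_of_iff[of "fst e" "snd e" T] arcs_of_iff[of "snd e" "fst e" T]
        edge_list_no_reverse[OF T, of "fst e" "snd e"] by auto
    have filter_eq: "positions a w = filter P [0..<N]" if "a \<in> arcs_of T" "?\<tau> a = set (filter P [0..<N])" for a P
      unfolding positions_def w(1)
      by (rule filter_cong) (use w(3)[OF that(1)] that(2) in auto)
    show "positions e w = fst (\<sigma> e)" "positions (snd e, fst e) w = snd (\<sigma> e)"
      using \<sigma>[OF e] filter_eq[OF arcs(1)] filter_eq[OF arcs(2)] e arcs(3)
      by (auto simp: arc_times_def)
  qed (use w(1,2) in auto)
qed

section \<open>Arc consistency\<close>

type_synonym config = "nat \<times> cand list"

definition configs :: "nat \<Rightarrow> nat \<Rightarrow> nat \<Rightarrow> nat \<Rightarrow> nat list \<Rightarrow> (nat \<times> nat) list \<Rightarrow> cand list \<Rightarrow> config list" where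
  "configs D N K d vs es cs =
    concat (map (\<lambda>v. map (\<lambda>c. (v, c)) (filter (\<lambda>c. good_config N K d es v c) (lists_upto D cs))) vs)"

text \<open>Support is asked for at both ends, which avoids a case distinction: at its own vertex a
  config supports itself.\<close>

definition prune :: "config list \<Rightarrow> config list" where
  "prune R = filter (\<lambda>c. \<forall>x\<in>set (snd c).
    (\<exists>b\<in>set R. fst b = fst (fst x) \<and> x \<in> set (snd b)) \<and>
    (\<exists>b\<in>set R. fst b = snd (fst x) \<and> x \<in> set (snd b))) R"

definition prune_all :: "config list \<Rightarrow> config list" where
  "prune_all R = (prune ^^ length R) R"

definition solvable :: "nat \<Rightarrow> nat \<Rightarrow> nat \<Rightarrow> nat \<Rightarrow> nat list \<Rightarrow> (nat \<times> nat) list \<Rightarrow> cand list \<Rightarrow> bool" where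
  "solvable D N K d vs es cs \<longleftrightarrow>
    (\<forall>v\<in>set vs. \<exists>c\<in>set (prune_all (configs D N K d vs es cs)). fst c = v)"

lemma good_config_functional:
  assumes "good_config N K d es v c" "x \<in> set c" "y \<in> set c" "fst x = fst y"
  shows "x = y"
proof -
  have "\<forall>x\<in>set c. \<forall>y\<in>set c. x = y \<or> (fst x \<noteq> fst y \<and> (\<forall>t\<in>set (outs v x). t \<notin> set (outs v y)))"
    using assms(1) unfolding good_config_def by (elim conjE)
  then show ?thesis using assms(2-4) by metis
qed

lemma good_config_incident:
  assumes "good_config N K d es v c" "x \<in> set c"
  shows "v = fst (fst x) \<or> v = snd (fst x)"
  using assms(1)[unfolded good_config_def, THEN conjunct1] assms(2) by (rule bspec)

lemma good_config_cover:
  assumes "good_config N K d es v c" "e \<in> set es" "v = fst e \<or> v = snd e"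
  shows "\<exists>x\<in>set c. fst x = e"
  using assms(1)[unfolded good_config_def, THEN conjunct2, THEN conjunct1] assms(2,3) by metis

lemma filter_length_eq: "length (filter P xs) = length xs \<Longrightarrow> filter P xs = xs"
  by (metis filter_True length_filter_less nat_neq_iff)

text \<open>A round that changes anything removes at least one config, so \<open>length R\<close>
  rounds suffice.\<close>

lemma prune_all_fixpoint: "prune (prune_all R) = prune_all R"
proof -
  have le: "length (prune R) \<le> length R" for R by (simp add: prune_def)
  have eq: "prune R = R" if "length (prune R) = length R" for R
    using that filter_length_eq unfolding prune_def by blast
  have "prune ((prune ^^ n) R) = (prune ^^ n) R \<or> length ((prune ^^ n) R) + n \<le> length R" for n
  proof (induction n)
    case (Suc n)
    then show ?case using eq[of "(prune ^^ n) R"] le[of "(prune ^^ n) R"] by force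
  qed simp
  from this[of "length R"] show ?thesis
    unfolding prune_all_def by (auto simp: prune_def)
qed

lemma set_prune_all_subset: "set (prune_all R) \<subseteq> set R"
proof -
  have "set ((prune ^^ n) R) \<subseteq> set R" for n
    by (induction n) (auto simp: prune_def)
  then show ?thesis by (simp add: prune_all_def)
qed

text \<open>A set whose members support one another loses no member in any round. So the fixpoint
  contains every such set.\<close>

lemma prune_all_supersolution:
  assumes "S \<subseteq> set R"
    and "\<And>c x. c \<in> S \<Longrightarrow> x \<in> set (snd c) \<Longrightarrow>
      (\<exists>b\<in>S. fst b = fst (fst x) \<and> x \<in> set (snd b)) \<and> (\<exists>b\<in>S. fst b = snd (fst x) \<and> x \<in> set (snd b))"
  shows "S \<subseteq> set (prune_all R)"
proof -
  have "S \<subseteq> set ((prune ^^ n) R)" for n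
  proof (induction n)
    case (Suc n)
    show ?case
    proof
      fix c assume c: "c \<in> S"
      have "\<forall>x\<in>set (snd c). (\<exists>b\<in>set ((prune ^^ n) R). fst b = fst (fst x) \<and> x \<in> set (snd b)) \<and>
        (\<exists>b\<in>set ((prune ^^ n) R). fst b = snd (fst x) \<and> x \<in> set (snd b))"
        using assms(2)[OF c] Suc by blast
      then have "c \<in> set (prune ((prune ^^ n) R))"
        using c Suc unfolding prune_def[of "(prune ^^ n) R"] by auto
      then show "c \<in> set ((prune ^^ Suc n) R)" by simp
    qed
  qed (use assms(1) in simp)
  then show ?thesis by (simp add: prune_all_def)
qed

text \<open>The degree counts edges as sets, and these are distinct along the list. Hence configs of
  length at most \<open>D\<close> cover all edges at a vertex.\<close>

lemma length_incident_edges: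
  assumes T: "is_rooted_tree T" and D: "max_degree_le D T" and v: "v \<in> verts_of T"
  shows "length (filter (\<lambda>e. v = fst e \<or> v = snd e) (edge_list T)) \<le> D"
proof -
  let ?es = "filter (\<lambda>e. v = fst e \<or> v = snd e) (edge_list T)"
  have "distinct (map (\<lambda>(u, v). {u, v}) (edge_list T))" using T by (simp add: is_rooted_tree_def)
  then have dist: "distinct (map (\<lambda>(u, v). {u, v}) ?es)" by (rule distinct_map_filter)
  have "length ?es = card (set (map (\<lambda>(u, v). {u, v}) ?es))"
    using distinct_card[OF dist] by simp
  also have "\<dots> \<le> card {e \<in> edges T. v \<in> e}"
    by (rule card_mono) (auto simp: edges_def)
  also have "\<dots> \<le> D" using D v by (simp add: max_degree_le_def)
  finally show ?thesis .
qed

text \<open>The configs induced by a solution support one another and survive. Conversely, every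
  survivor has a matching survivor across each of its edges, so the survivors can label the tree
  consistently, and \<open>\<sigma>\<close> is read off from the labels.\<close>

lemma solvable_iff:
  assumes T: "is_rooted_tree T" and D: "max_degree_le D T"
    and cs: "\<And>x. x \<in> set cs \<Longrightarrow> fst x \<in> set (edge_list T)"
  shows "solvable D N K (depot T) (vertex_list T) (edge_list T) cs \<longleftrightarrow>
    (\<exists>\<sigma>. (\<forall>e\<in>set (edge_list T). (e, \<sigma> e) \<in> set cs) \<and>
      (\<forall>v\<in>verts_of T. good_config N K (depot T) (edge_list T) v (config_of (edge_list T) \<sigma> v)))"
    (is "?L \<longleftrightarrow> ?R")
proof
  let ?es = "edge_list T" and ?Cs = "configs D N K (depot T) (vertex_list T) (edge_list T) cs"
  assume ?R
  then obtain \<sigma> where \<sigma>: "\<And>e. e \<in> set ?es \<Longrightarrow> (e, \<sigma> e) \<in> set cs"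
    "\<And>v. v \<in> verts_of T \<Longrightarrow> good_config N K (depot T) ?es v (config_of ?es \<sigma> v)" by blast
  let ?S = "(\<lambda>v. (v, config_of ?es \<sigma> v)) ` verts_of T"
  have "?S \<subseteq> set (prune_all ?Cs)"
  proof (rule prune_all_supersolution)
    show "?S \<subseteq> set ?Cs"
    proof
      fix c assume "c \<in> ?S"
      then obtain v where v: "v \<in> verts_of T" "c = (v, config_of ?es \<sigma> v)" by blast
      have "config_of ?es \<sigma> v \<in> set (lists_upto D cs)"
        using \<sigma>(1) length_incident_edges[OF T D v(1)] by (auto simp: set_lists_upto config_of_def)
      then show "c \<in> set ?Cs" using v \<sigma>(2)[OF v(1)] by (auto simp: configs_def)
    qed
  next
    fix c x assume "c \<in> ?S" "x \<in> set (snd c)"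
    then obtain e where e: "e \<in> set ?es" "x = (e, \<sigma> e)" by (auto simp: config_of_def)
    then have "fst e \<in> verts_of T" "snd e \<in> verts_of T" using T by (auto simp: is_rooted_tree_def)
    moreover have "x \<in> set (config_of ?es \<sigma> (fst e))" "x \<in> set (config_of ?es \<sigma> (snd e))"
      using e by (auto simp: config_of_def)
    ultimately show "(\<exists>b\<in>?S. fst b = fst (fst x) \<and> x \<in> set (snd b)) \<and>
      (\<exists>b\<in>?S. fst b = snd (fst x) \<and> x \<in> set (snd b))"
      using e(2) by auto
  qed
  then show ?L unfolding solvable_def by force
next
  let ?es = "edge_list T" and ?Cs = "configs D N K (depot T) (vertex_list T) (edge_list T) cs"
  assume ?L
  define R where "R v = {c. (v, c) \<in> set (prune_all ?Cs)}" for v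
  \<comment> \<open>Compares the candidates for the common edge in either orientation, since it is
    not known which one is listed.\<close>
  define agree :: "nat \<Rightarrow> nat \<Rightarrow> cand list \<Rightarrow> cand list \<Rightarrow> bool"
    where "agree u v a b \<longleftrightarrow> (\<forall>x. fst x = (u, v) \<or> fst x = (v, u) \<longrightarrow> x \<in> set a \<longleftrightarrow> x \<in> set b)" for u v a b
  have nonempty: "\<exists>c. c \<in> R v" if "v \<in> verts_of T" for v
    using \<open>?L\<close> that unfolding solvable_def R_def by fastforce
  have R: "good_config N K (depot T) ?es v c" "set c \<subseteq> set cs" if "c \<in> R v" for v c
    using that set_prune_all_subset[of ?Cs] unfolding R_def configs_def
    by (auto simp: set_lists_upto)
  have fixpoint: "(\<exists>b\<in>R (fst (fst x)). x \<in> set b) \<and> (\<exists>b\<in>R (snd (fst x)). x \<in> set b)"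
    if "c \<in> R v" "x \<in> set c" for v c x
  proof -
    have "(v, c) \<in> set (prune (prune_all ?Cs))" using that(1) by (simp add: R_def prune_all_fixpoint)
    with that(2) show ?thesis unfolding prune_def R_def by force
  qed
  note functional = good_config_functional and cover = good_config_cover
  have "depot T \<in> verts_of T" using T by (simp add: is_rooted_tree_def)
  then obtain c0 where "c0 \<in> R (depot T)" using nonempty by blast
  have extend: "\<exists>b\<in>R v. agree u v a b" if uv: "(u, v) \<in> arcs_of T" and a: "a \<in> R u" for u v a
  proof -
    obtain e where e: "e \<in> set ?es" "e = (u, v) \<or> e = (v, u)" using uv by (auto simp: arcs_of_iff)
    then obtain x where x: "x \<in> set a" "fst x = e" using cover[OF R(1)[OF a], of e] by auto
    then obtain b where b: "b \<in> R v" "x \<in> set b" using fixpoint[OF a x(1)] e(2) a by auto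
    \<comment> \<open>Each of the two configs has at most one candidate for the edge, so the shared
      \<open>x\<close> settles agreement.\<close>
    have only: "y = x" if "y \<in> set a \<or> y \<in> set b" "fst y = (u, v) \<or> fst y = (v, u)" for y
    proof -
      have "y \<in> set cs" using that(1) R(2)[OF a] R(2)[OF b(1)] by blast
      then have "fst y \<in> set ?es" by (rule cs)
      then have "fst y = e" using that(2) e edge_list_no_reverse[OF T, of u v] by auto
      then show ?thesis
        using that(1) functional[OF R(1)[OF a], of y x] functional[OF R(1)[OF b(1)], of y x] x b by auto
    qed
    have "agree u v a b" unfolding agree_def using only x(1) b(2) by blast
    with b(1) show ?thesis by blast
  qed
  have "\<exists>f. (\<forall>v\<in>verts_of T. f v \<in> R v) \<and> (\<forall>(u, v)\<in>arcs_of T. agree u v (f u) (f v))"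
    by (rule tree_labelling[where R = R and agree = agree, OF T])
      (rule \<open>c0 \<in> R (depot T)\<close>, rule extend, assumption+, auto simp: agree_def)
  then obtain f where f: "\<And>v. v \<in> verts_of T \<Longrightarrow> f v \<in> R v"
    "\<And>u v. (u, v) \<in> arcs_of T \<Longrightarrow> agree u v (f u) (f v)"
    by blast
  \<comment> \<open>The candidate is taken from the label at the first end; \<open>agree\<close>
    places it in the label at the second end as well.\<close>
  define pick where "pick e = (SOME x. x \<in> set (f (fst e)) \<and> fst x = e)" for e
  define \<sigma> where "\<sigma> e = snd (pick e)" for e
  have at_fst: "(e, \<sigma> e) \<in> set (f (fst e))" and at_snd: "(e, \<sigma> e) \<in> set (f (snd e))"
    and ends: "fst e \<in> verts_of T" "snd e \<in> verts_of T" if e: "e \<in> set ?es" for e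
  proof -
    show v: "fst e \<in> verts_of T" "snd e \<in> verts_of T" using T e by (auto simp: is_rooted_tree_def)
    have "\<exists>x. x \<in> set (f (fst e)) \<and> fst x = e"
      using cover[OF R(1)[OF f(1)[OF v(1)]] e] by blast
    then have "pick e \<in> set (f (fst e)) \<and> fst (pick e) = e" unfolding pick_def by (rule someI_ex)
    moreover from this have "(e, \<sigma> e) = pick e" by (simp add: \<sigma>_def prod_eq_iff)
    ultimately show *: "(e, \<sigma> e) \<in> set (f (fst e))" by simp
    have "(fst e, snd e) \<in> arcs_of T" unfolding arcs_of_iff using e by simp
    from f(2)[OF this, unfolded agree_def, rule_format, of "(e, \<sigma> e)"] *
    show "(e, \<sigma> e) \<in> set (f (snd e))" by simp
  qed
  show ?R
  proof (intro exI[of _ \<sigma>] conjI ballI)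
    fix e assume "e \<in> set ?es"
    from at_fst[OF this] R(2)[OF f(1)[OF ends(1)[OF this]]] show "(e, \<sigma> e) \<in> set cs"
      by (rule rev_subsetD)
  next
    fix v assume v: "v \<in> verts_of T"
    note g = R(1)[OF f(1)[OF v]]
    \<comment> \<open>\<open>good_config\<close> depends on the set of candidates only, so the label
      may differ from \<open>config_of\<close> in order and repetitions.\<close>
    have eq: "set (config_of ?es \<sigma> v) = set (f v)"
    proof (intro set_eqI iffI)
      fix x assume "x \<in> set (config_of ?es \<sigma> v)"
      then obtain e where e: "e \<in> set ?es" "x = (e, \<sigma> e)" "v = fst e \<or> v = snd e"
        unfolding config_of_def by auto
      then show "x \<in> set (f v)" using at_fst[OF e(1)] at_snd[OF e(1)] by metis
    next
      fix x assume x: "x \<in> set (f v)"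
      with R(2)[OF f(1)[OF v]] have "x \<in> set cs" by (rule subsetD)
      then have e: "fst x \<in> set ?es" by (rule cs)
      have inc: "v = fst (fst x) \<or> v = snd (fst x)" using g x by (rule good_config_incident)
      then have "(fst x, \<sigma> (fst x)) \<in> set (f v)" using at_fst[OF e] at_snd[OF e] by metis
      then have "x = (fst x, \<sigma> (fst x))" using functional[OF g x] by simp
      then show "x \<in> set (config_of ?es \<sigma> v)" using e inc unfolding config_of_def by auto
    qed
    from g show "good_config N K (depot T) ?es v (config_of ?es \<sigma> v)"
      unfolding good_config_def eq .
  qed
qed

section \<open>The decision procedure\<close>

text \<open>The enumeration produces unsorted lists with repetitions; filtering
  \<open>[0..<N]\<close> sorts them, which gives the form in which \<open>positions\<close> lists
  its times.\<close>

definition time_lists :: "nat \<Rightarrow> nat \<Rightarrow> nat list list" where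
  "time_lists F N = map (\<lambda>c. filter (\<lambda>i. i \<in> set c) [0..<N]) (lists_upto F [0..<N])"

lemma mem_time_lists:
  "ts \<in> set (time_lists F N) \<longleftrightarrow> length ts \<le> F \<and> (\<exists>P. ts = filter P [0..<N])"
proof
  assume "ts \<in> set (time_lists F N)"
  then obtain c where c: "length c \<le> F" "ts = filter (\<lambda>i. i \<in> set c) [0..<N]"
    by (auto simp: time_lists_def set_lists_upto)
  have "length ts = card (set ts)" unfolding c(2) by (simp add: distinct_card[symmetric] del: set_filter)
  also have "\<dots> \<le> card (set c)" unfolding c(2) by (intro card_mono) auto
  also have "\<dots> \<le> length c" by (rule card_length)
  finally show "length ts \<le> F \<and> (\<exists>P. ts = filter P [0..<N])" using c by auto
next
  assume "length ts \<le> F \<and> (\<exists>P. ts = filter P [0..<N])"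
  then obtain P where "length ts \<le> F" "ts = filter P [0..<N]" by blast
  moreover from this(2) have "ts = filter (\<lambda>i. i \<in> set ts) [0..<N]"
    by (auto intro!: filter_cong)
  ultimately show "ts \<in> set (time_lists F N)"
    by (auto simp: time_lists_def set_lists_upto intro!: image_eqI[of _ _ ts])
qed

text \<open>The additional data of type \<open>'x\<close> of an edge is what \<open>ok\<close> consults to judge the list of
  traversal times of either of its two arcs.\<close>

definition candidates :: "nat \<Rightarrow> nat \<Rightarrow> ('x \<Rightarrow> nat list \<Rightarrow> bool) \<Rightarrow> ((nat \<times> nat) \<times> 'x) list \<Rightarrow> cand list" where
  "candidates F N ok xs = concat (map (\<lambda>x. concat (map (\<lambda>ts.
      map (\<lambda>ts'. (fst x, (ts, ts'))) (filter (\<lambda>ts. ok (snd x) ts) (time_lists F N)))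
    (filter (\<lambda>ts. ok (snd x) ts) (time_lists F N)))) xs)"

lemma mem_candidates:
  "(e, ts, ts') \<in> set (candidates F N ok xs) \<longleftrightarrow>
    (\<exists>x. (e, x) \<in> set xs \<and> ok x ts \<and> ok x ts' \<and> ts \<in> set (time_lists F N) \<and> ts' \<in> set (time_lists F N))"
proof -
  have "(e, ts, ts') \<in> set (candidates F N ok xs) \<longleftrightarrow> (\<exists>x\<in>set xs. e = fst x \<and> ok (snd x) ts \<and>
    ok (snd x) ts' \<and> ts \<in> set (time_lists F N) \<and> ts' \<in> set (time_lists F N))"
    by (simp add: candidates_def image_iff) blast
  then show ?thesis by force
qed

text \<open>\<open>K\<close>, \<open>ok\<close> and \<open>L\<close> take the length
  \<open>N\<close> as an argument, because cyclic gaps and bounds on the length can be judged only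
  when it is known.\<close>

definition walk_search ::
  "nat \<Rightarrow> nat \<Rightarrow> nat \<Rightarrow> (nat \<Rightarrow> nat) \<Rightarrow> (nat \<Rightarrow> 'x \<Rightarrow> nat list \<Rightarrow> bool) \<Rightarrow> (nat \<Rightarrow> bool) \<Rightarrow>
    nat \<Rightarrow> nat list \<Rightarrow> ((nat \<times> nat) \<times> 'x) list \<Rightarrow> bool" where
  "walk_search F D c K ok L d vs xs \<longleftrightarrow> (\<exists>N\<in>set [0..<Suc (c * length xs)]. L N \<and>
    solvable D N (K N) d vs (map fst xs) (candidates F N (ok N) xs))"

lemma length_positions: "length (positions a w) = count_list w a"
proof -
  have "count_list w a = length (filter ((=) a) (map ((!) w) [0..<length w]))"
    by (simp only: map_nth count_list_eq_length_filter)
  also have "\<dots> = length (filter (\<lambda>i. w ! i = a) [0..<length w])"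
    by (simp only: filter_map length_map) (rule arg_cong[where f = length], auto intro: filter_cong)
  finally show ?thesis by (simp add: positions_def)
qed

lemma walk_length_bound:
  assumes T: "is_rooted_tree T" and w: "closed_walk_from_depot T w"
    and F: "\<And>a. a \<in> arcs_of T \<Longrightarrow> count_list w a \<le> F"
  shows "length w \<le> 2 * F * length (edge_list T)"
proof -
  let ?A = "set (edge_list T) \<union> (\<lambda>e. (snd e, fst e)) ` set (edge_list T)"
  have "arcs_of T \<subseteq> ?A" by (force simp: arcs_of_iff)
  then have sub: "set w \<subseteq> ?A" "set w \<subseteq> arcs_of T" using w by (auto simp: closed_walk_iff[OF T])
  have "length w = (\<Sum>a\<in>set w. count_list w a)" by (simp add: sum_count_set)
  also have "\<dots> \<le> (\<Sum>a\<in>set w. F)" using F sub by (intro sum_mono) auto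
  also have "\<dots> \<le> card ?A * F" using card_mono[OF _ sub(1)] by simp
  also have "card ?A \<le> card (set (edge_list T)) + card ((\<lambda>e. (snd e, fst e)) ` set (edge_list T))"
    by (rule card_Un_le)
  also have "\<dots> \<le> length (edge_list T) + length (edge_list T)"
    by (intro add_mono card_length order_trans[OF card_image_le]) auto
  finally show ?thesis by (simp add: algebra_simps)
qed

text \<open>The hypothesis that \<open>ok\<close> accepts at most \<open>F\<close> times per arc has
  two effects: the times of any admissible walk are among the candidates, and the walk is short
  enough to be met by the search over \<open>N\<close>.\<close>

lemma walk_search_iff:
  fixes T :: "'z tree_input_scheme"
  assumes T: "is_rooted_tree T" and D: "max_degree_le D T" and c: "c = 2 * F"
    and xs: "xs = map (\<lambda>(u, v). ((u, v), x {u, v})) (edge_list T)"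
    and F: "\<And>e N ts. e \<in> edges T \<Longrightarrow> ok N (x e) ts \<Longrightarrow> length ts \<le> F"
  shows "walk_search F D c K ok L (depot T) (vertex_list T) xs \<longleftrightarrow>
    (\<exists>w. closed_walk_from_depot T w \<and> L (length w) \<and>
      (\<forall>(u, v)\<in>arcs_of T. ok (length w) (x {u, v}) (positions (u, v) w)) \<and>
      returns_within (depot T) (K (length w)) w)" (is "?L \<longleftrightarrow> ?R")
proof -
  let ?es = "edge_list T"
  have es: "map fst xs = ?es" by (auto simp: xs o_def case_prod_beta intro: map_idI)
  have mem_xs: "(e, y) \<in> set xs \<longleftrightarrow> e \<in> set ?es \<and> y = x {fst e, snd e}" for e y
    by (cases e) (auto simp: xs image_iff Bex_def)
  have cands: "fst y \<in> set ?es" if "y \<in> set (candidates F N (ok N) xs)" for y N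
  proof -
    obtain e ts ts' where "y = (e, ts, ts')" by (metis prod_cases3)
    then show ?thesis using that mem_xs by (auto simp: mem_candidates)
  qed
  have sol: "solvable D N (K N) (depot T) (vertex_list T) ?es (candidates F N (ok N) xs) \<longleftrightarrow>
    (\<exists>\<sigma>. (\<forall>e\<in>set ?es. (e, \<sigma> e) \<in> set (candidates F N (ok N) xs)) \<and>
      (\<forall>v\<in>verts_of T. good_config N (K N) (depot T) ?es v (config_of ?es \<sigma> v)))" for N
    by (rule solvable_iff[OF T D]) (rule cands)
  have edge: "{fst e, snd e} \<in> edges T" if "e \<in> set ?es" for e
    using that by (force simp: edges_def)
  show ?thesis
  proof
    assume ?L
    then obtain N \<sigma> where N: "L N"
      and \<sigma>: "\<And>e. e \<in> set ?es \<Longrightarrow> (e, \<sigma> e) \<in> set (candidates F N (ok N) xs)"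
      and g: "\<And>v. v \<in> verts_of T \<Longrightarrow> good_config N (K N) (depot T) ?es v (config_of ?es \<sigma> v)"
      unfolding walk_search_def es sol by blast
    have \<sigma>': "ok N (x {fst e, snd e}) (fst (\<sigma> e)) \<and> ok N (x {fst e, snd e}) (snd (\<sigma> e)) \<and>
      fst (\<sigma> e) \<in> set (time_lists F N) \<and> snd (\<sigma> e) \<in> set (time_lists F N)" if "e \<in> set ?es" for e
    proof -
      have "(e, fst (\<sigma> e), snd (\<sigma> e)) \<in> set (candidates F N (ok N) xs)" using \<sigma>[OF that] by simp
      then show ?thesis unfolding mem_candidates mem_xs by blast
    qed
    have P: "(\<exists>P. fst (\<sigma> e) = filter P [0..<N]) \<and> (\<exists>P. snd (\<sigma> e) = filter P [0..<N])"
      if "e \<in> set ?es" for e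
      using \<sigma>'[OF that] mem_time_lists by metis
    have "\<exists>w. closed_walk_from_depot T w \<and> length w = N \<and> returns_within (depot T) (K N) w \<and>
      (\<forall>e\<in>set ?es. positions e w = fst (\<sigma> e) \<and> positions (snd e, fst e) w = snd (\<sigma> e))"
      by (rule walk_of_configs[OF T]) (rule P g; assumption)+
    then obtain w where w: "closed_walk_from_depot T w" "length w = N" "returns_within (depot T) (K N) w"
      "\<And>e. e \<in> set ?es \<Longrightarrow> positions e w = fst (\<sigma> e) \<and> positions (snd e, fst e) w = snd (\<sigma> e)"
      by blast
    have "ok N (x {u, v}) (positions (u, v) w)" if "(u, v) \<in> arcs_of T" for u v
      using that[unfolded arcs_of_iff]
    proof
      assume "(u, v) \<in> set ?es" then show ?thesis using w(4) \<sigma>'[of "(u, v)"] by force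
    next
      assume "(v, u) \<in> set ?es" then show ?thesis using w(4)[of "(v, u)"] \<sigma>'[of "(v, u)"]
        by (simp add: insert_commute)
    qed
    then show ?R using w N by blast
  next
    assume ?R
    then obtain w where w: "closed_walk_from_depot T w" "L (length w)" "returns_within (depot T) (K (length w)) w"
      and ok: "\<And>u v. (u, v) \<in> arcs_of T \<Longrightarrow> ok (length w) (x {u, v}) (positions (u, v) w)" by blast
    let ?N = "length w"
    let ?\<sigma> = "\<lambda>e. (positions e w, positions (snd e, fst e) w)"
    have len: "length (positions a w) \<le> F" if "a \<in> arcs_of T" for a
    proof -
      have "{fst a, snd a} \<in> edges T" using that by (auto simp: sym_orient_def)
      then show ?thesis using F ok[of "fst a" "snd a"] that by simp
    qed
    have "(e, ?\<sigma> e) \<in> set (candidates F ?N (ok ?N) xs)" if "e \<in> set ?es" for e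
    proof -
      have arcs: "(fst e, snd e) \<in> arcs_of T" "(snd e, fst e) \<in> arcs_of T"
        unfolding arcs_of_iff using that by simp_all
      then have "positions e w \<in> set (time_lists F ?N)" "positions (snd e, fst e) w \<in> set (time_lists F ?N)"
        using len[OF arcs(1)] len[OF arcs(2)] unfolding mem_time_lists by (auto simp: positions_def)
      then show ?thesis unfolding mem_candidates
        using mem_xs[of e] that ok[OF arcs(1)] ok[OF arcs(2)] insert_commute[of "snd e" "fst e" "{}"] by simp
    qed
    moreover have "good_config ?N (K ?N) (depot T) ?es v (config_of ?es ?\<sigma> v)" for v
      by (rule good_config_walk[OF T w(1,3)])
    ultimately have "solvable D ?N (K ?N) (depot T) (vertex_list T) ?es (candidates F ?N (ok ?N) xs)"
      unfolding sol by (intro exI[of _ ?\<sigma>]) blast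
    moreover have "length w \<le> c * length xs"
      using walk_length_bound[OF T w(1), of F] len by (simp add: length_positions c xs)
    ultimately show ?L unfolding walk_search_def es using w(2) by (intro bexI[of _ ?N]) auto
  qed
qed

section \<open>Running time of the search\<close>

abbreviation enc_cand :: "cand \<Rightarrow> data" where
  "enc_cand \<equiv> enc_prod (enc_prod enc_nat enc_nat) (enc_prod (enc_list enc_unary) (enc_list enc_unary))"

lemmas inj_encs = inj_enc_nat inj_enc_unary inj_enc_prod inj_enc_list

declare polyf_eq [polyf_intros]

lemma polyf_outs [polyf_intros]:
  assumes "polyf A enc_nat v" "polyf A enc_cand x"
  shows "polyf A (enc_list enc_unary) (\<lambda>s. outs (v s) (x s))"
  unfolding outs_def by (rule polyf_intros assms inj_encs)+

lemma polyf_ins [polyf_intros]: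
  assumes "polyf A enc_nat v" "polyf A enc_cand x"
  shows "polyf A (enc_list enc_unary) (\<lambda>s. ins (v s) (x s))"
  unfolding ins_def by (rule polyf_intros assms inj_encs)+

lemma polyf_good_config [polyf_intros]:
  assumes "polyf A enc_unary N" "polyf A enc_unary K" "polyf A enc_nat d"
    "polyf A (enc_list (enc_prod enc_nat enc_nat)) es" "polyf A enc_nat v" "polyf A (enc_list enc_cand) c"
  shows "polyf A enc_bool (\<lambda>s. good_config (N s) (K s) (d s) (es s) (v s) (c s))"
  unfolding good_config_def
  by (rule assms polyf_intros inj_encs polyf_comp[OF _ assms(1)] polyf_comp[OF _ assms(2)]
      polyf_comp[OF _ assms(3)] polyf_comp[OF _ assms(4)] polyf_comp[OF _ assms(5)]
      polyf_comp[OF _ assms(6)])+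

abbreviation enc_config :: "config \<Rightarrow> data" where
  "enc_config \<equiv> enc_prod enc_nat (enc_list enc_cand)"

lemma polyf_configs [polyf_intros]:
  assumes "polyf A enc_unary N" "polyf A enc_unary K" "polyf A enc_nat d" "polyf A (enc_list enc_nat) vs"
    "polyf A (enc_list (enc_prod enc_nat enc_nat)) es" "polyf A (enc_list enc_cand) cs"
  shows "polyf A (enc_list enc_config) (\<lambda>s. configs D (N s) (K s) (d s) (vs s) (es s) (cs s))"
  unfolding configs_def
  by (rule assms polyf_intros polyf_comp[OF _ assms(1)] polyf_comp[OF _ assms(2)]
      polyf_comp[OF _ assms(3)] polyf_comp[OF _ assms(5)] polyf_comp[OF _ assms(6)])+

lemma polyf_prune [polyf_intros]:
  assumes "polyf A (enc_list enc_config) R"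
  shows "polyf A (enc_list enc_config) (\<lambda>s. prune (R s))"
  unfolding prune_def by (rule assms polyf_intros inj_encs polyf_comp[OF _ assms])+

text \<open>Filtering never enlarges a list, so the size of the initial list bounds all
  rounds.\<close>

lemma polyf_prune_all [polyf_intros]:
  assumes "polyf A (enc_list enc_config) R"
  shows "polyf A (enc_list enc_config) (\<lambda>s. prune_all (R s))"
proof -
  obtain q where q: "\<And>s. size (enc_list enc_config (R s)) \<le> poly q (size (A s))"
    by (rule polyf_size[OF assms]) blast
  have filter: "size (enc_list X (filter P xs)) \<le> size (enc_list X xs)" for X P and xs :: "'x list"
    by (induction xs) auto
  have "size (enc_list enc_config ((prune ^^ n) xs)) \<le> size (enc_list enc_config xs)" for n xs
    by (induction n) (auto simp: prune_def intro: order_trans[OF filter])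
  then have "size (enc_list enc_config (((\<lambda>a. prune a) ^^ n) (R s))) \<le> poly q (size (A s))" for n s
    using q order_trans by blast
  then have "polyf A (enc_list enc_config) (\<lambda>s. ((\<lambda>a. prune a) ^^ length (R s)) (R s))"
    by (intro polyf_funpow[of A "\<lambda>s. length (R s)" "enc_list enc_config" R "\<lambda>a _. prune a"])
      (rule assms polyf_intros | blast)+
  then show ?thesis by (simp add: prune_all_def)
qed

lemma polyf_solvable [polyf_intros]:
  assumes "polyf A enc_unary N" "polyf A enc_unary K" "polyf A enc_nat d" "polyf A (enc_list enc_nat) vs"
    "polyf A (enc_list (enc_prod enc_nat enc_nat)) es" "polyf A (enc_list enc_cand) cs"
  shows "polyf A enc_bool (\<lambda>s. solvable D (N s) (K s) (d s) (vs s) (es s) (cs s))"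
proof -
  have R: "polyf A (enc_list enc_config) (\<lambda>s. prune_all (configs D (N s) (K s) (d s) (vs s) (es s) (cs s)))"
    by (rule assms polyf_intros)+
  show ?thesis unfolding solvable_def
    by (rule assms(4) polyf_comp[OF _ R] polyf_Ball polyf_Bex polyf_eq polyf_fst polyf_snd polyf_id
        inj_encs)+
qed

lemma polyf_time_lists [polyf_intros]:
  assumes "polyf A enc_unary N"
  shows "polyf A (enc_list (enc_list enc_unary)) (\<lambda>s. time_lists F (N s))"
  unfolding time_lists_def by (rule assms polyf_intros inj_encs polyf_comp[OF _ assms])+

lemma polyf_candidates:
  assumes N: "polyf A enc_unary N" and xs: "polyf A (enc_list (enc_prod (enc_prod enc_nat enc_nat) X)) xs"
    and ok: "polyf (enc_prod (enc_list enc_unary) (enc_prod X A)) enc_bool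
      (\<lambda>p. ok (snd (snd p)) (fst (snd p)) (fst p))"
  shows "polyf A (enc_list enc_cand) (\<lambda>s. candidates F (N s) (ok s) (xs s))"
proof -
  have ok': "polyf B enc_bool (\<lambda>b. ok (f b) (g b) (h b))"
    if "polyf B A f" "polyf B X g" "polyf B (enc_list enc_unary) h" for B :: "'fresh \<Rightarrow> data" and f g h
    using polyf_comp[OF polyf_Pair[OF that(3) polyf_Pair[OF that(2,1)]] ok] by simp
  show ?thesis unfolding candidates_def
    by (rule xs ok' polyf_intros polyf_comp[OF _ N])+
qed

lemma polyf_walk_search:
  assumes "polyf A enc_nat d" "polyf A (enc_list enc_nat) vs"
    and xs: "polyf A (enc_list (enc_prod (enc_prod enc_nat enc_nat) X)) xs"
    and K: "polyf (enc_prod enc_unary A) enc_unary (\<lambda>p. K (snd p) (fst p))"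
    and L: "polyf (enc_prod enc_unary A) enc_bool (\<lambda>p. L (snd p) (fst p))"
    and ok: "polyf (enc_prod (enc_list enc_unary) (enc_prod X (enc_prod enc_unary A))) enc_bool
      (\<lambda>p. ok (snd (snd (snd p))) (fst (snd (snd p))) (fst (snd p)) (fst p))"
  shows "polyf A enc_bool (\<lambda>s. walk_search F D c (K s) (ok s) (L s) (d s) (vs s) (xs s))"
  unfolding walk_search_def
  by (rule L K polyf_candidates[where X = X] ok polyf_intros polyf_comp[OF _ xs]
      polyf_comp[OF _ assms(1)] polyf_comp[OF _ assms(2)] xs)+

section \<open>Prescribed frequencies and gaps\<close>

fun periodic :: "nat \<Rightarrow> nat \<Rightarrow> nat list \<Rightarrow> nat list" where
  "periodic 0 N ts = []"
| "periodic (Suc n) N ts = ts @ map (\<lambda>t. N + t) (periodic n N ts)"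

lemma polyf_periodic [polyf_intros]:
  assumes N: "polyf A enc_unary N" and ts: "polyf A (enc_list enc_unary) ts"
  shows "polyf A (enc_list enc_unary) (\<lambda>s. periodic n (N s) (ts s))"
proof (induction n)
  case (Suc n)
  show ?case unfolding periodic.simps by (rule Suc ts polyf_intros polyf_comp[OF _ N])+
qed (simp add: polyf_const)

lemma length_periodic: "length (periodic n N ts) = n * length ts"
  by (induction n) auto

lemma nth_periodic: "y < n * length ts \<Longrightarrow>
  periodic n N ts ! y = ts ! (y mod length ts) + (y div length ts) * N"
proof (induction n arbitrary: y)
  case (Suc n)
  show ?case
  proof (cases "y < length ts")
    case False
    then have "y - length ts < n * length ts" "0 < length ts" using Suc.prems by (auto simp: algebra_simps)
    with False Suc.IH[of "y - length ts"] show ?thesis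
      by (simp add: nth_append length_periodic le_mod_geq le_div_geq)
  qed (simp add: nth_append)
qed simp

text \<open>Writing out the rounds replaces \<open>div\<close> and \<open>mod\<close>. With at least
  one traversal per round, \<open>Suc F\<close> rounds contain the first \<open>F + 1\<close>
  traversals. The index \<open>i\<close> counts from 0, the traversals of \<open>cyclic_gap\<close>
  from 1.\<close>

definition gap_at :: "nat \<Rightarrow> nat \<Rightarrow> nat list \<Rightarrow> nat \<Rightarrow> nat" where
  "gap_at F N ts i =
    nth_default 0 (periodic (Suc F) N ts) (Suc i) - nth_default 0 (periodic (Suc F) N ts) i"

lemma gap_at_positions:
  assumes "positions a w \<noteq> []" "i < F"
  shows "gap_at F (length w) (positions a w) i = cyclic_gap a w (Suc i)"
proof -
  let ?k = "length (positions a w)"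
  have "0 < ?k" using assms(1) by simp
  then have *: "Suc F \<le> Suc F * ?k" by (cases ?k) auto
  have "Suc i < Suc F" using assms(2) by simp
  from this * have "Suc i < Suc F * ?k" by (rule less_le_trans)
  then show ?thesis
    using nth_periodic[of i "Suc F" "positions a w" "length w"]
      nth_periodic[of "Suc i" "Suc F" "positions a w" "length w"]
    by (simp add: gap_at_def nth_default_nth length_periodic cyclic_gap_def cyclic_position_def Let_def
        del: periodic.simps)
qed

text \<open>The test \<open>clip k g = k\<close> compares the unary \<open>k\<close> with the binary \<open>g\<close>.\<close>

definition times_ok :: "bool \<Rightarrow> nat \<Rightarrow> nat \<Rightarrow> nat \<times> nat list \<Rightarrow> nat list \<Rightarrow> bool" where
  "times_ok exact F N x ts \<longleftrightarrow>
    length ts \<le> clip F (fst x) \<and> (exact \<longrightarrow> length ts = clip F (fst x)) \<and>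
    (\<forall>i\<in>set [0..<clip F (fst x)].
      ts \<noteq> [] \<and> clip (gap_at F N ts i) (nth_default 0 (snd x) i) = gap_at F N ts i)"

lemma polyf_gap_at [polyf_intros]:
  assumes "polyf A enc_unary N" "polyf A (enc_list enc_unary) ts" "polyf A enc_unary i"
  shows "polyf A enc_unary (\<lambda>s. gap_at F (N s) (ts s) (i s))"
  unfolding gap_at_def by (rule assms polyf_intros)+

lemma polyf_times_ok [polyf_intros]:
  assumes "polyf A enc_unary N" "polyf A (enc_prod enc_nat (enc_list enc_nat)) x"
    "polyf A (enc_list enc_unary) ts"
  shows "polyf A enc_bool (\<lambda>s. times_ok exact F (N s) (x s) (ts s))"
  unfolding times_ok_def
  by (rule assms polyf_intros inj_encs polyf_comp[OF _ assms(1)] polyf_comp[OF _ assms(2)]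
      polyf_comp[OF _ assms(3)])+

lemma times_ok_positions:
  assumes f: "f \<le> F"
  shows "times_ok exact F (length w) (f, map g [1..<F + 1]) (positions a w) \<longleftrightarrow>
    count_list w a \<le> f \<and> (exact \<longrightarrow> count_list w a = f) \<and>
    (\<forall>y\<in>{1..f}. a \<in> set w \<and> cyclic_gap a w y \<le> g y)"
proof -
  have ne: "positions a w \<noteq> [] \<longleftrightarrow> a \<in> set w"
    using set_positions[of a w] by (auto simp: in_set_conv_nth set_empty[symmetric] simp del: set_empty)
  have clip: "clip F f = f" using f by (simp add: clip_def)
  have le: "clip k m = k \<longleftrightarrow> k \<le> m" for k m by (auto simp: clip_def min_def)
  have g: "nth_default 0 (map g [1..<F + 1]) i = g (Suc i)" if "i < f" for i
    using that f by (simp add: nth_default_nth del: upt_Suc)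
  have "(\<forall>i\<in>set [0..<f]. positions a w \<noteq> [] \<and>
      gap_at F (length w) (positions a w) i \<le> nth_default 0 (map g [1..<F + 1]) i) \<longleftrightarrow>
    (\<forall>i<f. a \<in> set w \<and> cyclic_gap a w (Suc i) \<le> g (Suc i))"
    using g gap_at_positions[of a w _ F] f ne by (auto simp del: upt_Suc)
  also have "\<dots> \<longleftrightarrow> (\<forall>y\<in>{1..f}. a \<in> set w \<and> cyclic_gap a w y \<le> g y)"
    by (auto simp: Ball_def) (metis One_nat_def Suc_le_D Suc_le_eq)+
  finally show ?thesis unfolding times_ok_def fst_conv snd_conv clip le length_positions by simp
qed

text \<open>The last arc arrives at the depot, and, there being no loops, it does not also depart
  from there. So every departure is followed by an arrival, and \<open>K = length w\<close> excludes
  nothing.\<close>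

lemma returns_within_trivial:
  assumes T: "is_rooted_tree T" and w: "closed_walk_from_depot T w"
  shows "returns_within (depot T) (length w) w"
  unfolding returns_within_def
proof (intro allI impI)
  fix i assume i: "i < length w" "fst (w ! i) = depot T"
  note cw = w[unfolded closed_walk_iff[OF T]]
  have "w ! i \<in> arcs_of T" using cw i by auto
  then have "fst (w ! i) \<noteq> snd (w ! i)" using arcs_of_verts(3)[OF T, of "fst (w ! i)" "snd (w ! i)"] by simp
  moreover have last: "snd (w ! (length w - 1)) = depot T" using cw i by (auto simp: last_conv_nth)
  ultimately have "i \<noteq> length w - 1" using i by auto
  then show "\<exists>j<length w. i < j \<and> j \<le> Suc (i + length w) \<and> snd (w ! j) = depot T"
    using last i by (intro exI[of _ "length w - 1"]) auto
qed

type_synonym walk_data = "nat \<times> nat list \<times> ((nat \<times> nat) \<times> nat \<times> nat list) list"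

abbreviation enc_walk_data :: "walk_data \<Rightarrow> data" where
  "enc_walk_data \<equiv> enc_prod enc_nat (enc_prod (enc_list enc_nat)
    (enc_list (enc_prod (enc_prod enc_nat enc_nat) (enc_prod enc_nat (enc_list enc_nat)))))"

text \<open>What the encoding reveals of the record, with functions on edges turned into tables. The
  decision procedure has to be a function of this value for the closure rules to apply.\<close>

definition walk_data :: "nat \<Rightarrow> walk_input \<Rightarrow> walk_data" where
  "walk_data F X = (depot X, vertex_list X,
    map (\<lambda>(u, v). ((u, v), freq X {u, v}, map (gap X {u, v}) [1..<F + 1])) (edge_list X))"

definition decide_walk :: "bool \<Rightarrow> nat \<Rightarrow> nat \<Rightarrow> walk_data \<Rightarrow> bool" where
  "decide_walk exact F D s = walk_search F D (2 * F) (\<lambda>N. N) (times_ok exact F) (\<lambda>N. True)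
    (fst s) (fst (snd s)) (snd (snd s))"

lemma enc_list_map: "enc_list A (map f xs) = enc_list (\<lambda>x. A (f x)) xs"
  by (induction xs) auto

lemma enc_walk_data: "enc_walk_input F X = enc_walk_data (walk_data F X)"
  by (simp add: enc_walk_input_def walk_data_def enc_list_map split_def enc_prod_def del: upt_Suc)

lemma polyf_decide_walk: "polyf enc_walk_data enc_bool (decide_walk exact F D)"
  unfolding decide_walk_def[abs_def] by (rule polyf_walk_search polyf_intros)+

lemma decide_walk_iff:
  assumes "X \<in> walk_instances F D"
  shows "decide_walk exact F D (walk_data F X) \<longleftrightarrow>
    (\<exists>w. closed_walk_from_depot X w \<and>
      (\<forall>(u, v)\<in>arcs_of X. count_list w (u, v) \<le> freq X {u, v} \<and>
        (exact \<longrightarrow> count_list w (u, v) = freq X {u, v})) \<and> gaps_ok X w)"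
proof -
  have X: "is_rooted_tree X" "max_degree_le D X" and f: "\<And>e. e \<in> edges X \<Longrightarrow> freq X e \<le> F"
    using assms by (auto simp: walk_instances_def)
  have arc: "freq X {u, v} \<le> F" if "(u, v) \<in> arcs_of X" for u v
    using f that by (simp add: sym_orient_def)
  have eq: "(\<forall>(u, v)\<in>arcs_of X. times_ok exact F (length w)
        (freq X {u, v}, map (gap X {u, v}) [1..<F + 1]) (positions (u, v) w)) \<longleftrightarrow>
      (\<forall>(u, v)\<in>arcs_of X. count_list w (u, v) \<le> freq X {u, v} \<and>
        (exact \<longrightarrow> count_list w (u, v) = freq X {u, v})) \<and> gaps_ok X w" for w
  proof -
    have "(\<forall>(u, v)\<in>arcs_of X. times_ok exact F (length w)
        (freq X {u, v}, map (gap X {u, v}) [1..<F + 1]) (positions (u, v) w)) \<longleftrightarrow>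
      (\<forall>(u, v)\<in>arcs_of X. count_list w (u, v) \<le> freq X {u, v} \<and>
        (exact \<longrightarrow> count_list w (u, v) = freq X {u, v}) \<and>
        (\<forall>y\<in>{1..freq X {u, v}}. (u, v) \<in> set w \<and> cyclic_gap (u, v) w y \<le> gap X {u, v} y))"
      by (rule ball_cong[OF refl]) (auto simp only: split_paired_all split_conv times_ok_positions[OF arc])
    then show ?thesis unfolding gaps_ok_def by auto
  qed
  show ?thesis
    unfolding decide_walk_def walk_data_def fst_conv snd_conv
    by (subst walk_search_iff[OF X refl refl, where F = F]; (simp only: eq)?)
      (auto simp: times_ok_def clip_def returns_within_trivial[OF X(1)])
qed

text \<open>\<open>g\<close> is computed on all values of the encoded type and has to match
  \<open>Q\<close> on the instances only.\<close>

lemma polytime_decidableI: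
  assumes "polyf A enc_bool g" and "\<And>x. x \<in> I \<Longrightarrow> enc x = A (f x)" and "\<And>x. x \<in> I \<Longrightarrow> g (f x) \<longleftrightarrow> Q x"
  shows "polytime_decidable I enc Q"
proof -
  obtain P q where "\<And>y. \<exists>v n. eval P [A y] (Call 0 (Var 0)) v n \<and> n \<le> poly q (size (A y)) \<and>
      (v \<noteq> Leaf \<longleftrightarrow> g y)"
    using polyf_polytime[OF assms(1)] by blast
  then show ?thesis unfolding polytime_decidable_def using assms(2,3)
    by (intro exI[of _ P] exI[of _ q] ballI) metis
qed

lemma polytime_exact_walk:
  "polytime_decidable (walk_instances F D) (enc_walk_input F) (\<lambda>X. \<exists>w. exact_walk X w)"
proof (rule polytime_decidableI[OF polyf_decide_walk[of True F D]])
  fix X assume "X \<in> walk_instances F D"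
  from decide_walk_iff[OF this, of True]
  show "decide_walk True F D (walk_data F X) \<longleftrightarrow> (\<exists>w. exact_walk X w)"
    unfolding exact_walk_def by (auto simp: case_prod_beta)
qed (rule enc_walk_data)

lemma polytime_at_most_walk:
  "polytime_decidable (walk_instances F D) (enc_walk_input F) (\<lambda>X. \<exists>w. at_most_walk X w)"
proof (rule polytime_decidableI[OF polyf_decide_walk[of False F D]])
  fix X assume "X \<in> walk_instances F D"
  from decide_walk_iff[OF this, of False]
  show "decide_walk False F D (walk_data F X) \<longleftrightarrow> (\<exists>w. at_most_walk X w)"
    unfolding at_most_walk_def by simp
qed (rule enc_walk_data)

section \<open>Vehicle routes\<close>

definition ratio :: "nat \<times> nat \<Rightarrow> rat" where
  "ratio x = of_nat (fst x) / of_nat (snd x)"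

text \<open>A negative numerator turns into 0, so the pair represents \<open>r\<close> only for
  \<open>0 \<le> r\<close>.\<close>

definition rat_pair :: "rat \<Rightarrow> nat \<times> nat" where
  "rat_pair r = (case quotient_of r of (a, b) \<Rightarrow> (nat a, nat b))"

lemma enc_rat_pair: "enc_rat r = enc_prod enc_nat enc_nat (rat_pair r)"
  by (simp add: enc_rat_def rat_pair_def split_def)

lemma snd_rat_pair_pos: "0 < snd (rat_pair r)"
  using quotient_of_denom_pos'[of r] by (simp add: rat_pair_def split_def)

lemma ratio_rat_pair:
  assumes "0 \<le> r" shows "ratio (rat_pair r) = r"
proof -
  obtain a b where ab: "quotient_of r = (a, b)" by fastforce
  have "0 < b" using ab by (rule quotient_of_denom_pos)
  moreover have r: "r = of_int a / of_int b" using ab by (rule quotient_of_div)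
  ultimately have "0 \<le> a" using assms by (simp add: zero_le_divide_iff)
  with \<open>0 < b\<close> have "ratio (nat a, nat b) = r" unfolding r by (simp add: ratio_def)
  then show ?thesis by (simp add: rat_pair_def ab)
qed

text \<open>The inequality \<open>k \<le> x * y\<close> for fractions, cleared of denominators. The
  unary factor \<open>k\<close> is realised by repeating the list of exponents \<open>k\<close>
  times.\<close>

definition le_mult :: "nat \<Rightarrow> nat \<times> nat \<Rightarrow> nat \<times> nat \<Rightarrow> bool" where
  "le_mult k x y \<longleftrightarrow> pow2_le
    (concat (map (\<lambda>_. exponents_mult (exponents (snd x)) (exponents (snd y))) [0..<k]))
    (exponents_mult (exponents (fst x)) (exponents (fst y)))"

lemma le_mult_iff:
  assumes "0 < snd x" "0 < snd y"
  shows "le_mult k x y \<longleftrightarrow> of_nat k \<le> ratio x * ratio y"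
proof -
  have "sum_pow2 (concat (map (\<lambda>_. es) [0..<k])) = k * sum_pow2 es" for es
    by (induction k) auto
  then have "le_mult k x y \<longleftrightarrow> k * (snd x * snd y) \<le> fst x * fst y"
    by (simp add: le_mult_def pow2_le_iff)
  also have "\<dots> \<longleftrightarrow> (of_nat (k * (snd x * snd y)) :: rat) \<le> of_nat (fst x * fst y)"
    by (rule of_nat_le_iff[symmetric])
  also have "\<dots> \<longleftrightarrow> of_nat k \<le> ratio x * ratio y"
    using assms by (simp add: ratio_def field_simps)
  finally show ?thesis .
qed

lemma le_mult_rat_pair:
  assumes "0 \<le> r" "0 \<le> r'"
  shows "le_mult k (rat_pair r) (rat_pair r') \<longleftrightarrow> of_nat k \<le> r * r'"
  using assms by (simp add: le_mult_iff snd_rat_pair_pos ratio_rat_pair)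

lemma polyf_le_mult [polyf_intros]:
  assumes "polyf A enc_unary k" "polyf A (enc_prod enc_nat enc_nat) x" "polyf A (enc_prod enc_nat enc_nat) y"
  shows "polyf A enc_bool (\<lambda>s. le_mult (k s) (x s) (y s))"
  unfolding le_mult_def
  by (rule assms polyf_intros polyf_comp[OF _ assms(2)] polyf_comp[OF _ assms(3)])+

text \<open>Priorities start at 1 and come in binary: clipping at the number of rows makes them
  unary, and \<open>- 1\<close> turns them into an index. Gaps do not wrap around here, hence
  \<open>length ts - 1\<close> of them.\<close>

definition route_times_ok :: "nat \<Rightarrow> (nat \<times> nat) list list \<Rightarrow> nat \<times> nat \<Rightarrow> nat \<times> nat \<Rightarrow> nat list \<Rightarrow> bool" where
  "route_times_ok F tab L x ts \<longleftrightarrow> 1 \<le> length ts \<and> length ts \<le> clip F (fst x) \<and>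
    (\<forall>i\<in>set [0..<length ts - 1]. le_mult (nth_default 0 ts (Suc i) - nth_default 0 ts i)
      (nth_default (0, 0) (nth_default [] tab (clip (length tab) (snd x) - 1)) i) L)"

lemma polyf_route_times_ok [polyf_intros]:
  assumes "polyf A (enc_list (enc_list (enc_prod enc_nat enc_nat))) tab" "polyf A (enc_prod enc_nat enc_nat) L"
    "polyf A (enc_prod enc_nat enc_nat) x" "polyf A (enc_list enc_unary) ts"
  shows "polyf A enc_bool (\<lambda>s. route_times_ok F (tab s) (L s) (x s) (ts s))"
  unfolding route_times_ok_def
  by (rule assms polyf_intros polyf_comp[OF _ assms(1)] polyf_comp[OF _ assms(2)]
      polyf_comp[OF _ assms(3)] polyf_comp[OF _ assms(4)])+

type_synonym vehicle_data = "nat \<times> nat list \<times> ((nat \<times> nat) \<times> nat \<times> nat) list \<times>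
  (nat \<times> nat) list list \<times> (nat \<times> nat) \<times> (nat \<times> nat)"

abbreviation enc_vehicle_data :: "vehicle_data \<Rightarrow> data" where
  "enc_vehicle_data \<equiv> enc_prod enc_nat (enc_prod (enc_list enc_nat) (enc_prod
    (enc_list (enc_prod (enc_prod enc_nat enc_nat) (enc_prod enc_nat enc_nat)))
    (enc_prod (enc_list (enc_list (enc_prod enc_nat enc_nat)))
      (enc_prod (enc_prod enc_nat enc_nat) (enc_prod enc_nat enc_nat)))))"

definition time_table :: "nat \<Rightarrow> vehicle_input \<Rightarrow> (nat \<times> nat) list list" where
  "time_table F X = map (\<lambda>q. map (\<lambda>i. rat_pair (time_frac X q i)) [1..<F + 1]) [1..<num_prio X + 1]"

definition vehicle_data :: "nat \<Rightarrow> vehicle_input \<Rightarrow> vehicle_data" where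
  "vehicle_data F X = (depot X, vertex_list X,
    map (\<lambda>(u, v). ((u, v), freq X {u, v}, prio X {u, v})) (edge_list X),
    time_table F X, rat_pair (max_length X), rat_pair (capacity X))"

lemma enc_vehicle_data: "enc_vehicle_input F X = enc_vehicle_data (vehicle_data F X)"
  by (simp add: enc_vehicle_input_def vehicle_data_def time_table_def enc_list_map split_def enc_prod_def
      enc_rat_pair del: upt_Suc)

text \<open>This is the minimum of \<open>N\<close> and the floor of the product of the two
  fractions. The product may be exponentially large, but beyond the length of the walk its exact
  value makes no difference.\<close>

definition range_bound :: "nat \<times> nat \<Rightarrow> nat \<times> nat \<Rightarrow> nat \<Rightarrow> nat" where
  "range_bound c L N = length (filter (\<lambda>k. le_mult (Suc k) c L) [0..<N])"

lemma polyf_range_bound [polyf_intros]: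
  assumes "polyf A (enc_prod enc_nat enc_nat) c" "polyf A (enc_prod enc_nat enc_nat) L" "polyf A enc_unary N"
  shows "polyf A enc_unary (\<lambda>s. range_bound (c s) (L s) (N s))"
  unfolding range_bound_def
  by (rule assms polyf_intros polyf_comp[OF _ assms(1)] polyf_comp[OF _ assms(2)])+

text \<open>The pair \<open>(1, 1)\<close> is the fraction 1, so the bound on the length uses the
  same comparison as the other conditions.\<close>

definition decide_route :: "nat \<Rightarrow> nat \<Rightarrow> vehicle_data \<Rightarrow> bool" where
  "decide_route F D s = walk_search F D (2 * F)
    (range_bound (snd (snd (snd (snd (snd s))))) (fst (snd (snd (snd (snd s))))))
    (\<lambda>N. route_times_ok F (fst (snd (snd (snd s)))) (fst (snd (snd (snd (snd s))))))
    (\<lambda>N. le_mult N (fst (snd (snd (snd (snd s))))) (1, 1))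
    (fst s) (fst (snd s)) (fst (snd (snd s)))"

lemma polyf_decide_route: "polyf enc_vehicle_data enc_bool (decide_route F D)"
  unfolding decide_route_def[abs_def] by (rule polyf_walk_search polyf_intros)+

lemma range_bound_iff:
  assumes "0 \<le> c" "0 \<le> L" "j \<le> N"
  shows "j \<le> range_bound (rat_pair c) (rat_pair L) N \<longleftrightarrow> of_nat j \<le> c * L"
proof -
  define m where "m = nat \<lfloor>c * L\<rfloor>"
  have m: "of_nat k \<le> c * L \<longleftrightarrow> k \<le> m" for k
  proof -
    have "0 \<le> \<lfloor>c * L\<rfloor>" using assms by simp
    moreover have "(of_nat k :: rat) \<le> c * L \<longleftrightarrow> int k \<le> \<lfloor>c * L\<rfloor>" by (simp add: le_floor_iff)
    ultimately show ?thesis unfolding m_def by linarith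
  qed
  have "filter (\<lambda>k. le_mult (Suc k) (rat_pair c) (rat_pair L)) [0..<N] = filter (\<lambda>k. k < m) [0..<N]"
    using assms by (intro filter_cong refl) (simp only: le_mult_rat_pair m Suc_le_eq)
  then have "range_bound (rat_pair c) (rat_pair L) N = length (filter (\<lambda>k. k < m) [0..<N])"
    by (simp add: range_bound_def)
  also have "\<dots> = card (set (filter (\<lambda>k. k < m) [0..<N]))"
    by (rule distinct_card[symmetric]) simp
  also have "set (filter (\<lambda>k. k < m) [0..<N]) = {..<min m N}" by auto
  finally show ?thesis using m assms(3) by simp
qed

text \<open>A stretch that misses the depot lies between a departure and the next arrival, and the
  arcs strictly between these two form such a stretch. \<open>K\<close> has to match the rational
  bound \<open>B\<close> only up to the length of the walk.\<close>

lemma returns_within_iff: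
  assumes T: "is_rooted_tree T" and w: "closed_walk_from_depot T w"
    and B: "0 \<le> B" and K: "\<And>j. j \<le> length w \<Longrightarrow> j \<le> K \<longleftrightarrow> of_nat j \<le> (B :: rat)"
  shows "returns_within (depot T) K w \<longleftrightarrow>
    (\<forall>s. sublist s w \<and> B < of_nat (length s) \<longrightarrow> depot T \<in> fst ` set s \<union> snd ` set s)"
    (is "?L \<longleftrightarrow> ?R")
proof -
  let ?d = "depot T"
  note cw = w[unfolded closed_walk_iff[OF T]]
  have step: "fst (w ! Suc i) = snd (w ! i)" if "Suc i < length w" for i using cw that by auto
  have init: "fst (w ! 0) = ?d" if "0 < length w" using cw that by auto
  have fin: "snd (w ! (length w - 1)) = ?d" if "0 < length w" using cw that by (auto simp: last_conv_nth)
  have noloop: "fst (w ! i) \<noteq> snd (w ! i)" if "i < length w" for i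
  proof -
    have "w ! i \<in> arcs_of T" using cw nth_mem[OF that] by blast
    then show ?thesis using arcs_of_verts(3)[OF T, of "fst (w ! i)" "snd (w ! i)"] by simp
  qed
  show ?thesis
  proof
    assume L: ?L
    show ?R
    proof (intro allI impI, rule ccontr)
      fix s assume s: "sublist s w \<and> B < of_nat (length s)" and "?d \<notin> fst ` set s \<union> snd ` set s"
      then have nd: "fst (s ! i) \<noteq> ?d \<and> snd (s ! i) \<noteq> ?d" if "i < length s" for i
        using nth_mem[OF that] by (metis UnI1 UnI2 imageI)
      obtain p q where pq: "w = p @ s @ q" using s by (auto simp: sublist_def)
      let ?i = "length p"
      have sw: "w ! (?i + i) = s ! i" if "i < length s" for i using that by (simp add: pq nth_append)
      have len: "?i + length s \<le> length w" by (simp add: pq)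
      have pos: "0 < length s" using s B by (cases s) auto
      have w0: "fst (w ! 0) = ?d" using pos len by (intro init) linarith
      have "?i \<noteq> 0"
      proof
        assume "?i = 0"
        then have "w ! 0 = s ! 0" using sw[OF pos] by simp
        with w0 nd[OF pos] show False by simp
      qed
      \<comment> \<open>The departures before the stretch \<open>s\<close>, of which the last one is
        wanted. Time 0 is among them, as \<open>s\<close> misses the depot and so cannot begin at
        the start of the walk.\<close>
      define M where "M = {i. i < ?i \<and> fst (w ! i) = ?d}"
      have "finite M" "0 \<in> M" using \<open>?i \<noteq> 0\<close> w0 by (auto simp: M_def)
      then have "Max M \<in> M" and le_Max: "\<And>i. i \<in> M \<Longrightarrow> i \<le> Max M" by (auto intro!: Max_in)
      then have a: "Max M < ?i" "fst (w ! Max M) = ?d" by (auto simp: M_def)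
      then obtain j where j: "j < length w" "Max M < j" "j \<le> Suc (Max M + K)" "snd (w ! j) = ?d"
        using L len unfolding returns_within_def by (meson less_le_trans le_add1)
      \<comment> \<open>An earlier arrival \<open>j\<close> is impossible: well before
        \<open>s\<close> it would be followed by a departure later than \<open>Max M\<close>,
        directly before \<open>s\<close> it would make \<open>s\<close> start at the depot, and
        inside \<open>s\<close> it would be a visit.\<close>
      have "?i + length s \<le> j"
      proof (rule ccontr)
        assume "\<not> ?i + length s \<le> j"
        then consider "Suc j < ?i" | "Suc j = ?i" | "?i \<le> j" "j - ?i < length s" by linarith
        then show False
        proof cases
          case 1
          then have "Suc j \<in> M" using step[of j] j len by (simp add: M_def)
          with le_Max[of "Suc j"] j(2) show False by simp
        next
          case 2
          then show False using step[of j] j len pos sw[of 0] nd[of 0] by simp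
        next
          case 3
          then show False using nd[of "j - ?i"] sw[of "j - ?i"] j(4) by simp
        qed
      qed
      then have "length s \<le> K" using a(1) j(3) by linarith
      then show False using K[of "length s"] len s by auto
    qed
  next
    assume R: ?R
    show ?L
      unfolding returns_within_def
    proof (intro allI impI)
      fix i assume i: "i < length w" "fst (w ! i) = ?d"
      define J where "J = {j. i < j \<and> j < length w \<and> snd (w ! j) = ?d}"
      have last: "snd (w ! (length w - 1)) = ?d" using i(1) by (intro fin) linarith
      then have "i \<noteq> length w - 1" using noloop[OF i(1)] i(2) by auto
      then have "length w - 1 \<in> J" using i(1) last by (auto simp: J_def)
      then have "Min J \<in> J" by (intro Min_in) (auto simp: J_def)
      then have j: "i < Min J" "Min J < length w" "snd (w ! Min J) = ?d" by (auto simp: J_def)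
      have least: "Min J \<le> k" if "k \<in> J" for k by (rule Min_le) (use that in \<open>auto simp: J_def\<close>)
      have "Min J \<le> Suc (i + K)"
      proof (rule ccontr)
        assume far: "\<not> Min J \<le> Suc (i + K)"
        \<comment> \<open>The arcs strictly between the departure \<open>i\<close> and the first
          later arrival; there are more than \<open>K\<close> of them.\<close>
        let ?s = "take (Min J - Suc i) (drop (Suc i) w)"
        have len: "length ?s = Min J - Suc i" using j by simp
        have "drop (Suc i) w = ?s @ drop (Min J - Suc i) (drop (Suc i) w)"
          by (rule append_take_drop_id[symmetric])
        then have "w = take (Suc i) w @ ?s @ drop (Min J - Suc i) (drop (Suc i) w)"
          by (metis append_take_drop_id)
        then have "sublist ?s w" unfolding sublist_def by blast
        moreover have "B < of_nat (length ?s)"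
        proof -
          have "length ?s \<le> length w" "\<not> length ?s \<le> K" unfolding len using far j by linarith+
          then show ?thesis using K[of "length ?s"] by (simp only: not_le simp_thms)
        qed
        ultimately have "?d \<in> fst ` set ?s \<union> snd ` set ?s" using R by blast
        then obtain m where m: "m < length ?s" "fst (?s ! m) = ?d \<or> snd (?s ! m) = ?d"
          by (auto simp: in_set_conv_nth)
        define k where "k = Suc i + m"
        have k: "i < k" "k < Min J" "fst (w ! k) = ?d \<or> snd (w ! k) = ?d"
          using m len j by (auto simp: k_def)
        from k(3) show False
        proof
          assume "snd (w ! k) = ?d"
          then have "k \<in> J" using k j by (simp add: J_def)
          then show False using least k(2) by (simp add: not_le[symmetric])
        next
          assume "fst (w ! k) = ?d"
          \<comment> \<open>An arc of the stretch that departs from the depot follows an arrival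
            there, which either precedes \<open>Min J\<close> in \<open>J\<close> or turns the arc
            at \<open>i\<close> into a loop.\<close>
          then have prev: "snd (w ! (k - 1)) = ?d" using step[of "k - 1"] k j by simp
          show False
          proof (cases "k - 1 = i")
            case True
            then show False using prev noloop[OF i(1)] i(2) by simp
          next
            case False
            then have "i < k - 1" "k - 1 < length w" using k(1,2) j(2) by linarith+
            then have "k - 1 \<in> J" using prev unfolding J_def by blast
            then show False using least[of "k - 1"] k(1,2) by linarith
          qed
        qed
      qed
      with j show "\<exists>j<length w. i < j \<and> j \<le> Suc (i + K) \<and> snd (w ! j) = ?d" by blast
    qed
  qed
qed

lemma route_times_ok_positions:
  assumes X: "X \<in> vehicle_instances F D" and e: "e \<in> edges X"
  shows "route_times_ok F (time_table F X) (rat_pair (max_length X)) (freq X e, prio X e) (positions a w) \<longleftrightarrow>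
    1 \<le> count_list w a \<and> count_list w a \<le> freq X e \<and>
    (\<forall>i\<in>{1..<count_list w a}. of_nat (positions a w ! i - positions a w ! (i - 1))
        \<le> time_frac X (prio X e) i * max_length X)"
proof -
  let ?ts = "positions a w" and ?p = "prio X e"
  have f: "freq X e \<le> F" and p: "?p \<in> {1..num_prio X}"
    and t: "\<And>i. 1 \<le> i \<Longrightarrow> 0 < time_frac X ?p i" and L: "0 \<le> max_length X"
    using X e by (auto simp: vehicle_instances_def)
  have clip_f: "clip F (freq X e) = freq X e" using f by (simp add: clip_def)
  have row: "nth_default [] (time_table F X) (clip (length (time_table F X)) ?p - 1)
    = map (\<lambda>i. rat_pair (time_frac X ?p i)) [1..<F + 1]"
  proof -
    have "?p - 1 < num_prio X" "Suc (?p - 1) = ?p" "min (num_prio X) ?p = ?p" using p by auto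
    then show ?thesis by (simp add: time_table_def clip_def nth_default_nth del: upt_Suc)
  qed
  have "(\<forall>i\<in>set [0..<length ?ts - 1]. le_mult (nth_default 0 ?ts (Suc i) - nth_default 0 ?ts i)
      (nth_default (0, 0) (map (\<lambda>i. rat_pair (time_frac X ?p i)) [1..<F + 1]) i) (rat_pair (max_length X)))
    \<longleftrightarrow> (\<forall>i\<in>set [0..<length ?ts - 1]. of_nat (?ts ! Suc i - ?ts ! i)
        \<le> time_frac X ?p (Suc i) * max_length X)" if "length ?ts \<le> F"
  proof (rule ball_cong[OF refl])
    fix i assume "i \<in> set [0..<length ?ts - 1]"
    then have i: "Suc i < length ?ts" "i < F" using that by auto
    then have "nth_default (0, 0) (map (\<lambda>i. rat_pair (time_frac X ?p i)) [1..<F + 1]) i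
      = rat_pair (time_frac X ?p (Suc i))"
      by (simp add: nth_default_nth del: upt_Suc)
    then show "le_mult (nth_default 0 ?ts (Suc i) - nth_default 0 ?ts i)
      (nth_default (0, 0) (map (\<lambda>i. rat_pair (time_frac X ?p i)) [1..<F + 1]) i) (rat_pair (max_length X))
      \<longleftrightarrow> of_nat (?ts ! Suc i - ?ts ! i) \<le> time_frac X ?p (Suc i) * max_length X"
      using le_mult_rat_pair[of "time_frac X ?p (Suc i)" "max_length X"] t[of "Suc i"] L i
      by (simp add: nth_default_nth)
  qed
  note le_mult = this
  have "(\<forall>i\<in>set [0..<length ?ts - 1]. Q (Suc i) i) \<longleftrightarrow> (\<forall>i\<in>{1..<length ?ts}. Q i (i - 1))" for Q
  proof (intro iffI ballI)
    fix i assume "\<forall>i\<in>set [0..<length ?ts - 1]. Q (Suc i) i" "i \<in> {1..<length ?ts}"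
    then show "Q i (i - 1)" by (cases i) auto
  next
    fix i assume *: "\<forall>i\<in>{1..<length ?ts}. Q i (i - 1)" "i \<in> set [0..<length ?ts - 1]"
    then show "Q (Suc i) i" by (auto dest!: bspec[of _ _ "Suc i"])
  qed
  note reindex = this[of "\<lambda>i j. of_nat (?ts ! i - ?ts ! j) \<le> time_frac X ?p i * max_length X"]
  show ?thesis
  \<comment> \<open>The table has \<open>F\<close> columns, so its entries are meaningful only for
    lists within the frequency bound; for longer lists both sides fail at that bound.\<close>
  proof (cases "length ?ts \<le> freq X e")
    case True
    with f have "length ?ts \<le> F" by simp
    then show ?thesis
      unfolding route_times_ok_def fst_conv snd_conv clip_f row le_mult[OF \<open>length ?ts \<le> F\<close>] reindex
      by (simp only: length_positions)
  next
    case False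
    then show ?thesis by (simp add: route_times_ok_def clip_f length_positions)
  qed
qed

lemma decide_route_iff:
  assumes X: "X \<in> vehicle_instances F D"
  shows "decide_route F D (vehicle_data F X) \<longleftrightarrow> (\<exists>w. vehicle_route X w)"
proof -
  have T: "is_rooted_tree X" "max_degree_le D X" and f: "\<And>e. e \<in> edges X \<Longrightarrow> freq X e \<le> F"
    and L: "0 \<le> max_length X" and c: "0 \<le> capacity X"
    using X by (auto simp: vehicle_instances_def)
  let ?K = "range_bound (rat_pair (capacity X)) (rat_pair (max_length X))"
  have len: "le_mult N (rat_pair (max_length X)) (1, 1) \<longleftrightarrow> of_nat N \<le> max_length X" for N
    using L by (simp add: le_mult_iff snd_rat_pair_pos ratio_rat_pair) (simp add: ratio_def)
  have arcs: "(\<forall>(u, v)\<in>arcs_of X. route_times_ok F (time_table F X) (rat_pair (max_length X))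
        (freq X {u, v}, prio X {u, v}) (positions (u, v) w)) \<longleftrightarrow>
    (\<forall>(u, v)\<in>arcs_of X. 1 \<le> count_list w (u, v) \<and> count_list w (u, v) \<le> freq X {u, v}) \<and>
    (\<forall>(u, v)\<in>arcs_of X. \<forall>i\<in>{1..<count_list w (u, v)}.
      of_nat (positions (u, v) w ! i - positions (u, v) w ! (i - 1))
        \<le> time_frac X (prio X {u, v}) i * max_length X)" for w
  proof -
    have "(\<forall>(u, v)\<in>arcs_of X. route_times_ok F (time_table F X) (rat_pair (max_length X))
        (freq X {u, v}, prio X {u, v}) (positions (u, v) w)) \<longleftrightarrow>
      (\<forall>(u, v)\<in>arcs_of X. 1 \<le> count_list w (u, v) \<and> count_list w (u, v) \<le> freq X {u, v} \<and>
       (\<forall>i\<in>{1..<count_list w (u, v)}. of_nat (positions (u, v) w ! i - positions (u, v) w ! (i - 1))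
        \<le> time_frac X (prio X {u, v}) i * max_length X))"
    proof (rule ball_cong[OF refl])
      fix a assume a: "a \<in> arcs_of X"
      obtain u v where uv: "a = (u, v)" by fastforce
      have "{u, v} \<in> edges X" using a by (simp add: uv sym_orient_def)
      from route_times_ok_positions[OF X this]
      show "(case a of (u, v) \<Rightarrow> route_times_ok F (time_table F X) (rat_pair (max_length X))
          (freq X {u, v}, prio X {u, v}) (positions (u, v) w)) \<longleftrightarrow>
        (case a of (u, v) \<Rightarrow> 1 \<le> count_list w (u, v) \<and> count_list w (u, v) \<le> freq X {u, v} \<and>
         (\<forall>i\<in>{1..<count_list w (u, v)}. of_nat (positions (u, v) w ! i - positions (u, v) w ! (i - 1))
          \<le> time_frac X (prio X {u, v}) i * max_length X))"
        unfolding uv split_conv .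
    qed
    then show ?thesis by auto
  qed
  have returns: "returns_within (depot X) (?K (length w)) w \<longleftrightarrow>
    (\<forall>s. sublist s w \<and> capacity X * max_length X < of_nat (length s) \<longrightarrow>
      depot X \<in> fst ` set s \<union> snd ` set s)" if "closed_walk_from_depot X w" for w
    by (rule returns_within_iff[OF T(1) that]) (use L c range_bound_iff in auto)
  have "decide_route F D (vehicle_data F X) \<longleftrightarrow>
    (\<exists>w. closed_walk_from_depot X w \<and> le_mult (length w) (rat_pair (max_length X)) (1, 1) \<and>
      (\<forall>(u, v)\<in>arcs_of X. route_times_ok F (time_table F X) (rat_pair (max_length X))
        (freq X {u, v}, prio X {u, v}) (positions (u, v) w)) \<and>
      returns_within (depot X) (?K (length w)) w)"
    unfolding decide_route_def vehicle_data_def fst_conv snd_conv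
    by (rule walk_search_iff[OF T refl refl]) (auto simp: route_times_ok_def clip_def)
  also have "\<dots> \<longleftrightarrow> (\<exists>w. vehicle_route X w)"
    unfolding arcs len vehicle_route_def
    by (rule ex_cong1, rule iffI; elim conjE; intro conjI; (assumption | simp only: returns))
  finally show ?thesis .
qed

lemma polytime_vehicle_route:
  "polytime_decidable (vehicle_instances F D) (enc_vehicle_input F) (\<lambda>X. \<exists>w. vehicle_route X w)"
  by (rule polytime_decidableI[OF polyf_decide_route[of F D]]) (rule enc_vehicle_data decide_route_iff; assumption?)+

theorem theorem5:
  fixes F D :: nat
  shows "polytime_decidable (walk_instances F D) (enc_walk_input F) (\<lambda>X. \<exists>w. exact_walk X w) \<and>
    polytime_decidable (walk_instances F D) (enc_walk_input F) (\<lambda>X. \<exists>w. at_most_walk X w) \<and>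
    polytime_decidable (vehicle_instances F D) (enc_vehicle_input F) (\<lambda>X. \<exists>w. vehicle_route X w)"
  by (intro conjI polytime_exact_walk polytime_at_most_walk polytime_vehicle_route)

end
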